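(* Suppose $X$ is convex, $c$ is proper and $c(x,\cdot):X\to[0,\infty)$ is convex for every $x\in X$. Let $\ell\in\mathcal G_{c^N}(X^N)$ be upper semi-continuous and concave. Then $$S(\ell)=\sup_{\bar P\in\mathcal U_\infty}\mathbb E_{\bar P}\ell.$$ If additionally $\ell\in\mathcal G^<_{c^N}(X^N)$, then $S(\ell)=\lim_{M\to\infty}U^{\mathrm{sym}}_M(\ell)$.
   Context: $X$ is a nonempty closed subset of $\mathbb R^d$ (here assumed convex). $c$ is a transportation cost (lower semi-continuous, symmetric, $c(x,x)=0$); proper means $c(x,y)\le K(c(x,z)+c(z,y))$ for some $K>0$ and compact sublevel sets $\{x:c(x_0,x)\le r\}$. $\hat P$ is a Borel probability measure on $X$ with finite $c$-moment, $\rho>0$, $N\in\mathbb N$; $W_c$ is the optimal transport cost; $\mathbb B^c_\rho(\hat P)$ the set of $P$ with finite $c$-moment and $W_c(P,\hat P)\le\rho$. $S(\ell)=\sup_{P\in\mathbb B^c_\rho(\hat P)}\int\ell\,dP^{\otimes N}$. For $M\ge N$: $c^M(x,y)=\sum_{i\le M}c(x_i,y_i)$; $\mathbb B^{c^M}_{M\rho}(\hat P^{\otimes M})$ the set of measures on $X^M$ with finite $c^M$-moment and $W_{c^M}(\cdot,\hat P^{\otimes M})\le M\rho$, with subscript $\mathrm{sym}$ meaning its permutation-invariant elements; $\mathcal U_M=\{(\mathrm{pr}^M_{1:N})_\#\bar P:\bar P\in\mathbb B^{c^M}_{M\rho}(\hat P^{\otimes M})_{\mathrm{sym}}\}$, $\mathcal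 U_\infty=\bigcap_{M\ge N}\mathcal U_M$; $U^{\mathrm{sym}}_M(\ell)=\sup_{\bar P\in\mathbb B^{c^M}_{M\rho}(\hat P^{\otimes M})}\mathbb E_{\bar P}(\ell\circ\mathrm{pr}^M_{1:N})_{\mathrm{sym}}$ with $g_{\mathrm{sym}}=\frac1{M!}\sum_{\pi\in\mathcal S_M}g\circ\pi$. $\mathcal D$: functions $\delta:[0,\infty)\to[0,\infty)$ with $\delta(r)\le r$, $\delta(r)/r\to0$; $\mathcal G_{c^N}(X^N)=\{\ell:\exists C>0,\hat x,\ \ell\le C(1+c^N(\hat x,\cdot))\}$, $\mathcal G^<_{c^N}(X^N)=\{\ell:\exists C>0,\delta\in\mathcal D,\hat x,\ \ell\le C(1+\delta(c^N(\hat x,\cdot)))\}$. *)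

theory Defs
  imports "HOL-Probability.Probability"
begin

(* Tuples x = (x_0,...,x_{M-1}) in X^M are modelled as extensional functions nat => 'a
   on {..<M}, i.e. elements of PiE {..<M} (\<lambda>_. X). *)
definition tup :: "nat \<Rightarrow> 'a set \<Rightarrow> (nat \<Rightarrow> 'a) set" where
  "tup M X = PiE {..<M} (\<lambda>_. X)"

definition spaceM :: "nat \<Rightarrow> (nat \<Rightarrow> 'a::euclidean_space) measure" where
  "spaceM M = PiM {..<M} (\<lambda>_. borel)"

definition costM :: "nat \<Rightarrow> ('a \<Rightarrow> 'a \<Rightarrow> real) \<Rightarrow> (nat \<Rightarrow> 'a) \<Rightarrow> (nat \<Rightarrow> 'a) \<Rightarrow> real" where
  "costM M c x y = (\<Sum>i<M. c (x i) (y i))"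

definition couplings :: "'b measure \<Rightarrow> 'b measure \<Rightarrow> ('b \<times> 'b) measure set" where
  "couplings A B = {\<pi>. sets \<pi> = sets (A \<Otimes>\<^sub>M B) \<and> distr \<pi> A fst = A \<and> distr \<pi> B snd = B}"

definition OT :: "('b \<Rightarrow> 'b \<Rightarrow> real) \<Rightarrow> 'b measure \<Rightarrow> 'b measure \<Rightarrow> ennreal" where
  "OT c A B = (INF \<pi> \<in> couplings A B. \<integral>\<^sup>+ z. ennreal (c (fst z) (snd z)) \<partial>\<pi>)"

definition probs_on :: "'b measure \<Rightarrow> 'b set \<Rightarrow> 'b measure set" where
  "probs_on S Y = {P. sets P = sets S \<and> prob_space P \<and> emeasure P Y = 1}"

definition finite_moment :: "('b \<Rightarrow> 'b \<Rightarrow> real) \<Rightarrow> 'b set \<Rightarrow> 'b measure \<Rightarrow> bool" where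
  "finite_moment c Y P = (\<exists>x0\<in>Y. (\<integral>\<^sup>+ x. ennreal (c x0 x) \<partial>P) < \<infinity>)"

definition OTball :: "'b measure \<Rightarrow> 'b set \<Rightarrow> ('b \<Rightarrow> 'b \<Rightarrow> real) \<Rightarrow> real \<Rightarrow> 'b measure \<Rightarrow> 'b measure set" where
  "OTball S Y c r Q = {P \<in> probs_on S Y. finite_moment c Y P \<and> OT c P Q \<le> ennreal r}"

definition ext_integral :: "'b measure \<Rightarrow> ('b \<Rightarrow> real) \<Rightarrow> ereal" where
  "ext_integral P f = enn2ereal (\<integral>\<^sup>+ x. ennreal (f x) \<partial>P) - enn2ereal (\<integral>\<^sup>+ x. ennreal (- f x) \<partial>P)"

definition Exp_on :: "'b set \<Rightarrow> 'b measure \<Rightarrow> ('b \<Rightarrow> real) \<Rightarrow> ereal" where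
  "Exp_on Y P f = ext_integral P (\<lambda>x. if x \<in> Y then f x else 0)"

definition prodM :: "nat \<Rightarrow> 'a measure \<Rightarrow> (nat \<Rightarrow> 'a) measure" where
  "prodM N P = PiM {..<N} (\<lambda>_. P)"

definition prN :: "nat \<Rightarrow> (nat \<Rightarrow> 'a) \<Rightarrow> (nat \<Rightarrow> 'a)" where
  "prN N x = restrict x {..<N}"

definition permute :: "nat \<Rightarrow> (nat \<Rightarrow> nat) \<Rightarrow> (nat \<Rightarrow> 'a) \<Rightarrow> (nat \<Rightarrow> 'a)" where
  "permute M \<sigma> x = restrict (x \<circ> \<sigma>) {..<M}"

definition perms :: "nat \<Rightarrow> (nat \<Rightarrow> nat) set" where
  "perms M = {\<sigma>. \<sigma> permutes {..<M}}"

definition symmetric_measure :: "nat \<Rightarrow> (nat \<Rightarrow> 'a::euclidean_space) measure \<Rightarrow> bool" where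
  "symmetric_measure M P = (\<forall>\<sigma>\<in>perms M. distr P (spaceM M) (permute M \<sigma>) = P)"

definition S_val :: "'a::euclidean_space set \<Rightarrow> ('a \<Rightarrow> 'a \<Rightarrow> real) \<Rightarrow> real \<Rightarrow> 'a measure \<Rightarrow> nat
    \<Rightarrow> ((nat \<Rightarrow> 'a) \<Rightarrow> real) \<Rightarrow> ereal" where
  "S_val X c \<rho> Phat N l = (SUP P \<in> OTball borel X c \<rho> Phat. Exp_on (tup N X) (prodM N P) l)"

definition ballM :: "'a::euclidean_space set \<Rightarrow> ('a \<Rightarrow> 'a \<Rightarrow> real) \<Rightarrow> real \<Rightarrow> 'a measure \<Rightarrow> nat
    \<Rightarrow> (nat \<Rightarrow> 'a) measure set" where
  "ballM X c \<rho> Phat M = OTball (spaceM M) (tup M X) (costM M c) (real M * \<rho>) (prodM M Phat)"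

definition U_set :: "'a::euclidean_space set \<Rightarrow> ('a \<Rightarrow> 'a \<Rightarrow> real) \<Rightarrow> real \<Rightarrow> 'a measure \<Rightarrow> nat \<Rightarrow> nat
    \<Rightarrow> (nat \<Rightarrow> 'a) measure set" where
  "U_set X c \<rho> Phat N M = (\<lambda>Pb. distr Pb (spaceM N) (prN N)) `
      {Pb \<in> ballM X c \<rho> Phat M. symmetric_measure M Pb}"

definition U_inf :: "'a::euclidean_space set \<Rightarrow> ('a \<Rightarrow> 'a \<Rightarrow> real) \<Rightarrow> real \<Rightarrow> 'a measure \<Rightarrow> nat
    \<Rightarrow> (nat \<Rightarrow> 'a) measure set" where
  "U_inf X c \<rho> Phat N = (\<Inter>M\<in>{N..}. U_set X c \<rho> Phat N M)"

definition sym_fun :: "nat \<Rightarrow> nat \<Rightarrow> ((nat \<Rightarrow> 'a) \<Rightarrow> real) \<Rightarrow> (nat \<Rightarrow> 'a) \<Rightarrow> real" where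
  "sym_fun N M l x = (\<Sum>\<sigma>\<in>perms M. l (prN N (permute M \<sigma> x))) / fact M"

definition U_sym :: "'a::euclidean_space set \<Rightarrow> ('a \<Rightarrow> 'a \<Rightarrow> real) \<Rightarrow> real \<Rightarrow> 'a measure \<Rightarrow> nat
    \<Rightarrow> ((nat \<Rightarrow> 'a) \<Rightarrow> real) \<Rightarrow> nat \<Rightarrow> ereal" where
  "U_sym X c \<rho> Phat N l M = (SUP Pb \<in> ballM X c \<rho> Phat M. Exp_on (tup M X) Pb (sym_fun N M l))"

definition transport_cost :: "'a::euclidean_space set \<Rightarrow> ('a \<Rightarrow> 'a \<Rightarrow> real) \<Rightarrow> bool" where
  "transport_cost X c \<longleftrightarrow>
     (\<forall>x\<in>X. \<forall>y\<in>X. 0 \<le> c x y \<and> c x y = c y x) \<and> (\<forall>x\<in>X. c x x = 0) \<and>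
     (\<forall>z\<in>X \<times> X. \<forall>t. t < c (fst z) (snd z) \<longrightarrow>
         eventually (\<lambda>w. t < c (fst w) (snd w)) (at z within X \<times> X))"

definition proper_cost :: "'a::euclidean_space set \<Rightarrow> ('a \<Rightarrow> 'a \<Rightarrow> real) \<Rightarrow> bool" where
  "proper_cost X c \<longleftrightarrow>
     (\<exists>K>0. \<forall>x\<in>X. \<forall>y\<in>X. \<forall>z\<in>X. c x y \<le> K * (c x z + c z y)) \<and>
     (\<forall>x0\<in>X. \<forall>r. compact {x\<in>X. c x0 x \<le> r})"

(* upper semicontinuity on a set A (product topology on tuples) *)
definition usc_on :: "'b::topological_space set \<Rightarrow> ('b \<Rightarrow> real) \<Rightarrow> bool" where
  "usc_on A f \<longleftrightarrow> (\<forall>x\<in>A. \<forall>t. f x < t \<longrightarrow> eventually (\<lambda>y. f y < t) (at x within A))"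

definition concave_tup :: "nat \<Rightarrow> 'a::real_vector set \<Rightarrow> ((nat \<Rightarrow> 'a) \<Rightarrow> real) \<Rightarrow> bool" where
  "concave_tup N X l \<longleftrightarrow> (\<forall>x\<in>tup N X. \<forall>y\<in>tup N X. \<forall>t::real. 0 \<le> t \<and> t \<le> 1 \<longrightarrow>
      t * l x + (1 - t) * l y \<le> l (restrict (\<lambda>i. t *\<^sub>R x i + (1 - t) *\<^sub>R y i) {..<N}))"

definition Dfuns :: "(real \<Rightarrow> real) set" where
  "Dfuns = {\<delta>. (\<forall>r\<ge>0. 0 \<le> \<delta> r \<and> \<delta> r \<le> r) \<and> ((\<lambda>r. \<delta> r / r) \<longlongrightarrow> 0) at_top}"

definition growth :: "nat \<Rightarrow> 'a set \<Rightarrow> ('a \<Rightarrow> 'a \<Rightarrow> real) \<Rightarrow> ((nat \<Rightarrow> 'a) \<Rightarrow> real) \<Rightarrow> bool" where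
  "growth N X c l \<longleftrightarrow> (\<exists>C>0. \<exists>xh\<in>tup N X. \<forall>x\<in>tup N X. l x \<le> C * (1 + costM N c xh x))"

definition growth_lt :: "nat \<Rightarrow> 'a set \<Rightarrow> ('a \<Rightarrow> 'a \<Rightarrow> real) \<Rightarrow> ((nat \<Rightarrow> 'a) \<Rightarrow> real) \<Rightarrow> bool" where
  "growth_lt N X c l \<longleftrightarrow> (\<exists>C>0. \<exists>\<delta>\<in>Dfuns. \<exists>xh\<in>tup N X.
      \<forall>x\<in>tup N X. l x \<le> C * (1 + \<delta> (costM N c xh x)))"

end

theory Submission
  imports Defs
begin

text \<open>
  The inequality from left to right holds because a product \<open>P ^ M\<close> lies in the ball around
  \<open>Phat ^ M\<close> (couple coordinatewise). For the converse no compactness of measures is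
  used. Take a nearly optimal coupling \<open>(x, y)\<close> of an \<open>M\<close>-dimensional candidate with
  \<open>Phat ^ M\<close>, symmetrise it over permutations of the coordinates, and replace \<open>x i\<close> by a
  truncated conditional expectation \<open>f (y i) = E[x i | y i]\<close>. By Jensen the cost does not
  increase (up to the truncation). By exchangeability and the independence of the
  \<open>y i\<close>, the variable \<open>x i\<close> is, after conditioning on \<open>y 0, ..., y (N - 1)\<close>, almost a function of
  \<open>y i\<close> alone when \<open>M\<close> is large; since \<open>l\<close> is an infimum of countably many affine functions, this
  gives \<open>E l(x) \<le> E l(f (y 0), ..., f (y (N - 1))) + o(1)\<close>. Midpoint combinations of the maps \<open>f\<close>
  converge almost everywhere to some \<open>fs\<close> as \<open>M\<close> grows, and the law of \<open>fs\<close> under \<open>Phat\<close> is the measure that bounds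
  \<open>S_val\<close> from below. Mass of \<open>l\<close> escaping to infinity is excluded by the fixed marginal in the
  first claim and by sublinear growth in the second.
\<close>

section \<open>Semicontinuous functions and tuples\<close>

text \<open>Two difficulties shape the argument. First, \<open>l\<close> is only upper
  semi-continuous and may grow as fast as the cost, so weak limits of laws give no direct hold on
  its mean. An affine majorant whose index depends on the reference sample \<open>y\<close> only
  replaces \<open>l(x)\<close> by an expression that is affine in \<open>x\<close>, and there a
  conditional mean may be inserted. The index is chosen at the limit map \<open>fs\<close> and then
  frozen, so that one bounded test functional is evaluated along the whole sequence. Second,
  conditional means given the whole sample would not lead to a product measure; the surplus
  coordinates beyond \<open>N\<close> are what rules out this dependence. Convexity of the cost
  enters three times: in Jensen, in the stability of cost bounds under midpoints, and in the growth
  of the cost, which is at least linear and so bounds first moments. These moments are bounded but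
  not uniformly integrable. Hence the maps are truncated at specially chosen radii, and almost
  everywhere limits of convex combinations are taken in the manner of Komlos.\<close>

lemma usc_on_open:
  assumes "usc_on A f"
  obtains U where "open U" "\<And>x. x \<in> A \<Longrightarrow> f x < t \<longleftrightarrow> x \<in> U"
proof -
  define U where "U = \<Union>{W. open W \<and> (\<forall>y\<in>W \<inter> A. f y < t)}"
  have "open U" unfolding U_def by auto
  moreover have "f x < t \<longleftrightarrow> x \<in> U" if x: "x \<in> A" for x
  proof
    assume lt: "f x < t"
    then have "eventually (\<lambda>y. f y < t) (at x within A)"
      using assms x unfolding usc_on_def by blast
    then obtain W where "open W" "x \<in> W" "\<forall>y\<in>W. y \<noteq> x \<longrightarrow> y \<in> A \<longrightarrow> f y < t"
      unfolding eventually_at_topological by blast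
    moreover from this lt have "\<forall>y\<in>W \<inter> A. f y < t" by (metis IntE)
    ultimately show "x \<in> U" unfolding U_def by blast
  qed (use x in \<open>auto simp: U_def\<close>)
  ultimately show thesis using that by blast
qed

lemma usc_on_borel_measurable:
  fixes f :: "'b::topological_space \<Rightarrow> real"
  assumes "usc_on A f" "closed A"
  shows "(\<lambda>x. if x \<in> A then f x else 0) \<in> borel_measurable borel"
  unfolding borel_measurable_iff_less
proof
  fix t
  obtain U where U: "open U" "\<And>x. x \<in> A \<Longrightarrow> f x < t \<longleftrightarrow> x \<in> U"
    using usc_on_open[OF assms(1)] by blast
  have "{w \<in> space borel. (if w \<in> A then f w else 0) < t} = (A \<inter> U) \<union> (if 0 < t then - A else {})"
    using U by (auto split: if_splits)
  also have "\<dots> \<in> sets borel"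
    using U(1) assms(2) by (auto intro!: sets.Un)
  finally show "{w \<in> space borel. (if w \<in> A then f w else 0) < t} \<in> sets borel" .
qed

text \<open>Tuples are functions on all of \<open>nat\<close> with value \<open>undefined\<close>
  off \<open>{..<N}\<close>. With the singleton \<open>{undefined}\<close> as factor there, a set of
  tuples becomes a full product, to which the closedness and compactness criteria of the product
  topology apply.\<close>

lemma PiE_lessThan_eq_PiE_UNIV: "PiE {..<N} X = PiE UNIV (\<lambda>i. if i < (N::nat) then X i else {undefined})"
proof (intro set_eqI iffI)
  fix x assume x: "x \<in> PiE UNIV (\<lambda>i. if i < N then X i else {undefined})"
  have "x i \<in> X i" if "i < N" for i using PiE_mem[OF x, of i] that by simp
  moreover have "x i = undefined" if "\<not> i < N" for i using PiE_mem[OF x, of i] that by simp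
  ultimately show "x \<in> PiE {..<N} X" by (intro PiE_I) auto
next
  fix x assume x: "x \<in> PiE {..<N} X"
  show "x \<in> PiE UNIV (\<lambda>i. if i < N then X i else {undefined})"
  proof (rule PiE_I)
    fix i show "x i \<in> (if i < N then X i else {undefined})"
      using PiE_mem[OF x, of i] PiE_arb[OF x, of i] by (cases "i < N") auto
  qed simp
qed

lemma closed_tup:
  fixes X :: "'a::t1_space set"
  assumes "closed X" shows "closed (tup N X)"
proof -
  have "closedin (product_topology (\<lambda>_. euclidean) UNIV) (tup N X)"
    unfolding tup_def PiE_lessThan_eq_PiE_UNIV closedin_product_topology using assms by auto
  then show ?thesis unfolding euclidean_product_topology by simp
qed

lemma compact_PiE_lessThan:
  fixes X :: "nat \<Rightarrow> 'a::t1_space set"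
  assumes "\<And>i. compact (X i)" shows "compact (PiE {..<N} X)"
proof -
  have "compactin (product_topology (\<lambda>_. euclidean) UNIV) (PiE {..<N} X)"
    unfolding PiE_lessThan_eq_PiE_UNIV compactin_PiE using assms by auto
  then show ?thesis unfolding euclidean_product_topology by simp
qed

lemma space_spaceM [simp]: "space (spaceM M) = extensional {..<M}"
  by (simp add: spaceM_def space_PiM PiE_def)

lemma space_prodM: "sets P = sets borel \<Longrightarrow> space (prodM M P) = extensional {..<M}"
  by (simp add: prodM_def space_PiM PiE_def sets_eq_imp_space_eq[of P borel])

lemma sets_prodM: "sets P = sets borel \<Longrightarrow> sets (prodM M P) = sets (spaceM M)"
  unfolding prodM_def spaceM_def by (intro sets_PiM_cong) auto

text \<open>Joins the two structures on tuples: functions that are Borel for the product topology,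
  such as upper semi-continuous ones, become measurable on the finite product
  \<open>spaceM N\<close>. The coordinates from \<open>N\<close> on are constantly
  \<open>undefined\<close>.\<close>

lemma measurable_spaceM_borel: "(\<lambda>x. x) \<in> measurable (spaceM N) (borel :: (nat \<Rightarrow> 'a::euclidean_space) measure)"
proof -
  have "(\<lambda>x i. x i) \<in> measurable (spaceM N) (PiM UNIV (\<lambda>_. borel :: 'a measure))"
  proof (rule measurable_PiM_single')
    fix i
    show "(\<lambda>x. x i) \<in> measurable (spaceM N) (borel :: 'a measure)"
    proof (cases "i < N")
      case True then show ?thesis unfolding spaceM_def by (intro measurable_component_singleton) simp
    next
      case False
      then have "x i = undefined" if "x \<in> space (spaceM N)" for x :: "nat \<Rightarrow> 'a"
        using that by (simp add: extensional_def)
      then show ?thesis by (subst measurable_cong[where g = "\<lambda>_. undefined"]) auto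
    qed
  qed auto
  then show ?thesis
    unfolding measurable_cong_sets[OF refl sets_PiM_equal_borel] by simp
qed

lemma sets_tup:
  fixes X :: "'a::euclidean_space set"
  shows "X \<in> sets borel \<Longrightarrow> tup N X \<in> sets (spaceM N)"
  unfolding tup_def spaceM_def by (intro sets_PiM_I_finite) auto

lemma usc_on_tup_measurable:
  fixes X :: "'a::euclidean_space set"
  assumes "usc_on (tup N X) l" "closed X"
  shows "(\<lambda>x. if x \<in> tup N X then l x else 0) \<in> borel_measurable (spaceM N)"
  using measurable_compose[OF measurable_spaceM_borel usc_on_borel_measurable[OF assms(1) closed_tup[OF assms(2)]]]
  by simp

lemma norm_add_scaleR_square:
  fixes a b :: "'a::real_inner"
  shows "(norm (a + \<theta> *\<^sub>R b))\<^sup>2 = (norm a)\<^sup>2 + 2 * \<theta> * (a \<bullet> b) + \<theta>\<^sup>2 * (norm b)\<^sup>2"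
  unfolding power2_norm_eq_inner
  by (simp add: inner_add_left inner_add_right inner_commute[of b a] power2_eq_square algebra_simps)

section \<open>Countable families of affine majorants\<close>

definition aff :: "nat \<Rightarrow> (nat \<Rightarrow> 'a::real_inner) \<Rightarrow> real \<Rightarrow> (nat \<Rightarrow> 'a) \<Rightarrow> real" where
  "aff N p \<beta> u = (\<Sum>i<N. p i \<bullet> u i) + \<beta>"

text \<open>Separation by nearest points. The point \<open>(x, t)\<close> lies strictly above the
  closed convex hypograph \<open>H\<close>, and the point \<open>m\<close> of \<open>H\<close>
  closest to it yields a supporting hyperplane. This hyperplane is not vertical, because it
  separates \<open>(x, t)\<close> from \<open>(x, l x)\<close>. The squared distance
  \<open>d\<close> sums over the \<open>N\<close> active coordinates and the height.\<close>

lemma affine_majorant_at: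
  fixes X :: "'a::euclidean_space set"
  assumes X: "closed X" "convex X" and usc: "usc_on (tup N X) l" and conc: "concave_tup N X l"
    and x: "x \<in> tup N X" and t: "l x < t"
  shows "\<exists>p \<beta>. (\<forall>u\<in>tup N X. l u \<le> aff N p \<beta> u) \<and> aff N p \<beta> x < t"
proof -
  define r where "r = t - l x"
  have r: "r > 0" using t by (simp add: r_def)
  define H where "H = {h::(nat \<Rightarrow> 'a) \<times> real. fst h \<in> tup N X \<and> snd h \<le> l (fst h)}"
  have "\<exists>U. \<forall>q. open (U q) \<and> (\<forall>x\<in>tup N X. l x < q \<longleftrightarrow> x \<in> U q)"
    by (intro choice allI) (metis usc_on_open[OF usc])
  then obtain U where U: "\<And>q. open (U q)" "\<And>q x. x \<in> tup N X \<Longrightarrow> l x < q \<longleftrightarrow> x \<in> U q" by blast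
  \<comment> \<open>Closedness of the hypograph: the points above the graph are covered by the open
    boxes on which \<open>l < q\<close> and the height exceeds \<open>q\<close>.\<close>
  have Heq: "H = (tup N X \<times> UNIV) \<inter> (\<Inter>q. - (U q \<times> {q<..}))"
  proof (intro set_eqI iffI)
    fix h assume h: "h \<in> (tup N X \<times> UNIV) \<inter> (\<Inter>q. - (U q \<times> {q<..}))"
    have "snd h \<le> l (fst h)"
    proof (rule ccontr)
      assume "\<not> snd h \<le> l (fst h)"
      then obtain q where "l (fst h) < q" "q < snd h" by (meson dense not_le)
      then have "h \<in> U q \<times> {q<..}" using h U(2)[of "fst h" q] by (cases h) auto
      then show False using h by blast
    qed
    then show "h \<in> H" using h by (auto simp: H_def)
  next
    fix h assume h: "h \<in> H"
    then have "h \<notin> U q \<times> {q<..}" for q using U(2)[of "fst h" q] by (cases h) (auto simp: H_def)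
    then show "h \<in> (tup N X \<times> UNIV) \<inter> (\<Inter>q. - (U q \<times> {q<..}))" using h by (cases h) (auto simp: H_def)
  qed
  have "closed (tup N X \<times> (UNIV::real set))" by (intro closed_Times closed_tup X) auto
  moreover have "closed (\<Inter>q. - (U q \<times> {q<..}))"
    by (intro closed_INT ballI closed_Compl open_Times U(1)) auto
  ultimately have clH: "closed H" unfolding Heq by (rule closed_Int)
  define d where "d h = (\<Sum>i<N. (norm (fst h i - x i))\<^sup>2) + (snd h - t)\<^sup>2" for h :: "(nat \<Rightarrow> 'a) \<times> real"
  have proj: "continuous_on A (\<lambda>h::(nat \<Rightarrow> 'a) \<times> real. fst h i)" for A i
    by (rule continuous_on_product_then_coordinatewise) (intro continuous_intros)
  have contd: "continuous_on A d" for A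
    unfolding d_def by (intro continuous_intros proj)
  \<comment> \<open>\<open>(x, l x)\<close> lies in \<open>H\<close> at squared distance
    \<open>r^2\<close>, so a minimiser can be sought in this compact box: every point of
    \<open>H\<close> outside it is at least as far away.\<close>
  define S where "S = (PiE {..<N} (\<lambda>i. cball (x i) r) \<times> {t - r .. t + r}) \<inter> H"
  have compS: "compact S"
    unfolding S_def by (intro compact_Int_closed compact_Times compact_PiE_lessThan clH) auto
  have xS: "(x, l x) \<in> S" using x r by (auto simp: S_def H_def tup_def r_def PiE_iff)
  obtain m where m: "m \<in> S" "\<And>h. h \<in> S \<Longrightarrow> d m \<le> d h"
    using continuous_attains_inf[OF compS _ contd] xS by blast
  have dx: "d (x, l x) = r\<^sup>2" by (simp add: d_def r_def power2_commute)
  have min: "d m \<le> d h" if h: "h \<in> H" for h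
  proof (cases "h \<in> S")
    case False
    have "r\<^sup>2 \<le> d h"
    proof (rule ccontr)
      assume "\<not> r\<^sup>2 \<le> d h"
      then have lt: "d h < r\<^sup>2" by simp
      have "(norm (fst h i - x i))\<^sup>2 \<le> d h" if "i < N" for i
      proof -
        have "(norm (fst h i - x i))\<^sup>2 \<le> (\<Sum>i<N. (norm (fst h i - x i))\<^sup>2)"
          using that by (intro member_le_sum) auto
        then show ?thesis by (simp add: d_def add_increasing2)
      qed
      then have "norm (fst h i - x i) \<le> r" if "i < N" for i
        using that lt r by (meson less_imp_le order_trans power2_le_imp_le)
      moreover have "(snd h - t)\<^sup>2 \<le> d h" by (simp add: d_def sum_nonneg)
      then have "\<bar>snd h - t\<bar>\<^sup>2 \<le> r\<^sup>2" using lt by simp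
      then have "\<bar>snd h - t\<bar> \<le> r" using r power2_le_imp_le less_imp_le by blast
      then have "t - r \<le> snd h" "snd h \<le> t + r" by (simp_all add: abs_le_iff)
      ultimately have "h \<in> S" using h
        by (auto simp: S_def H_def tup_def PiE_iff dist_norm norm_minus_commute mem_Times_iff)
      then show False using False by simp
    qed
    then show ?thesis using m(2)[OF xS] dx by simp
  qed (use m in simp)
  obtain a b where mab: "m = (a, b)" by (cases m)
  have aH: "a \<in> tup N X" "b \<le> l a" using m(1) by (auto simp: S_def H_def mab)
  have var: "0 \<le> (\<Sum>i<N. (a i - x i) \<bullet> (u i - a i)) + (b - t) * (s - b)" (is "0 \<le> ?I")
    if us: "u \<in> tup N X" "s \<le> l u" for u s
  proof -
    define J where "J = (\<Sum>i<N. (norm (u i - a i))\<^sup>2) + (s - b)\<^sup>2"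
    \<comment> \<open>First variation: moving from \<open>m\<close> towards \<open>(u, s)\<close> by
      \<open>\<theta>\<close> stays in \<open>H\<close> by concavity, so the distance cannot
      drop.\<close>
    have step: "0 \<le> 2 * ?I + \<theta> * J" if th: "0 < \<theta>" "\<theta> \<le> 1" for \<theta>
    proof -
      define w where "w = restrict (\<lambda>i. \<theta> *\<^sub>R u i + (1 - \<theta>) *\<^sub>R a i) {..<N}"
      have w: "w \<in> tup N X"
        using us(1) aH(1) th X(2) unfolding w_def tup_def
        by (auto simp: PiE_iff intro!: convexD)
      have "\<theta> * s + (1 - \<theta>) * b \<le> \<theta> * l u + (1 - \<theta>) * l a"
        using us aH th by (intro add_mono mult_left_mono) auto
      also have "\<dots> \<le> l w" using conc us(1) aH(1) th unfolding concave_tup_def w_def by auto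
      finally have "d m \<le> d (w, \<theta> * s + (1 - \<theta>) * b)" using w by (intro min) (simp add: H_def)
      also have "\<dots> = (\<Sum>i<N. (norm (a i - x i))\<^sup>2 + 2 * \<theta> * ((a i - x i) \<bullet> (u i - a i)) + \<theta>\<^sup>2 * (norm (u i - a i))\<^sup>2)
          + ((b - t)\<^sup>2 + 2 * \<theta> * ((b - t) * (s - b)) + \<theta>\<^sup>2 * (s - b)\<^sup>2)"
      proof -
        have "(norm (w i - x i))\<^sup>2 = (norm (a i - x i))\<^sup>2 + 2 * \<theta> * ((a i - x i) \<bullet> (u i - a i)) + \<theta>\<^sup>2 * (norm (u i - a i))\<^sup>2"
          if "i < N" for i
        proof -
          have "w i - x i = (a i - x i) + \<theta> *\<^sub>R (u i - a i)" using that by (simp add: w_def algebra_simps)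
          then show ?thesis by (simp only: norm_add_scaleR_square)
        qed
        moreover have "(\<theta> * s + (1 - \<theta>) * b - t)\<^sup>2 = (b - t)\<^sup>2 + 2 * \<theta> * ((b - t) * (s - b)) + \<theta>\<^sup>2 * (s - b)\<^sup>2"
          by (simp add: power2_eq_square algebra_simps)
        ultimately show ?thesis unfolding d_def by simp
      qed
      also have "\<dots> = d m + \<theta> * (2 * ?I + \<theta> * J)"
      proof -
        have *: "(\<Sum>i<N. A i + 2 * \<theta> * B i + \<theta>\<^sup>2 * C i) + (a' + 2 * \<theta> * b' + \<theta>\<^sup>2 * c')
            = ((\<Sum>i<N. A i) + a') + \<theta> * (2 * ((\<Sum>i<N. B i) + b') + \<theta> * ((\<Sum>i<N. C i) + c'))"
          for A B C and a' b' c'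
          unfolding sum.distrib sum_distrib_left[symmetric] by (simp add: power2_eq_square distrib_left)
        show ?thesis unfolding d_def mab J_def fst_conv snd_conv by (rule *)
      qed
      finally have "0 \<le> \<theta> * (2 * ?I + \<theta> * J)" by simp
      then show ?thesis using th by (simp add: zero_le_mult_iff)
    qed
    show ?thesis
    proof (rule ccontr)
      assume neg: "\<not> 0 \<le> ?I"
      have J: "0 \<le> J" unfolding J_def by (simp add: sum_nonneg)
      \<comment> \<open>This \<open>\<theta>\<close> keeps the quadratic term
        \<open>\<theta> * J\<close> below minus the linear coefficient, so a negative coefficient
        contradicts \<open>step\<close>.\<close>
      define \<theta> where "\<theta> = min 1 (- ?I / (J + 1))"
      have th: "0 < \<theta>" "\<theta> \<le> 1" using neg J by (auto simp: \<theta>_def)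
      have "\<theta> * J \<le> (- ?I / (J + 1)) * J" using J by (intro mult_right_mono) (auto simp: \<theta>_def)
      also have "\<dots> \<le> - ?I" using J neg by (simp add: divide_simps)
      finally have "\<theta> * J \<le> - ?I" .
      moreover have "False" if "J' \<le> - I" "0 \<le> 2 * I + J'" "\<not> 0 \<le> I" for I J' :: real using that by linarith
      ultimately show False using step[OF th] neg by blast
    qed
  qed
  \<comment> \<open>Were the nearest point at height \<open>t\<close> or above, testing
    \<open>var\<close> with \<open>(x, l x)\<close> would force \<open>a = x\<close>, and then
    \<open>b \<le> l x < t\<close>.\<close>
  have b: "b < t"
  proof (rule ccontr)
    assume nb: "\<not> b < t"
    have "(\<Sum>i<N. (a i - x i) \<bullet> (x i - a i)) = - (\<Sum>i<N. (norm (a i - x i))\<^sup>2)"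
      by (simp add: power2_norm_eq_inner sum_negf[symmetric] inner_diff_left inner_diff_right algebra_simps)
    then have 1: "(\<Sum>i<N. (norm (a i - x i))\<^sup>2) \<le> (b - t) * (l x - b)"
      using var[OF x, of "l x"] by simp
    moreover have 2: "(b - t) * (l x - b) \<le> 0" using nb t by (intro mult_nonneg_nonpos) auto
    ultimately have "(\<Sum>i<N. (norm (a i - x i))\<^sup>2) \<le> 0" by linarith
    then have "(\<Sum>i<N. (norm (a i - x i))\<^sup>2) = 0" by (simp add: sum_nonneg order_antisym)
    then have "\<forall>i<N. a i = x i" by (simp add: sum_nonneg_eq_0_iff)
    then have "a = x" using aH(1) x unfolding tup_def by (intro PiE_ext) auto
    then show False using aH(2) nb t by simp
  qed
  define q where "q = t - b"
  have q: "q > 0" using b by (simp add: q_def)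
  define p where "p = (\<lambda>i. (1/q) *\<^sub>R (a i - x i))"
  define \<beta> where "\<beta> = b - (\<Sum>i<N. p i \<bullet> a i)"
  have aff: "aff N p \<beta> u = b + (\<Sum>i<N. (a i - x i) \<bullet> (u i - a i)) / q" for u
    unfolding aff_def \<beta>_def p_def
    by (simp add: sum_divide_distrib sum_subtractf[symmetric] inner_diff_right diff_divide_distrib[symmetric])
  have "l u \<le> aff N p \<beta> u" if u: "u \<in> tup N X" for u
    using var[OF u, of "l u"] q unfolding aff by (simp add: field_simps q_def)
  moreover have "aff N p \<beta> x < t"
  proof -
    have "(\<Sum>i<N. (a i - x i) \<bullet> (x i - a i)) = - (\<Sum>i<N. (norm (a i - x i))\<^sup>2)"
      by (simp add: power2_norm_eq_inner sum_negf[symmetric] inner_diff_left inner_diff_right algebra_simps)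
    then have "(\<Sum>i<N. (a i - x i) \<bullet> (x i - a i)) / q \<le> 0" using q by (simp add: sum_nonneg divide_nonpos_pos)
    then show ?thesis unfolding aff using b by linarith
  qed
  ultimately show ?thesis by blast
qed

lemma continuous_on_aff: "continuous_on A (aff N p \<beta>)"
  unfolding aff_def by (intro continuous_intros continuous_on_product_then_coordinatewise[OF continuous_on_id])

text \<open>Lindelof: the strict epigraphs of all affine majorants are open and cover every
  \<open>(u, t)\<close> with \<open>l u < t\<close>; a countable subfamily has the same union.
  Countability is what later permits a measurable choice of a majorant.\<close>

lemma countable_affine_majorants:
  fixes X :: "'a::euclidean_space set"
  assumes X: "closed X" "convex X" "X \<noteq> {}" and usc: "usc_on (tup N X) l" and conc: "concave_tup N X l"
  obtains p :: "nat \<Rightarrow> nat \<Rightarrow> 'a" and \<beta> :: "nat \<Rightarrow> real"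
  where "\<And>n u. u \<in> tup N X \<Longrightarrow> l u \<le> aff N (p n) (\<beta> n) u"
    and "\<And>u t. u \<in> tup N X \<Longrightarrow> l u < t \<Longrightarrow> \<exists>n. aff N (p n) (\<beta> n) u < t"
proof -
  define A where "A = {a::(nat \<Rightarrow> 'a) \<times> real. \<forall>u\<in>tup N X. l u \<le> aff N (fst a) (snd a) u}"
  define O' where "O' a = {h::(nat \<Rightarrow> 'a) \<times> real. aff N (fst a) (snd a) (fst h) < snd h}" for a
  have op: "open (O' a)" for a
    unfolding O'_def
    by (intro open_Collect_less continuous_intros continuous_on_compose2[OF continuous_on_aff[of UNIV]]) auto
  obtain F where F: "F \<subseteq> O' ` A" "countable F" "\<Union>F = \<Union>(O' ` A)"
    by (rule Lindelof[of "O' ` A"]) (use op in auto)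
  obtain C where C: "C \<subseteq> A" "countable C" "F = O' ` C"
    using F(1,2) by (metis countable_subset_image)
  have hit: "\<exists>a\<in>C. aff N (fst a) (snd a) u < t" if u: "u \<in> tup N X" "l u < t" for u t
  proof -
    obtain p \<beta> where "\<forall>u\<in>tup N X. l u \<le> aff N p \<beta> u" "aff N p \<beta> u < t"
      using affine_majorant_at[OF X(1,2) usc conc u] by blast
    then have "(u, t) \<in> \<Union>(O' ` A)" by (intro UN_I[of "(p, \<beta>)"]) (auto simp: A_def O'_def)
    then have "(u, t) \<in> \<Union>(O' ` C)" using F(3) C(3) by simp
    then show ?thesis by (auto simp: O'_def)
  qed
  obtain x0 where "x0 \<in> X" using X(3) by blast
  then have "restrict (\<lambda>_. x0) {..<N} \<in> tup N X" by (auto simp: tup_def)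
  from hit[OF this, of "l (restrict (\<lambda>_. x0) {..<N}) + 1"] have ne: "C \<noteq> {}" by auto
  define e where "e = from_nat_into C"
  have e: "e n \<in> C" for n unfolding e_def using ne by (rule from_nat_into)
  show thesis
  proof (rule that[of "\<lambda>n. fst (e n)" "\<lambda>n. snd (e n)"])
    show "l u \<le> aff N (fst (e n)) (snd (e n)) u" if "u \<in> tup N X" for n u
      using e[of n] C(1) that by (auto simp: A_def)
    fix u t assume "u \<in> tup N X" "l u < t"
    from hit[OF this] obtain a where a: "a \<in> C" "aff N (fst a) (snd a) u < t" by blast
    then obtain n where "e n = a" unfolding e_def using from_nat_into_surj[OF C(2)] by blast
    with a show "\<exists>n. aff N (fst (e n)) (snd (e n)) u < t" by blast
  qed
qed

section \<open>Conditional expectations as functions of the conditioning variable\<close>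

text \<open>The conditional expectation of \<open>\<zeta>\<close> given \<open>Y\<close>, recorded
  as a function on the value space of \<open>Y\<close>. In this factored form it can be evaluated at
  any coordinate, and the maps obtained from different plans all live on the same space
  \<open>P\<close>.\<close>

definition cond_exp_fun ::
  "'w measure \<Rightarrow> 'b measure \<Rightarrow> ('w \<Rightarrow> 'b) \<Rightarrow> ('w \<Rightarrow> real) \<Rightarrow> ('b \<Rightarrow> real) \<Rightarrow> bool" where
  "cond_exp_fun \<mu> \<nu> Y \<zeta> H \<longleftrightarrow> integrable \<mu> \<zeta> \<and> integrable \<nu> H \<and>
     (\<forall>\<psi> C. \<psi> \<in> borel_measurable \<nu> \<longrightarrow> (\<forall>y. \<bar>\<psi> y\<bar> \<le> C) \<longrightarrow>
        (\<integral>\<omega>. \<zeta> \<omega> * \<psi> (Y \<omega>) \<partial>\<mu>) = (\<integral>y. H y * \<psi> y \<partial>\<nu>))"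

lemma cond_exp_funD:
  assumes "cond_exp_fun \<mu> \<nu> Y \<zeta> H" "\<psi> \<in> borel_measurable \<nu>" "\<And>y. \<bar>\<psi> y\<bar> \<le> C"
  shows "(\<integral>\<omega>. \<zeta> \<omega> * \<psi> (Y \<omega>) \<partial>\<mu>) = (\<integral>y. H y * \<psi> y \<partial>\<nu>)"
  using assms unfolding cond_exp_fun_def by blast

lemma integrable_mult_bounded:
  fixes f g :: "'b \<Rightarrow> real"
  assumes "integrable M f" "g \<in> borel_measurable M" "\<And>x. \<bar>g x\<bar> \<le> C"
  shows "integrable M (\<lambda>x. f x * g x)"
proof (rule Bochner_Integration.integrable_bound)
  show "integrable M (\<lambda>x. C * f x)" using assms(1) by simp
  show "(\<lambda>x. f x * g x) \<in> borel_measurable M" using assms by measurable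
  have "0 \<le> C" using assms(3)[of undefined] by linarith
  then show "AE x in M. norm (f x * g x) \<le> norm (C * f x)"
    using assms(3) by (intro AE_I2) (simp add: abs_mult mult.commute[of C] mult_left_mono)
qed

lemma cond_exp_fun_add:
  assumes Y: "Y \<in> measurable \<mu> \<nu>" and 1: "cond_exp_fun \<mu> \<nu> Y \<zeta> H" and 2: "cond_exp_fun \<mu> \<nu> Y \<zeta>' H'"
  shows "cond_exp_fun \<mu> \<nu> Y (\<lambda>\<omega>. \<zeta> \<omega> + \<zeta>' \<omega>) (\<lambda>y. H y + H' y)"
proof -
  have "(\<integral>\<omega>. (\<zeta> \<omega> + \<zeta>' \<omega>) * \<psi> (Y \<omega>) \<partial>\<mu>) = (\<integral>y. (H y + H' y) * \<psi> y \<partial>\<nu>)"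
    if p: "\<psi> \<in> borel_measurable \<nu>" "\<forall>y. \<bar>\<psi> y\<bar> \<le> C" for \<psi> C
  proof -
    have m: "(\<lambda>\<omega>. \<psi> (Y \<omega>)) \<in> borel_measurable \<mu>" using Y p(1) by measurable
    have i: "integrable \<mu> (\<lambda>\<omega>. \<zeta> \<omega> * \<psi> (Y \<omega>))" "integrable \<mu> (\<lambda>\<omega>. \<zeta>' \<omega> * \<psi> (Y \<omega>))"
      "integrable \<nu> (\<lambda>y. H y * \<psi> y)" "integrable \<nu> (\<lambda>y. H' y * \<psi> y)"
      using 1 2 p m by (auto simp: cond_exp_fun_def intro!: integrable_mult_bounded[where C=C])
    show ?thesis
      using cond_exp_funD[OF 1 p(1) p(2)[rule_format]] cond_exp_funD[OF 2 p(1) p(2)[rule_format]] i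
      by (simp add: distrib_right)
  qed
  then show ?thesis using 1 2 by (auto simp: cond_exp_fun_def)
qed

lemma cond_exp_fun_scale:
  assumes "cond_exp_fun \<mu> \<nu> Y \<zeta> H"
  shows "cond_exp_fun \<mu> \<nu> Y (\<lambda>\<omega>. r * \<zeta> \<omega>) (\<lambda>y. r * H y)"
  using assms by (auto simp: cond_exp_fun_def mult.assoc)

lemma cond_exp_fun_const:
  assumes "prob_space \<mu>" "Y \<in> measurable \<mu> \<nu>" "distr \<mu> \<nu> Y = \<nu>"
  shows "cond_exp_fun \<mu> \<nu> Y (\<lambda>_. r) (\<lambda>_. r)"
proof -
  interpret prob_space \<mu> by fact
  interpret n: prob_space \<nu> using prob_space_distr[OF assms(2)] assms(3) by simp
  have "(\<integral>\<omega>. \<psi> (Y \<omega>) \<partial>\<mu>) = (\<integral>y. \<psi> y \<partial>\<nu>)" if "\<psi> \<in> borel_measurable \<nu>" for \<psi> :: "_ \<Rightarrow> real"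
    using integral_distr[OF assms(2) that] assms(3) by simp
  then show ?thesis by (auto simp: cond_exp_fun_def)
qed

lemma cond_exp_fun_sum:
  assumes "prob_space \<mu>" "Y \<in> measurable \<mu> \<nu>" "distr \<mu> \<nu> Y = \<nu>" "finite B"
    "\<And>b. b \<in> B \<Longrightarrow> cond_exp_fun \<mu> \<nu> Y (\<zeta> b) (H b)"
  shows "cond_exp_fun \<mu> \<nu> Y (\<lambda>\<omega>. \<Sum>b\<in>B. \<zeta> b \<omega>) (\<lambda>y. \<Sum>b\<in>B. H b y)"
  using assms(4,5)
proof (induction rule: finite_induct)
  case empty then show ?case using cond_exp_fun_const[OF assms(1-3), of 0] by simp
next
  case (insert x F)
  then show ?case using cond_exp_fun_add[OF assms(2), of "\<zeta> x" "H x" "\<lambda>\<omega>. \<Sum>b\<in>F. \<zeta> b \<omega>"] by simp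
qed

text \<open>\<open>H\<close> is the Radon-Nikodym density with respect to \<open>\<nu>\<close> of
  the image under \<open>Y\<close> of the measure with density \<open>\<zeta>\<close>; a
  \<open>\<nu>\<close>-null set pulls back to a null set, so the image is absolutely
  continuous.\<close>

lemma cond_exp_fun_exists_nonneg:
  assumes "prob_space \<mu>" and Y[measurable]: "Y \<in> measurable \<mu> \<nu>" and d: "distr \<mu> \<nu> Y = \<nu>"
    and z: "integrable \<mu> \<zeta>" "\<And>\<omega>. 0 \<le> \<zeta> \<omega>"
  shows "\<exists>H. cond_exp_fun \<mu> \<nu> Y \<zeta> H"
proof -
  interpret prob_space \<mu> by fact
  interpret n: prob_space \<nu> using prob_space_distr[OF Y] d by simp
  have zm[measurable]: "\<zeta> \<in> borel_measurable \<mu>" using z by simp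
  define D where "D = distr (density \<mu> (\<lambda>\<omega>. ennreal (\<zeta> \<omega>))) \<nu> Y"
  have sD: "sets D = sets \<nu>" by (simp add: D_def)
  have ac: "absolutely_continuous \<nu> D"
  proof (unfold absolutely_continuous_def, safe)
    fix A assume A: "A \<in> null_sets \<nu>"
    have "A \<in> null_sets (distr \<mu> \<nu> Y)" using A d by simp
    then have "AE \<omega> in \<mu>. Y \<omega> \<notin> A" using A
      by (simp add: null_sets_distr_iff AE_iff_null_sets Collect_conj_eq[symmetric])
         (auto intro!: AE_I' [of "Y -` A \<inter> space \<mu>"])
    then have "AE \<omega> in \<mu>. ennreal (\<zeta> \<omega>) * indicator (Y -` A \<inter> space \<mu>) \<omega> = 0"
      by eventually_elim (simp split: split_indicator)
    moreover have "Y -` A \<inter> space \<mu> \<in> sets \<mu>" using A measurable_sets[OF Y] by auto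
    ultimately have "emeasure D A = 0"
      using A unfolding D_def
      by (subst emeasure_distr) (auto simp: emeasure_density nn_integral_0_iff_AE)
    then show "A \<in> null_sets D" using A sD by auto
  qed
  obtain f where f[measurable]: "f \<in> borel_measurable \<nu>" "density \<nu> f = D"
    using n.Radon_Nikodym[OF ac sD] by blast
  have "(\<integral>\<^sup>+ y. f y \<partial>\<nu>) = emeasure D (space \<nu>)"
    unfolding f(2)[symmetric] by (simp add: emeasure_density cong: nn_integral_cong)
  also have "\<dots> = (\<integral>\<^sup>+ \<omega>. ennreal (\<zeta> \<omega>) \<partial>\<mu>)"
  proof -
    have "Y -` space \<nu> \<inter> space \<mu> = space \<mu>" using measurable_space[OF Y] by auto
    then show ?thesis unfolding D_def by (simp add: emeasure_distr emeasure_density cong: nn_integral_cong)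
  qed
  also have "\<dots> < \<infinity>" using z by (simp add: integrable_iff_bounded)
  finally have fin: "(\<integral>\<^sup>+ y. f y \<partial>\<nu>) < \<infinity>" .
  then have ae: "AE y in \<nu>. f y \<noteq> \<infinity>" by (intro nn_integral_noteq_infinite) auto
  define H where "H y = enn2real (f y)" for y
  have Hm[measurable]: "H \<in> borel_measurable \<nu>" unfolding H_def by measurable
  have eqH: "AE y in \<nu>. ennreal (H y) = f y" using ae by eventually_elim (simp add: H_def less_top)
  have "(\<integral>\<^sup>+ y. ennreal (H y) \<partial>\<nu>) = (\<integral>\<^sup>+ y. f y \<partial>\<nu>)" by (rule nn_integral_cong_AE[OF eqH])
  then have "integrable \<nu> H" using fin by (simp add: integrable_iff_bounded H_def)
  moreover have DH: "density \<nu> (\<lambda>y. ennreal (H y)) = D"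
    unfolding f(2)[symmetric] by (intro density_cong eqH) auto
  have "(\<integral>\<omega>. \<zeta> \<omega> * \<psi> (Y \<omega>) \<partial>\<mu>) = (\<integral>y. H y * \<psi> y \<partial>\<nu>)" if [measurable]: "\<psi> \<in> borel_measurable \<nu>" for \<psi>
  proof -
    have "(\<integral>\<omega>. \<zeta> \<omega> * \<psi> (Y \<omega>) \<partial>\<mu>) = integral\<^sup>L (density \<mu> (\<lambda>\<omega>. ennreal (\<zeta> \<omega>))) (\<lambda>\<omega>. \<psi> (Y \<omega>))"
      using z by (subst integral_density) auto
    also have "\<dots> = integral\<^sup>L D \<psi>" unfolding D_def by (subst integral_distr) auto
    also have "\<dots> = (\<integral>y. H y * \<psi> y \<partial>\<nu>)"
      unfolding DH[symmetric] by (subst integral_density) (auto simp: H_def)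
    finally show ?thesis .
  qed
  ultimately show ?thesis using z unfolding cond_exp_fun_def by blast
qed

lemma cond_exp_fun_exists:
  assumes "prob_space \<mu>" "Y \<in> measurable \<mu> \<nu>" "distr \<mu> \<nu> Y = \<nu>" and z: "integrable \<mu> \<zeta>"
  shows "\<exists>H. cond_exp_fun \<mu> \<nu> Y \<zeta> H"
proof -
  have "integrable \<mu> (\<lambda>\<omega>. max 0 (\<zeta> \<omega>))" "integrable \<mu> (\<lambda>\<omega>. max 0 (- \<zeta> \<omega>))" using z by auto
  then obtain H1 H2 where "cond_exp_fun \<mu> \<nu> Y (\<lambda>\<omega>. max 0 (\<zeta> \<omega>)) H1" "cond_exp_fun \<mu> \<nu> Y (\<lambda>\<omega>. max 0 (- \<zeta> \<omega>)) H2"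
    using cond_exp_fun_exists_nonneg[OF assms(1-3)] by (metis max.cobounded1)
  then have "cond_exp_fun \<mu> \<nu> Y (\<lambda>\<omega>. max 0 (\<zeta> \<omega>) + (-1) * max 0 (- \<zeta> \<omega>)) (\<lambda>y. H1 y + (-1) * H2 y)"
    by (intro cond_exp_fun_add assms cond_exp_fun_scale)
  moreover have "(\<lambda>\<omega>. max 0 (\<zeta> \<omega>) + (-1) * max 0 (- \<zeta> \<omega>)) = \<zeta>" by (auto simp: max_def)
  ultimately show ?thesis by auto
qed

text \<open>Test with the indicator of the set where \<open>y \<in> A\<close> and the inequality
  fails. The localisation to \<open>A\<close> allows Jensen with affine minorants that are valid
  only near a given parameter.\<close>

lemma cond_exp_fun_mono:
  assumes Y: "Y \<in> measurable \<mu> \<nu>" and 1: "cond_exp_fun \<mu> \<nu> Y \<zeta> H" and 2: "cond_exp_fun \<mu> \<nu> Y \<zeta>' H'"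
    and A: "A \<in> sets \<nu>" and le: "AE \<omega> in \<mu>. Y \<omega> \<in> A \<longrightarrow> \<zeta> \<omega> \<le> \<zeta>' \<omega>"
  shows "AE y in \<nu>. y \<in> A \<longrightarrow> H y \<le> H' y"
proof -
  have [measurable]: "H \<in> borel_measurable \<nu>" "H' \<in> borel_measurable \<nu>" "A \<in> sets \<nu>"
    using 1 2 A by (auto simp: cond_exp_fun_def)
  define \<psi> where "\<psi> y = (if y \<in> A \<and> H' y < H y then 1 else 0 :: real)" for y
  have [measurable]: "\<psi> \<in> borel_measurable \<nu>" unfolding \<psi>_def by measurable
  have bd: "\<bar>\<psi> y\<bar> \<le> 1" for y by (simp add: \<psi>_def)
  have Ym: "(\<lambda>\<omega>. \<psi> (Y \<omega>)) \<in> borel_measurable \<mu>" using Y by measurable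
  have int: "integrable \<nu> (\<lambda>y. H y * \<psi> y)" "integrable \<nu> (\<lambda>y. H' y * \<psi> y)"
     "integrable \<mu> (\<lambda>\<omega>. \<zeta> \<omega> * \<psi> (Y \<omega>))" "integrable \<mu> (\<lambda>\<omega>. \<zeta>' \<omega> * \<psi> (Y \<omega>))"
    using 1 2 Ym bd by (auto simp: cond_exp_fun_def intro!: integrable_mult_bounded[where C=1])
  have "(\<integral>y. H y * \<psi> y \<partial>\<nu>) = (\<integral>\<omega>. \<zeta> \<omega> * \<psi> (Y \<omega>) \<partial>\<mu>)" by (rule cond_exp_funD[OF 1 _ bd, symmetric]) measurable
  also have "\<dots> \<le> (\<integral>\<omega>. \<zeta>' \<omega> * \<psi> (Y \<omega>) \<partial>\<mu>)"
    using le by (intro integral_mono_AE int) (auto simp: \<psi>_def)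
  also have "\<dots> = (\<integral>y. H' y * \<psi> y \<partial>\<nu>)" by (rule cond_exp_funD[OF 2 _ bd]) measurable
  finally have "(\<integral>y. H y * \<psi> y - H' y * \<psi> y \<partial>\<nu>) \<le> 0" using int by simp
  moreover have nn: "0 \<le> H y * \<psi> y - H' y * \<psi> y" for y by (auto simp: \<psi>_def)
  ultimately have "(\<integral>y. H y * \<psi> y - H' y * \<psi> y \<partial>\<nu>) = 0"
    using integral_nonneg_AE[of "\<lambda>y. H y * \<psi> y - H' y * \<psi> y" \<nu>] by (intro antisym) auto
  then have "AE y in \<nu>. H y * \<psi> y - H' y * \<psi> y = 0"
    by (subst (asm) integral_nonneg_eq_0_iff_AE) (use int nn in auto)
  then show ?thesis by eventually_elim (auto simp: \<psi>_def split: if_splits)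
qed

text \<open>Support functionals keep the conditional barycenter inside the convex set.\<close>

lemma conditional_barycenter:
  fixes K :: "'a::euclidean_space set" and \<xi> :: "'w \<Rightarrow> 'a"
  assumes "prob_space \<mu>" "Y \<in> measurable \<mu> \<nu>" "distr \<mu> \<nu> Y = \<nu>"
    and K: "compact K" "convex K" "K \<noteq> {}"
    and xi[measurable]: "\<xi> \<in> borel_measurable \<mu>" and xiK: "AE \<omega> in \<mu>. \<xi> \<omega> \<in> K"
  obtains f where "f \<in> borel_measurable \<nu>" "\<And>y. f y \<in> K"
    "\<And>p. cond_exp_fun \<mu> \<nu> Y (\<lambda>\<omega>. p \<bullet> \<xi> \<omega>) (\<lambda>y. p \<bullet> f y)"
proof -
  interpret prob_space \<mu> by fact
  obtain r where r: "\<And>x. x \<in> K \<Longrightarrow> norm x \<le> r" using compact_imp_bounded[OF K(1)] bounded_iff by blast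
  have "integrable \<mu> (\<lambda>\<omega>. b \<bullet> \<xi> \<omega>)" for b
  proof (rule integrable_const_bound[where B = "norm b * r"])
    show "AE \<omega> in \<mu>. norm (b \<bullet> \<xi> \<omega>) \<le> norm b * r"
      using xiK by eventually_elim (metis Cauchy_Schwarz_ineq2 mult_left_mono norm_ge_zero order_trans r real_norm_def)
  qed simp
  then have "\<exists>F. \<forall>b. cond_exp_fun \<mu> \<nu> Y (\<lambda>\<omega>. b \<bullet> \<xi> \<omega>) (F b)"
    by (intro choice allI cond_exp_fun_exists[OF assms(1-3)])
  then obtain F where F: "\<And>b. cond_exp_fun \<mu> \<nu> Y (\<lambda>\<omega>. b \<bullet> \<xi> \<omega>) (F b)" by blast
  have Fm[measurable]: "F b \<in> borel_measurable \<nu>" for b using F[of b] by (auto simp: cond_exp_fun_def)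
  \<comment> \<open>Conditional expectations of the coordinates, recombined along the basis;
    linearity extends the defining identity to every functional \<open>p\<close>.\<close>
  define g where "g y = (\<Sum>b\<in>Basis. F b y *\<^sub>R b)" for y
  have gm[measurable]: "g \<in> borel_measurable \<nu>" unfolding g_def by measurable
  have g: "cond_exp_fun \<mu> \<nu> Y (\<lambda>\<omega>. p \<bullet> \<xi> \<omega>) (\<lambda>y. p \<bullet> g y)" for p
  proof -
    have "cond_exp_fun \<mu> \<nu> Y (\<lambda>\<omega>. \<Sum>b\<in>Basis. (p \<bullet> b) * (b \<bullet> \<xi> \<omega>)) (\<lambda>y. \<Sum>b\<in>Basis. (p \<bullet> b) * F b y)"
      by (intro cond_exp_fun_sum cond_exp_fun_scale F assms) auto
    moreover have "(\<Sum>b\<in>Basis. (p \<bullet> b) * (b \<bullet> x)) = p \<bullet> x" for x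
      by (subst (2) euclidean_inner) (simp add: inner_commute)
    moreover have "(\<Sum>b\<in>Basis. (p \<bullet> b) * F b y) = p \<bullet> g y" for y
      by (simp add: g_def inner_sum_right mult.commute)
    ultimately show ?thesis by simp
  qed
  define O' where "O' a = {x::'a. fst a \<bullet> x < snd a}" for a :: "'a \<times> real"
  define \<A> where "\<A> = {a. \<forall>x\<in>K. snd a \<le> fst a \<bullet> x}"
  have op: "open (O' a)" for a
    unfolding O'_def by (rule open_halfspace_lt)
  obtain G where G: "G \<subseteq> O' ` \<A>" "countable G" "\<Union>G = \<Union>(O' ` \<A>)"
    by (rule Lindelof[of "O' ` \<A>"]) (use op in auto)
  obtain C where C: "C \<subseteq> \<A>" "countable C" "G = O' ` C"
    using G(1,2) by (metis countable_subset_image)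
  \<comment> \<open>Only countably many half-spaces are tested, so the exceptional null sets
    together remain null; by the Lindelof choice of \<open>C\<close> they still detect every point
    outside \<open>K\<close>.\<close>
  have "AE y in \<nu>. \<forall>a\<in>C. snd a \<le> fst a \<bullet> g y"
  proof (subst AE_ball_countable[OF C(2)], intro ballI)
    fix a assume a: "a \<in> C"
    have "AE y in \<nu>. y \<in> space \<nu> \<longrightarrow> snd a \<le> fst a \<bullet> g y"
      using xiK a C(1)
      by (intro cond_exp_fun_mono[OF assms(2) cond_exp_fun_const[OF assms(1-3)] g])
         (auto simp: \<A>_def elim!: eventually_mono)
    then show "AE y in \<nu>. snd a \<le> fst a \<bullet> g y" using AE_space by eventually_elim auto
  qed
  then have gK: "AE y in \<nu>. g y \<in> K"
  proof eventually_elim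
    case (elim y)
    show "g y \<in> K"
    proof (rule ccontr)
      assume "g y \<notin> K"
      then obtain a b where ab: "a \<bullet> g y < b" "\<forall>x\<in>K. b < a \<bullet> x"
        using separating_hyperplane_closed_point[OF K(2) compact_imp_closed[OF K(1)]] by blast
      then have "g y \<in> \<Union>(O' ` \<A>)" by (intro UN_I[of "(a, b)"]) (auto simp: \<A>_def O'_def less_imp_le)
      then have "g y \<in> \<Union>(O' ` C)" using G(3) C(3) by simp
      then show False using elim by (auto simp: O'_def not_less[symmetric])
    qed
  qed
  obtain z where z: "z \<in> K" using K(3) by blast
  \<comment> \<open>Redefining on a null set puts the value in \<open>K\<close> for every
    \<open>y\<close>, not just for almost every one.\<close>
  define f where "f y = (if g y \<in> K then g y else z)" for y
  have [measurable]: "K \<in> sets borel" by (rule borel_closed[OF compact_imp_closed[OF K(1)]])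
  have fm[measurable]: "f \<in> borel_measurable \<nu>" unfolding f_def by measurable
  have fg: "AE y in \<nu>. f y = g y" using gK by eventually_elim (simp add: f_def)
  have "cond_exp_fun \<mu> \<nu> Y (\<lambda>\<omega>. p \<bullet> \<xi> \<omega>) (\<lambda>y. p \<bullet> f y)" for p
  proof -
    have "integrable \<nu> (\<lambda>y. p \<bullet> f y) \<longleftrightarrow> integrable \<nu> (\<lambda>y. p \<bullet> g y)"
      using fg by (intro integrable_cong_AE) (auto elim!: eventually_mono)
    moreover have "(\<integral>y. (p \<bullet> f y) * \<psi> y \<partial>\<nu>) = (\<integral>y. (p \<bullet> g y) * \<psi> y \<partial>\<nu>)"
      if "\<psi> \<in> borel_measurable \<nu>" for \<psi>
      using fg that by (intro integral_cong_AE) (auto elim!: eventually_mono)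
    ultimately show ?thesis using g[of p] by (auto simp: cond_exp_fun_def)
  qed
  with fm z show thesis by (intro that[of f]) (auto simp: f_def)
qed

section \<open>Jensen's inequality for a cost with a parameter\<close>

text \<open>Separating \<open>(x, t)\<close> strictly from the epigraph of \<open>g (_) y\<close>
  gives an affine function strictly below \<open>g (_) y\<close> on \<open>K\<close>. Joint lower
  semi-continuity and compactness of \<open>K\<close> (tube lemma) keep it below
  \<open>g (_) y'\<close> on all of \<open>K\<close> for every parameter \<open>y'\<close> of
  \<open>W\<close> near \<open>y\<close>.\<close>

lemma parametrized_affine_minorant_at:
  fixes K :: "'a::euclidean_space set" and g :: "'a \<Rightarrow> 'b::topological_space \<Rightarrow> real"
  assumes K: "compact K" "convex K" and lsc: "usc_on (K \<times> W) (\<lambda>z. - g (fst z) (snd z))"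
    and conv: "convex_on K (\<lambda>x. g x y)" and xy: "x \<in> K" "y \<in> W" "t < g x y"
  shows "\<exists>p \<beta> V. open V \<and> y \<in> V \<and> (\<forall>y'\<in>V \<inter> W. \<forall>u\<in>K. p \<bullet> u + \<beta> < g u y') \<and> t < p \<bullet> x + \<beta>"
proof -
  have "\<exists>U. \<forall>q. open (U q) \<and> (\<forall>z\<in>K \<times> W. - g (fst z) (snd z) < - q \<longleftrightarrow> z \<in> U q)"
    by (intro choice allI) (metis usc_on_open[OF lsc])
  then obtain U where U: "\<And>q. open (U q)" "\<And>q u v. u \<in> K \<Longrightarrow> v \<in> W \<Longrightarrow> q < g u v \<longleftrightarrow> (u, v) \<in> U q"
    by force
  define E where "E = {e::'a \<times> real. fst e \<in> K \<and> g (fst e) y \<le> snd e}"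
  have sl: "open ((\<lambda>u. (u, y)) -` U q)" for q
    by (intro open_vimage U(1) continuous_intros)
  have "E = (K \<times> UNIV) \<inter> (\<Inter>q. - (((\<lambda>u. (u, y)) -` U q) \<times> {..<q}))"
  proof (intro set_eqI iffI)
    fix e assume e: "e \<in> (K \<times> UNIV) \<inter> (\<Inter>q. - (((\<lambda>u. (u, y)) -` U q) \<times> {..<q}))"
    have "g (fst e) y \<le> snd e"
    proof (rule ccontr)
      assume "\<not> g (fst e) y \<le> snd e"
      then obtain q where q: "snd e < q" "q < g (fst e) y" by (meson dense not_le)
      then have "e \<in> ((\<lambda>u. (u, y)) -` U q) \<times> {..<q}" using e U(2)[of "fst e" y q] xy(2) by (cases e) auto
      then show False using e by blast
    qed
    then show "e \<in> E" using e by (auto simp: E_def)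
  next
    fix e assume e: "e \<in> E"
    then have "e \<notin> ((\<lambda>u. (u, y)) -` U q) \<times> {..<q}" for q
      using U(2)[of "fst e" y q] xy(2) by (cases e) (auto simp: E_def)
    then show "e \<in> (K \<times> UNIV) \<inter> (\<Inter>q. - (((\<lambda>u. (u, y)) -` U q) \<times> {..<q}))"
      using e by (cases e) (auto simp: E_def)
  qed
  moreover have "closed (K \<times> (UNIV::real set))" by (rule closed_Times[OF compact_imp_closed[OF K(1)] closed_UNIV])
  moreover have "closed (\<Inter>q. - (((\<lambda>u. (u, y)) -` U q) \<times> {..<q}))"
    by (intro closed_INT ballI closed_Compl open_Times sl) auto
  ultimately have clE: "closed E" by (simp add: closed_Int)
  have cvE: "convex E"
  proof (rule convexI)
    fix a b :: "'a \<times> real" and u v :: real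
    assume ab: "a \<in> E" "b \<in> E" and uv: "0 \<le> u" "0 \<le> v" "u + v = 1"
    have "g (u *\<^sub>R fst a + v *\<^sub>R fst b) y \<le> u * g (fst a) y + v * g (fst b) y"
      using conv ab uv by (auto simp: convex_on_def E_def)
    also have "\<dots> \<le> u * snd a + v * snd b"
      using ab uv by (intro add_mono mult_left_mono) (auto simp: E_def)
    finally show "u *\<^sub>R a + v *\<^sub>R b \<in> E"
      using convexD[OF K(2), of "fst a" "fst b" u v] ab uv by (auto simp: E_def)
  qed
  have "(x, t) \<notin> E" using xy by (simp add: E_def)
  then obtain a b where ab: "a \<bullet> (x, t) < b" "\<forall>e\<in>E. a \<bullet> e > b"
    using separating_hyperplane_closed_point[OF cvE clE] by blast
  obtain p q where pq: "a = (p, q)" by (cases a)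
  have below: "b < p \<bullet> u + q * g u y" if "u \<in> K" for u
    using ab(2) that by (auto simp: E_def pq inner_Pair)
  have at: "p \<bullet> x + q * t < b" using ab(1) by (simp add: pq inner_Pair)
  have "q * t < q * g x y" using below[OF xy(1)] at by linarith
  then have q: "q > 0" using xy(3) by (metis less_eq_real_def linorder_not_le mult_le_cancel_left_neg mult_zero_left neq_iff)
  define p' \<beta> where "p' = (- 1 / q) *\<^sub>R p" and "\<beta> = b / q"
  have sub: "p' \<bullet> u + \<beta> < g u y" if "u \<in> K" for u
    using below[OF that] q by (simp add: p'_def \<beta>_def field_simps)
  have top: "t < p' \<bullet> x + \<beta>" using at q by (simp add: p'_def \<beta>_def field_simps)
  \<comment> \<open>On \<open>K\<close> times \<open>W\<close> this is the set where the affine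
    function stays strictly below \<open>g\<close>; the intermediate thresholds \<open>s\<close>
    exhibit it as a union of open sets.\<close>
  define W' where "W' = (\<Union>s. ({u. p' \<bullet> u + \<beta> < s} \<times> UNIV) \<inter> U s)"
  have W': "open W'" unfolding W'_def
    by (intro open_UN ballI open_Int open_Times U(1) open_Collect_less continuous_intros) auto
  have W'iff: "(u, v) \<in> W' \<longleftrightarrow> p' \<bullet> u + \<beta> < g u v" if "u \<in> K" "v \<in> W" for u v
  proof
    assume "(u, v) \<in> W'"
    then obtain s where "p' \<bullet> u + \<beta> < s" "(u, v) \<in> U s" unfolding W'_def by auto
    then show "p' \<bullet> u + \<beta> < g u v" using U(2)[OF that, of s] by simp
  next
    assume "p' \<bullet> u + \<beta> < g u v"
    then obtain s where "p' \<bullet> u + \<beta> < s" "s < g u v" using dense by blast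
    then show "(u, v) \<in> W'" using U(2)[OF that, of s] unfolding W'_def by auto
  qed
  have "open ((\<lambda>z. (snd z, fst z)) -` W')"
    by (intro open_vimage W' continuous_intros)
  moreover have "{y} \<times> K \<subseteq> (\<lambda>z. (snd z, fst z)) -` W'" using W'iff sub xy(2) by auto
  ultimately have "\<exists>V. y \<in> V \<and> open V \<and> V \<times> K \<subseteq> (\<lambda>z. (snd z, fst z)) -` W'"
    by (rule Elementary_Topology.tube_lemma[OF K(1)])
  then obtain V where V: "open V" "y \<in> V" "V \<times> K \<subseteq> (\<lambda>z. (snd z, fst z)) -` W'"
    by (elim exE conjE)
  have "p' \<bullet> u + \<beta> < g u y'" if "y' \<in> V \<inter> W" "u \<in> K" for u y'
  proof -
    have "(y', u) \<in> V \<times> K" using that by simp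
    from subsetD[OF V(3) this] have "(u, y') \<in> W'" by simp
    then show ?thesis using W'iff[OF that(2), of y'] that by simp
  qed
  with V(1,2) top show ?thesis by (intro exI[of _ p'] exI[of _ \<beta>] exI[of _ V]) simp
qed

text \<open>Each affine minorant, on its open region of validity, gives a lower bound for
  \<open>H\<close>, the conditional mean of the cost, by monotonicity of conditional expectations.
  Countably many suffice by Lindelof, applied to the points \<open>(f y, y, H y)\<close>, and their
  supremum recovers \<open>g (f y) y\<close>.\<close>

lemma parametrized_jensen:
  fixes K :: "'a::euclidean_space set" and g :: "'a \<Rightarrow> 'b::second_countable_topology \<Rightarrow> real"
  assumes "prob_space \<mu>" "Y \<in> measurable \<mu> \<nu>" "distr \<mu> \<nu> Y = \<nu>" "sets \<nu> = sets borel"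
    and K: "compact K" "convex K" and W: "W \<in> sets borel"
    and lsc: "usc_on (K \<times> W) (\<lambda>z. - g (fst z) (snd z))"
    and conv: "\<And>y. y \<in> W \<Longrightarrow> convex_on K (\<lambda>x. g x y)"
    and nn: "\<And>x y. 0 \<le> g x y"
    and gm: "(\<lambda>\<omega>. g (\<xi> \<omega>) (Y \<omega>)) \<in> borel_measurable \<mu>"
    and xiK: "AE \<omega> in \<mu>. \<xi> \<omega> \<in> K" and YW: "AE \<omega> in \<mu>. Y \<omega> \<in> W"
    and f: "\<And>y. f y \<in> K" "\<And>p. cond_exp_fun \<mu> \<nu> Y (\<lambda>\<omega>. p \<bullet> \<xi> \<omega>) (\<lambda>y. p \<bullet> f y)"
  shows "(\<integral>\<^sup>+ y. ennreal (g (f y) y) \<partial>\<nu>) \<le> (\<integral>\<^sup>+ \<omega>. ennreal (g (\<xi> \<omega>) (Y \<omega>)) \<partial>\<mu>)"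
proof (cases "(\<integral>\<^sup>+ \<omega>. ennreal (g (\<xi> \<omega>) (Y \<omega>)) \<partial>\<mu>) = \<infinity>")
  case False
  interpret prob_space \<mu> by fact
  have zint: "integrable \<mu> (\<lambda>\<omega>. g (\<xi> \<omega>) (Y \<omega>))"
    using False gm nn by (simp add: integrable_iff_bounded less_top)
  obtain H where H: "cond_exp_fun \<mu> \<nu> Y (\<lambda>\<omega>. g (\<xi> \<omega>) (Y \<omega>)) H"
    using cond_exp_fun_exists[OF assms(1-3) zint] by blast
  define \<A> where "\<A> = {a::'a \<times> real \<times> 'b set. open (snd (snd a)) \<and>
      (\<forall>y'\<in>snd (snd a) \<inter> W. \<forall>u\<in>K. fst a \<bullet> u + fst (snd a) < g u y')}"
  define O' where "O' a = {h::'a \<times> 'b \<times> real. fst (snd h) \<in> snd (snd a) \<and> snd (snd h) < fst a \<bullet> fst h + fst (snd a)}"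
    for a :: "'a \<times> real \<times> 'b set"
  have op: "open (O' a)" if "a \<in> \<A>" for a
  proof -
    have "open {h::'a \<times> 'b \<times> real. fst (snd h) \<in> snd (snd a)}"
      using open_vimage[of "snd (snd a)" "\<lambda>h::'a \<times> 'b \<times> real. fst (snd h)"] that
      by (simp add: \<A>_def vimage_def continuous_intros)
    moreover have "open {h::'a \<times> 'b \<times> real. snd (snd h) < fst a \<bullet> fst h + fst (snd a)}"
      by (intro open_Collect_less continuous_intros)
    ultimately show ?thesis unfolding O'_def Collect_conj_eq by (rule open_Int)
  qed
  obtain G where G: "G \<subseteq> O' ` \<A>" "countable G" "\<Union>G = \<Union>(O' ` \<A>)"
    by (rule Lindelof[of "O' ` \<A>"]) (use op in auto)
  obtain C where C: "C \<subseteq> \<A>" "countable C" "G = O' ` C"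
    using G(1,2) by (metis countable_subset_image)
  have "AE y in \<nu>. \<forall>a\<in>C. y \<in> snd (snd a) \<inter> W \<longrightarrow> fst a \<bullet> f y + fst (snd a) \<le> H y"
  proof (subst AE_ball_countable[OF C(2)], intro ballI)
    fix a assume "a \<in> C"
    then have a: "a \<in> \<A>" using C by blast
    have "snd (snd a) \<inter> W \<in> sets \<nu>" using a W assms(4) by (auto simp: \<A>_def)
    moreover have "AE \<omega> in \<mu>. Y \<omega> \<in> snd (snd a) \<inter> W \<longrightarrow> fst a \<bullet> \<xi> \<omega> + fst (snd a) \<le> g (\<xi> \<omega>) (Y \<omega>)"
      using xiK by eventually_elim (use a in \<open>auto simp: \<A>_def less_imp_le\<close>)
    ultimately show "AE y in \<nu>. y \<in> snd (snd a) \<inter> W \<longrightarrow> fst a \<bullet> f y + fst (snd a) \<le> H y"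
      by (intro cond_exp_fun_mono[OF assms(2) cond_exp_fun_add[OF assms(2) f(2) cond_exp_fun_const[OF assms(1-3)]] H])
  qed
  moreover have "AE y in \<nu>. y \<in> W"
  proof -
    have "AE y in distr \<mu> \<nu> Y. y \<in> W"
      using YW W assms(2,4) by (subst AE_distr_iff) auto
    then show ?thesis unfolding assms(3) .
  qed
  ultimately have le: "AE y in \<nu>. g (f y) y \<le> H y"
  proof eventually_elim
    case (elim y)
    show ?case
    proof (rule ccontr)
      assume "\<not> g (f y) y \<le> H y"
      then have "H y < g (f y) y" by simp
      from parametrized_affine_minorant_at[OF K lsc conv[OF elim(2)] f(1) elim(2) this]
      obtain p \<beta> V where "open V" "y \<in> V" "\<forall>y'\<in>V \<inter> W. \<forall>u\<in>K. p \<bullet> u + \<beta> < g u y'" "H y < p \<bullet> f y + \<beta>"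
        by (elim exE conjE) (rule that)
      then have "(f y, y, H y) \<in> \<Union>(O' ` \<A>)"
        by (intro UN_I[of "(p, \<beta>, V)"]) (auto simp: \<A>_def O'_def)
      then have "(f y, y, H y) \<in> \<Union>(O' ` C)" using G(3) C(3) by simp
      then show False using elim by (force simp: O'_def)
    qed
  qed
  have Hnn: "AE y in \<nu>. 0 \<le> H y" using le by eventually_elim (use nn order_trans in blast)
  have "(\<integral>\<^sup>+ y. ennreal (g (f y) y) \<partial>\<nu>) \<le> (\<integral>\<^sup>+ y. ennreal (H y) \<partial>\<nu>)"
    using le by (intro nn_integral_mono_AE) (auto elim!: eventually_mono simp: ennreal_leI)
  also have "\<dots> = ennreal (\<integral>y. H y \<partial>\<nu>)"
    using H Hnn by (intro nn_integral_eq_integral) (auto simp: cond_exp_fun_def)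
  also have "(\<integral>y. H y \<partial>\<nu>) = (\<integral>\<omega>. g (\<xi> \<omega>) (Y \<omega>) \<partial>\<mu>)"
    using cond_exp_funD[OF H, of "\<lambda>_. 1" 1] by simp
  also have "ennreal \<dots> = (\<integral>\<^sup>+ \<omega>. ennreal (g (\<xi> \<omega>) (Y \<omega>)) \<partial>\<mu>)"
    using zint nn by (intro nn_integral_eq_integral[symmetric]) auto
  finally show ?thesis .
qed simp

section \<open>Almost everywhere convergence of midpoint combinations\<close>

text \<open>Midpoints generate only dyadic convex combinations, but the convergence argument takes
  no others, and every property used later (measurability, values in a convex set, cost bounds,
  lower bounds on affine functionals) survives one midpoint step. Indexing by the tail
  \<open>m\<close> ties the limit to large indices.\<close>

inductive_set midpoint_hull :: "(nat \<Rightarrow> 'b \<Rightarrow> 'a::real_vector) \<Rightarrow> nat \<Rightarrow> ('b \<Rightarrow> 'a) set"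
  for f :: "nat \<Rightarrow> 'b \<Rightarrow> 'a" and m :: nat where
  base: "m \<le> k \<Longrightarrow> f k \<in> midpoint_hull f m"
| mid: "g \<in> midpoint_hull f m \<Longrightarrow> h \<in> midpoint_hull f m \<Longrightarrow>
    (\<lambda>y. (1/2) *\<^sub>R (g y + h y)) \<in> midpoint_hull f m"

lemma midpoint_hull_mono: "g \<in> midpoint_hull f n \<Longrightarrow> m \<le> n \<Longrightarrow> g \<in> midpoint_hull f m"
  by (induction rule: midpoint_hull.induct) (auto intro: midpoint_hull.intros)

lemma midpoint_hull_measurable:
  fixes f :: "nat \<Rightarrow> 'b \<Rightarrow> 'a::euclidean_space"
  assumes "\<And>k. f k \<in> borel_measurable \<nu>"
  shows "g \<in> midpoint_hull f m \<Longrightarrow> g \<in> borel_measurable \<nu>"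
  by (induction rule: midpoint_hull.induct) (use assms in auto)

lemma midpoint_hull_mem:
  assumes "convex S" "\<And>k. f k y \<in> S"
  shows "g \<in> midpoint_hull f m \<Longrightarrow> g y \<in> S"
proof (induction rule: midpoint_hull.induct)
  case (mid g h)
  then show ?case using convexD[OF assms(1), of "g y" "h y" "1/2" "1/2"] by (simp add: scaleR_add_right)
qed (use assms in auto)

text \<open>The Euclidean length of the vector \<open>(1, x)\<close>: strictly convex like a square,
  yet of linear growth, so that first moments suffice to integrate it.\<close>

definition jnorm :: "'a::real_inner \<Rightarrow> real" where
  "jnorm x = sqrt (1 + (norm x)\<^sup>2)"

lemma jnorm_bounds: "1 \<le> jnorm x" "jnorm x \<le> 1 + norm x"
proof -
  show "1 \<le> jnorm x" by (simp add: jnorm_def)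
  show "jnorm x \<le> 1 + norm x"
    unfolding jnorm_def by (rule real_le_lsqrt) (auto simp: power2_eq_square algebra_simps)
qed

text \<open>With \<open>u\<close> and \<open>w\<close> the lengths of \<open>(1, a)\<close> and
  \<open>(1, b)\<close>, the quantity \<open>u * w - (1 + d)\<close> is the Cauchy-Schwarz defect of
  these vectors. By \<open>fac\<close> it equals the midpoint gap up to a factor, and by
  \<open>key\<close> it dominates the squared distance up to another one. The cubic weight reflects
  that the convexity degenerates at infinity.\<close>

lemma jnorm_midpoint_gap:
  "(norm (a - b))\<^sup>2 \<le> (jnorm a + jnorm b) ^ 3 * ((jnorm a + jnorm b) / 2 - jnorm ((1/2) *\<^sub>R (a + b)))"
  and jnorm_midpoint: "jnorm ((1/2) *\<^sub>R (a + b)) \<le> (jnorm a + jnorm b) / 2"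
proof -
  define u w m d where "u = jnorm a" and "w = jnorm b" and "m = jnorm ((1/2) *\<^sub>R (a + b))" and "d = a \<bullet> b"
  have u: "u\<^sup>2 = 1 + (norm a)\<^sup>2" and w: "w\<^sup>2 = 1 + (norm b)\<^sup>2" by (auto simp: u_def w_def jnorm_def)
  have m4: "4 * m\<^sup>2 = 4 + (norm a)\<^sup>2 + (norm b)\<^sup>2 + 2 * d"
  proof -
    have "m\<^sup>2 = 1 + (norm ((1/2) *\<^sub>R (a + b)))\<^sup>2" by (simp add: m_def jnorm_def)
    also have "(norm ((1/2) *\<^sub>R (a + b)))\<^sup>2 = (norm (a + b))\<^sup>2 / 4" by (simp add: power_divide)
    also have "(norm (a + b))\<^sup>2 = (norm a)\<^sup>2 + (norm b)\<^sup>2 + 2 * d"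
      by (simp add: power2_norm_eq_inner inner_add_left inner_add_right inner_commute d_def)
    finally show ?thesis by simp
  qed
  have pos: "1 \<le> u" "1 \<le> w" "1 \<le> m" by (auto simp: u_def w_def m_def jnorm_bounds)
  have uw0: "0 < u * w" using pos by (intro mult_pos_pos) auto
  have dsq: "d\<^sup>2 \<le> (norm a)\<^sup>2 * (norm b)\<^sup>2"
    using Cauchy_Schwarz_ineq[of a b] by (simp add: d_def power2_norm_eq_inner)
  have diff: "(norm (a - b))\<^sup>2 = (norm a)\<^sup>2 + (norm b)\<^sup>2 - 2 * d"
    by (simp add: power2_norm_eq_inner inner_diff_left inner_diff_right inner_commute d_def)
  have key: "(norm (a - b))\<^sup>2 \<le> (u * w)\<^sup>2 - (1 + d)\<^sup>2"
    unfolding diff power_mult_distrib u w using dsq by (simp add: power2_eq_square algebra_simps)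
  then have "\<bar>1 + d\<bar>\<^sup>2 \<le> (u * w)\<^sup>2" using zero_le_power2[of "norm (a - b)"] unfolding power2_abs by linarith
  then have ab: "\<bar>1 + d\<bar> \<le> u * w" using uw0 power2_le_imp_le less_imp_le by blast
  define s where "s = u + w"
  have fac: "(s - 2 * m) * (s + 2 * m) = 2 * (u * w - 1 - d)"
  proof -
    have "(s - 2 * m) * (s + 2 * m) = u\<^sup>2 + w\<^sup>2 + 2 * (u * w) - 4 * m\<^sup>2"
      by (simp add: s_def power2_eq_square algebra_simps)
    then show ?thesis unfolding u w m4 by simp
  qed
  have "0 \<le> (s - 2 * m) * (s + 2 * m)" using ab fac by simp
  moreover have "0 < s + 2 * m" using pos by (simp add: s_def)
  ultimately have sm: "0 \<le> s - 2 * m" by (simp add: zero_le_mult_iff)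
  then show "jnorm ((1/2) *\<^sub>R (a + b)) \<le> (jnorm a + jnorm b) / 2" by (simp add: s_def u_def w_def m_def)
  have "(norm (a - b))\<^sup>2 \<le> (u * w - 1 - d) * (u * w + 1 + d)"
    using key by (simp add: power2_eq_square algebra_simps)
  also have "\<dots> \<le> (u * w - 1 - d) * (2 * (u * w))"
    using ab by (intro mult_left_mono) auto
  also have "\<dots> = (s - 2 * m) * ((s + 2 * m) * (u * w))" using fac by simp
  also have "\<dots> \<le> (s - 2 * m) * ((2 * s) * (s\<^sup>2 / 4))"
  proof (intro mult_left_mono mult_mono sm)
    have "0 \<le> (u - w)\<^sup>2" by simp
    then show "u * w \<le> s\<^sup>2 / 4" by (simp add: s_def power2_eq_square algebra_simps)
  qed (use sm pos uw0 in \<open>auto simp: s_def\<close>)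
  also have "\<dots> = s ^ 3 * (s / 2 - m)" by (simp add: power2_eq_square power3_eq_cube field_simps)
  finally show "(norm (a - b))\<^sup>2 \<le> (jnorm a + jnorm b) ^ 3 * ((jnorm a + jnorm b) / 2 - jnorm ((1/2) *\<^sub>R (a + b)))"
    by (simp add: s_def u_def w_def m_def)
qed

text \<open>A Young inequality with exponents 4 and 4/3.\<close>

lemma sqrt_le_gap:
  assumes "0 \<le> s" "0 < w" "0 < \<tau>" "s\<^sup>2 \<le> w ^ 3 * G" "0 \<le> G"
  shows "sqrt s \<le> G / \<tau> ^ 3 + \<tau> * w"
proof (cases "sqrt s \<le> \<tau> * w")
  case True
  have "0 \<le> G / \<tau> ^ 3" using assms by simp
  with True show ?thesis by linarith
next
  case False
  define r where "r = sqrt s"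
  have "0 < \<tau> * w" using assms by simp
  then have r: "r > \<tau> * w" "r > 0" using False by (auto simp: r_def simp del: real_sqrt_gt_0_iff)
  have rs: "s = r\<^sup>2" using assms(1) by (simp add: r_def)
  have "r ^ 4 \<le> w ^ 3 * G" using assms(4) rs by simp
  then have "r ^ 4 * \<tau> ^ 3 \<le> (\<tau> * w) ^ 3 * G" using assms(3) by (simp add: power_mult_distrib mult.commute mult.left_commute)
  also have "\<dots> \<le> r ^ 3 * G" using r assms by (intro mult_right_mono power_mono) auto
  finally have "r ^ 3 * (r * \<tau> ^ 3) \<le> r ^ 3 * G" by (simp add: power_numeral_reduce mult_ac)
  then have "r * \<tau> ^ 3 \<le> G" using r(2) by simp
  then have "r \<le> G / \<tau> ^ 3" using assms(3) by (simp add: pos_le_divide_eq)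
  moreover have "0 \<le> \<tau> * w" using assms by simp
  ultimately show ?thesis by (simp add: r_def)
qed

text \<open>Square roots occur because \<open>jnorm_midpoint_gap\<close> controls a squared distance
  by a cube times the gap: after a fourth root, weight and gap have total degree one, which matches
  integrability of first order. Summable roots are eventually below 1 and then dominate the
  increments themselves.\<close>

lemma convergent_of_summable_sqrt_increments:
  fixes x :: "nat \<Rightarrow> 'a::banach"
  assumes "summable (\<lambda>j. sqrt (norm (x (Suc j) - x j)))"
  shows "convergent x"
proof -
  have "(\<lambda>j. sqrt (norm (x (Suc j) - x j))) \<longlonglongrightarrow> 0" using assms by (rule summable_LIMSEQ_zero)
  then have "eventually (\<lambda>j. sqrt (norm (x (Suc j) - x j)) < 1) sequentially"
    by (rule order_tendstoD) simp
  then have "eventually (\<lambda>j. norm (x (Suc j) - x j) \<le> sqrt (norm (x (Suc j) - x j))) sequentially"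
  proof eventually_elim
    case (elim j)
    define q where "q = sqrt (norm (x (Suc j) - x j))"
    have "norm (x (Suc j) - x j) = q * q" by (simp add: q_def)
    moreover have "q * q \<le> q * 1" using elim by (intro mult_left_mono) (auto simp: q_def)
    ultimately show ?case by (simp add: q_def)
  qed
  then have "summable (\<lambda>j. x (Suc j) - x j)"
    by (intro summable_comparison_test_ev[OF _ assms]) auto
  then have "convergent (\<lambda>n. \<Sum>j<n. x (Suc j) - x j)" by (rule summable_iff_convergent[THEN iffD1])
  moreover have "(\<Sum>j<n. x (Suc j) - x j) = x n - x 0" for n by (rule sum_lessThan_telescope)
  ultimately have "convergent (\<lambda>n. x n - x 0)" by simp
  then have "convergent (\<lambda>n. (x n - x 0) + x 0)" by (intro convergent_add convergent_const)
  then show ?thesis by simp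
qed

text \<open>Nearly minimising the strictly convex functional \<open>\<integral>jnorm g\<close> over the tails of the
  midpoint hull forces the minimisers to converge.\<close>

lemma midpoint_hull_convergent:
  fixes f :: "nat \<Rightarrow> 'b \<Rightarrow> 'a::euclidean_space"
  assumes "finite_measure \<nu>" and fm: "\<And>k. f k \<in> borel_measurable \<nu>"
    and fi: "\<And>k. integrable \<nu> (\<lambda>y. norm (f k y))" "\<And>k. (\<integral>y. norm (f k y) \<partial>\<nu>) \<le> C"
  obtains g where "\<And>n. g n \<in> midpoint_hull f n" "AE y in \<nu>. convergent (\<lambda>n. g n y)"
proof -
  interpret finite_measure \<nu> by fact
  have jm[measurable]: "(jnorm :: 'a \<Rightarrow> real) \<in> borel_measurable borel" unfolding jnorm_def by measurable
  define I where "I g = (\<integral>y. jnorm (g y) \<partial>\<nu>)" for g :: "'b \<Rightarrow> 'a"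
  define B where "B = measure \<nu> (space \<nu>) + C"
  have hull: "g \<in> borel_measurable \<nu> \<and> integrable \<nu> (\<lambda>y. jnorm (g y)) \<and> I g \<le> B"
    if "g \<in> midpoint_hull f n" for g n using that
  proof (induction rule: midpoint_hull.induct)
    case (base k)
    note fm[measurable]
    have i: "integrable \<nu> (\<lambda>y. 1 + norm (f k y))" using fi by simp
    have "integrable \<nu> (\<lambda>y. jnorm (f k y))"
    proof (rule Bochner_Integration.integrable_bound[OF i])
      show "AE y in \<nu>. norm (jnorm (f k y)) \<le> norm (1 + norm (f k y))"
      proof (intro AE_I2)
        fix y show "norm (jnorm (f k y)) \<le> norm (1 + norm (f k y))"
          using jnorm_bounds[of "f k y"] unfolding real_norm_def by linarith
      qed
    qed simp
    moreover from this have "I (f k) \<le> (\<integral>y. 1 + norm (f k y) \<partial>\<nu>)"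
      unfolding I_def using i by (intro integral_mono) (auto simp: jnorm_bounds)
    ultimately show ?case using fi fm by (auto simp: B_def intro: order_trans)
  next
    case (mid g h)
    then have [measurable]: "g \<in> borel_measurable \<nu>" "h \<in> borel_measurable \<nu>" by auto
    have i: "integrable \<nu> (\<lambda>y. (jnorm (g y) + jnorm (h y)) / 2)" using mid by simp
    have "integrable \<nu> (\<lambda>y. jnorm ((1/2) *\<^sub>R (g y + h y)))"
    proof (rule Bochner_Integration.integrable_bound[OF i])
      show "AE y in \<nu>. norm (jnorm ((1/2) *\<^sub>R (g y + h y))) \<le> norm ((jnorm (g y) + jnorm (h y)) / 2)"
      proof (intro AE_I2)
        fix y show "norm (jnorm ((1/2) *\<^sub>R (g y + h y))) \<le> norm ((jnorm (g y) + jnorm (h y)) / 2)"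
          using jnorm_bounds(1)[of "(1/2) *\<^sub>R (g y + h y)"] jnorm_midpoint[of "g y" "h y"]
          unfolding real_norm_def by linarith
      qed
    qed measurable
    moreover from this have "I (\<lambda>y. (1/2) *\<^sub>R (g y + h y)) \<le> (\<integral>y. (jnorm (g y) + jnorm (h y)) / 2 \<partial>\<nu>)"
      unfolding I_def using i by (intro integral_mono jnorm_midpoint) auto
    moreover have "\<dots> = (I g + I h) / 2" using mid by (simp add: I_def)
    ultimately show ?case using mid by auto
  qed
  have I0: "0 \<le> I g" for g
    unfolding I_def by (intro integral_nonneg_AE AE_I2 order_trans[OF zero_le_one jnorm_bounds(1)])
  \<comment> \<open>These infima increase with \<open>n\<close> and stay below \<open>B\<close>, so
    near-minimisers over late tails all have nearly the same value \<open>s\<close>.\<close>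
  define a where "a n = Inf (I ` midpoint_hull f n)" for n
  have ne: "midpoint_hull f n \<noteq> {}" for n using midpoint_hull.base[of n n f] by auto
  have bdd: "bdd_below (I ` midpoint_hull f n)" for n using I0 by (intro bdd_belowI[of _ 0]) auto
  have a_le: "a n \<le> I g" if "g \<in> midpoint_hull f n" for n g
    unfolding a_def using that bdd by (intro cInf_lower) auto
  have a_B: "a n \<le> B" for n using ne[of n] a_le[of _ n] hull[of _ n] by (meson all_not_in_conv order_trans)
  have bdda: "bdd_above (range a)" using a_B by (intro bdd_aboveI[of _ B]) auto
  have inca: "a m \<le> a n" if "m \<le> n" for m n
    unfolding a_def using ne bdd that by (intro cInf_superset_mono image_mono) (auto intro: midpoint_hull_mono)
  define s where "s = Sup (range a)"
  \<comment> \<open>Chosen as the fourth power of the weight \<open>\<tau> j = (1/2) ^ j\<close>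
    used below: the quotient \<open>\<epsilon> j / \<tau> j ^ 3\<close> is still summable.\<close>
  define \<epsilon> where "\<epsilon> j = (1/16 :: real) ^ j" for j :: nat
  have eps: "0 < \<epsilon> j" "\<epsilon> (Suc j) \<le> \<epsilon> j" for j by (auto simp: \<epsilon>_def)
  have "\<exists>n\<ge>j. s - \<epsilon> j < a n" for j
  proof -
    obtain n0 where "s - \<epsilon> j < a n0"
      using less_cSup_iff[of "range a" "s - \<epsilon> j"] bdda eps(1)[of j] by (auto simp: s_def)
    then show ?thesis using inca[of n0 "max n0 j"] by (intro exI[of _ "max n0 j"]) auto
  qed
  \<comment> \<open>Taking the least admissible index makes \<open>\<kappa>\<close> monotone, so
    \<open>g (Suc j)\<close> also belongs to the hull of index \<open>\<kappa> j\<close> and may be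
    averaged with \<open>g j\<close> there.\<close>
  define \<kappa> where "\<kappa> j = (LEAST n. j \<le> n \<and> s - \<epsilon> j < a n)" for j
  have k: "j \<le> \<kappa> j" "s - \<epsilon> j < a (\<kappa> j)" for j
    using LeastI_ex[OF \<open>\<exists>n\<ge>j. s - \<epsilon> j < a n\<close>] by (auto simp: \<kappa>_def)
  have kmono: "\<kappa> j \<le> \<kappa> (Suc j)" for j
    using k[of "Suc j"] eps(2)[of j] unfolding \<kappa>_def[of j] by (intro Least_le) linarith
  have "\<exists>g. \<forall>j. g j \<in> midpoint_hull f (\<kappa> j) \<and> I (g j) < a (\<kappa> j) + \<epsilon> j"
  proof (intro choice allI)
    fix j
    have "\<exists>x\<in>I ` midpoint_hull f (\<kappa> j). x < a (\<kappa> j) + \<epsilon> j"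
      using cInf_less_iff[of "I ` midpoint_hull f (\<kappa> j)" "a (\<kappa> j) + \<epsilon> j"] ne bdd eps(1)[of j]
      by (simp add: a_def)
    then show "\<exists>g. g \<in> midpoint_hull f (\<kappa> j) \<and> I g < a (\<kappa> j) + \<epsilon> j" by auto
  qed
  then obtain g where g: "\<And>j. g j \<in> midpoint_hull f (\<kappa> j)" "\<And>j. I (g j) < a (\<kappa> j) + \<epsilon> j" by blast
  have as: "a n \<le> s" for n unfolding s_def using bdda by (intro cSup_upper) auto
  have gm[measurable]: "g j \<in> borel_measurable \<nu>" and gi: "integrable \<nu> (\<lambda>y. jnorm (g j y))" and gB: "I (g j) \<le> B" for j
    using hull[OF g(1)[of j]] by auto
  define G where "G j y = (jnorm (g (Suc j) y) + jnorm (g j y)) / 2 - jnorm ((1/2) *\<^sub>R (g (Suc j) y + g j y))" for j y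
  have gS: "g (Suc j) \<in> midpoint_hull f (\<kappa> j)" for j using midpoint_hull_mono[OF g(1) kmono] .
  have hm: "(\<lambda>y. (1/2) *\<^sub>R (g (Suc j) y + g j y)) \<in> midpoint_hull f (\<kappa> j)" for j
    using gS g(1) by (rule midpoint_hull.mid)
  have Gi: "integrable \<nu> (G j)" for j using hull[OF hm] gi unfolding G_def by auto
  \<comment> \<open>Both end points have value at most \<open>s + \<epsilon> j\<close>, while their
    midpoint, still in the hull, has value above \<open>s - \<epsilon> j\<close>.\<close>
  have Gint: "(\<integral>y. G j y \<partial>\<nu>) \<le> 2 * \<epsilon> j" for j
  proof -
    have "(\<integral>y. G j y \<partial>\<nu>) = (I (g (Suc j)) + I (g j)) / 2 - I (\<lambda>y. (1/2) *\<^sub>R (g (Suc j) y + g j y))"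
      using hull[OF hm] gi unfolding G_def I_def by simp
    moreover have "I (g (Suc j)) \<le> s + \<epsilon> j" using g(2)[of "Suc j"] as[of "\<kappa> (Suc j)"] eps(2)[of j] by linarith
    moreover have "I (g j) \<le> s + \<epsilon> j" using g(2)[of j] as[of "\<kappa> j"] by linarith
    moreover have "x \<le> 2 * e"
      if "x = (p + q) / 2 - r" "p \<le> s + e" "q \<le> s + e" "b \<le> r" "s - e < b" for x p q r b e :: real
    proof -
      have "(p + q) / 2 \<le> s + e" using that(2,3) by simp
      then show ?thesis using that(1,4,5) by linarith
    qed
    ultimately show ?thesis using a_le[OF hm[of j]] k(2)[of j] by blast
  qed
  define \<tau> where "\<tau> j = (1/2 :: real) ^ j" for j :: nat
  have pw: "sqrt (norm (g (Suc j) y - g j y)) \<le> G j y / \<tau> j ^ 3 + \<tau> j * (jnorm (g (Suc j) y) + jnorm (g j y))" for j y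
    unfolding G_def
    by (rule sqrt_le_gap)
       (use jnorm_midpoint_gap[of "g (Suc j) y" "g j y"] jnorm_midpoint[of "g (Suc j) y" "g j y"]
          jnorm_bounds(1)[of "g (Suc j) y"] jnorm_bounds(1)[of "g j y"] in \<open>auto simp: \<tau>_def\<close>)
  have bound: "(\<integral>\<^sup>+y. ennreal (sqrt (norm (g (Suc j) y - g j y))) \<partial>\<nu>) \<le> ennreal ((2 + 2 * B) * (1/2) ^ j)" for j
  proof -
    have "(\<integral>\<^sup>+y. ennreal (sqrt (norm (g (Suc j) y - g j y))) \<partial>\<nu>)
        \<le> (\<integral>\<^sup>+y. ennreal (G j y / \<tau> j ^ 3 + \<tau> j * (jnorm (g (Suc j) y) + jnorm (g j y))) \<partial>\<nu>)"
      by (intro nn_integral_mono ennreal_leI pw)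
    also have "\<dots> = ennreal (\<integral>y. G j y / \<tau> j ^ 3 + \<tau> j * (jnorm (g (Suc j) y) + jnorm (g j y)) \<partial>\<nu>)"
      using Gi gi pw by (intro nn_integral_eq_integral AE_I2) (auto intro: order_trans[OF _ pw])
    also have "(\<integral>y. G j y / \<tau> j ^ 3 + \<tau> j * (jnorm (g (Suc j) y) + jnorm (g j y)) \<partial>\<nu>)
        = (\<integral>y. G j y \<partial>\<nu>) / \<tau> j ^ 3 + \<tau> j * (I (g (Suc j)) + I (g j))"
      using Gi gi by (simp add: I_def)
    also have "ennreal \<dots> \<le> ennreal (2 * \<epsilon> j / \<tau> j ^ 3 + \<tau> j * (B + B))"
      using Gint gB by (intro ennreal_leI add_mono divide_right_mono mult_left_mono) (auto simp: \<tau>_def)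
    also have "2 * \<epsilon> j / \<tau> j ^ 3 = 2 * (1/2) ^ j"
    proof -
      have "\<epsilon> j = \<tau> j ^ 3 * (1/2) ^ j"
      proof -
        have "(x::real) ^ 3 * x = x ^ 4" for x by (simp add: power_numeral_reduce)
        then have "\<tau> j ^ 3 * (1/2) ^ j = ((1/2) ^ j) ^ 4" by (simp add: \<tau>_def)
        also have "\<dots> = ((1/2) ^ 4) ^ j" by (simp only: power_mult[symmetric] mult.commute)
        also have "(1/2 :: real) ^ 4 = 1/16" by (simp add: power_divide)
        finally show ?thesis by (simp add: \<epsilon>_def)
      qed
      then show ?thesis by (simp add: \<tau>_def)
    qed
    finally show ?thesis by (simp add: \<tau>_def algebra_simps)
  qed
  have B0: "0 \<le> B" using gB[of 0] I0[of "g 0"] by linarith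
  have "(\<integral>\<^sup>+y. (\<Sum>j. ennreal (sqrt (norm (g (Suc j) y - g j y)))) \<partial>\<nu>)
      = (\<Sum>j. \<integral>\<^sup>+y. ennreal (sqrt (norm (g (Suc j) y - g j y))) \<partial>\<nu>)"
    by (rule nn_integral_suminf) measurable
  also have "\<dots> \<le> (\<Sum>j. ennreal ((2 + 2 * B) * (1/2) ^ j))" by (intro suminf_le bound) auto
  also have "\<dots> = ennreal (\<Sum>j. (2 + 2 * B) * (1/2) ^ j)"
    using B0 by (intro suminf_ennreal2) (auto intro!: summable_mult summable_geometric)
  finally have "(\<integral>\<^sup>+y. (\<Sum>j. ennreal (sqrt (norm (g (Suc j) y - g j y)))) \<partial>\<nu>) \<noteq> \<infinity>"
    by (metis ennreal_less_top infinity_ennreal_def leD)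
  then have "AE y in \<nu>. (\<Sum>j. ennreal (sqrt (norm (g (Suc j) y - g j y)))) \<noteq> \<infinity>"
    by (intro nn_integral_noteq_infinite) measurable
  then have "AE y in \<nu>. convergent (\<lambda>n. g n y)"
  proof eventually_elim
    case (elim y)
    then have "summable (\<lambda>j. sqrt (norm (g (Suc j) y - g j y)))"
      by (intro summable_suminf_not_top) auto
    then show ?case by (rule convergent_of_summable_sqrt_increments)
  qed
  then show thesis using that g(1) midpoint_hull_mono[OF _ k(1)] by blast
qed

section \<open>Exchangeable plans\<close>

text \<open>A permutation acts on both components at once, so it is the pairs
  \<open>(x i, y i)\<close> that are exchangeable. The \<open>y i\<close> are independent with law
  \<open>P\<close>; the \<open>x i\<close> may depend on each other and on all of
  \<open>y\<close>.\<close>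

definition exch_plan ::
  "'a::euclidean_space set \<Rightarrow> 'a measure \<Rightarrow> nat \<Rightarrow> ((nat \<Rightarrow> 'a) \<times> (nat \<Rightarrow> 'a)) measure \<Rightarrow> bool" where
  "exch_plan X P M \<mu> \<longleftrightarrow> prob_space \<mu> \<and> sets \<mu> = sets (spaceM M \<Otimes>\<^sub>M spaceM M) \<and>
     distr \<mu> (spaceM M) snd = prodM M P \<and> (AE z in \<mu>. fst z \<in> tup M X) \<and>
     (\<forall>\<sigma>\<in>perms M. distr \<mu> (spaceM M \<Otimes>\<^sub>M spaceM M)
        (\<lambda>z. (permute M \<sigma> (fst z), permute M \<sigma> (snd z))) = \<mu>)"

lemma measurable_coord: "i < M \<Longrightarrow> (\<lambda>x. x i) \<in> measurable (spaceM M) borel"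
  unfolding spaceM_def by (rule measurable_component_singleton) simp

lemma measurable_reindex:
  assumes "\<And>j. j < N \<Longrightarrow> h j < M"
  shows "(\<lambda>x. restrict (\<lambda>j. x (h j)) {..<N}) \<in> measurable (spaceM M) (spaceM N)"
  unfolding spaceM_def
  by (intro measurable_restrict measurable_component_singleton) (use assms in auto)

lemma measurable_permute: "\<sigma> \<in> perms M \<Longrightarrow> permute M \<sigma> \<in> measurable (spaceM M) (spaceM M)"
  unfolding permute_def[abs_def] comp_def
  by (rule measurable_reindex) (auto simp: perms_def dest: permutes_in_image)

lemma measurable_prN: "N \<le> M \<Longrightarrow> prN N \<in> measurable (spaceM M) (spaceM N)"
  unfolding prN_def[abs_def] using measurable_reindex[of N "\<lambda>j. j" M] by simp

lemma prob_space_prodM: "prob_space P \<Longrightarrow> prob_space (prodM M P)"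
  unfolding prodM_def by (rule prob_space_PiM)

lemma emeasure_prodM:
  assumes "prob_space P" "\<And>j. j < M \<Longrightarrow> A j \<in> sets P"
  shows "emeasure (prodM M P) (PiE {..<M} A) = (\<Prod>j<M. emeasure P (A j))"
proof -
  interpret product_sigma_finite "\<lambda>_::nat. P"
    using assms(1) by (simp add: product_sigma_finite_def prob_space_imp_sigma_finite)
  show ?thesis unfolding prodM_def by (rule emeasure_PiM) (use assms in auto)
qed

lemma prodM_eqI:
  assumes "prob_space P" "sets Q = sets (prodM M P)"
    and "\<And>A. (\<And>j. j < M \<Longrightarrow> A j \<in> sets P) \<Longrightarrow> emeasure Q (PiE {..<M} A) = (\<Prod>j<M. emeasure P (A j))"
  shows "Q = prodM M P"
proof -
  interpret product_sigma_finite "\<lambda>_::nat. P"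
    using assms(1) by (simp add: product_sigma_finite_def prob_space_imp_sigma_finite)
  show ?thesis unfolding prodM_def using assms by (intro PiM_eqI) (auto simp: prodM_def)
qed

text \<open>Serves to condition an i.i.d. sample on the coordinates outside \<open>J\<close>: those
  in \<open>J\<close> are redrawn from an independent copy, and Fubini then integrates them out. The
  two laws are compared on rectangles.\<close>

lemma distr_prodM_resample:
  fixes P :: "'a::euclidean_space measure"
  assumes P: "prob_space P" "sets P = sets borel" and J: "J \<subseteq> {..<M}" "inj_on h J" "h ` J \<subseteq> {..<N}"
  defines "T \<equiv> (\<lambda>v. restrict (\<lambda>j. if j \<in> J then snd v (h j) else fst v j) {..<M})"
  shows "T \<in> measurable (prodM M P \<Otimes>\<^sub>M prodM N P) (spaceM M)"
    and "distr (prodM M P \<Otimes>\<^sub>M prodM N P) (spaceM M) T = prodM M P"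
proof -
  interpret pM: prob_space "prodM M P" by (rule prob_space_prodM[OF P(1)])
  interpret pN: prob_space "prodM N P" by (rule prob_space_prodM[OF P(1)])
  interpret pp: pair_sigma_finite "prodM M P" "prodM N P" ..
  have [measurable_cong]: "sets (prodM M P) = sets (spaceM M)" "sets (prodM N P) = sets (spaceM N)"
    using sets_prodM[OF P(2)] by auto
  show Tm: "T \<in> measurable (prodM M P \<Otimes>\<^sub>M prodM N P) (spaceM M)"
    unfolding T_def spaceM_def[of M]
  proof (rule measurable_restrict)
    fix j assume j: "j \<in> {..<M}"
    show "(\<lambda>v. if j \<in> J then snd v (h j) else fst v j) \<in> measurable (prodM M P \<Otimes>\<^sub>M prodM N P) borel"
    proof (cases "j \<in> J")
      case True
      then have "h j < N" using J by auto
      note measurable_coord[OF this, measurable]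
      show ?thesis using True by simp
    next
      case False
      have "j < M" using j by simp
      note measurable_coord[OF this, measurable]
      show ?thesis using False by simp
    qed
  qed
  show "distr (prodM M P \<Otimes>\<^sub>M prodM N P) (spaceM M) T = prodM M P"
  proof (rule prodM_eqI[OF P(1)])
    show "sets (distr (prodM M P \<Otimes>\<^sub>M prodM N P) (spaceM M) T) = sets (prodM M P)"
      using sets_prodM[OF P(2)] by simp
    fix A :: "nat \<Rightarrow> 'a set" assume A: "\<And>j. j < M \<Longrightarrow> A j \<in> sets P"
    define A1 where "A1 j = (if j \<in> J then UNIV else A j)" for j
    define A2 where "A2 k = (if k \<in> h ` J then A (inv_into J h k) else UNIV)" for k
    have UN: "UNIV \<in> sets P" "emeasure P UNIV = 1"
      using P prob_space.emeasure_space_1[OF P(1)] sets_eq_imp_space_eq[OF P(2)] by auto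
    have A1: "A1 j \<in> sets P" if "j < M" for j using A that UN by (auto simp: A1_def)
    have A2: "A2 k \<in> sets P" if "k < N" for k
      using A UN J(1,2) by (auto simp: A2_def subset_eq)
    have "T -` PiE {..<M} A \<inter> space (prodM M P \<Otimes>\<^sub>M prodM N P) = PiE {..<M} A1 \<times> PiE {..<N} A2"
    proof (intro set_eqI iffI)
      fix v assume v: "v \<in> T -` PiE {..<M} A \<inter> space (prodM M P \<Otimes>\<^sub>M prodM N P)"
      then have sp: "fst v \<in> extensional {..<M}" "snd v \<in> extensional {..<N}"
        by (simp_all add: space_pair_measure space_prodM[OF P(2)] mem_Times_iff)
      have T: "T v j \<in> A j" if "j < M" for j using v that by (auto simp: PiE_iff)
      have "fst v j \<in> A1 j" if "j < M" for j using T[OF that] that by (auto simp: T_def A1_def)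
      moreover have "snd v k \<in> A2 k" if "k < N" for k
      proof (cases "k \<in> h ` J")
        case True
        then obtain j where "j \<in> J" "k = h j" by auto
        then show ?thesis using T[of j] J by (auto simp: T_def A2_def)
      qed (simp add: A2_def)
      ultimately show "v \<in> PiE {..<M} A1 \<times> PiE {..<N} A2" using sp by (auto simp: mem_Times_iff PiE_iff)
    next
      fix v assume v: "v \<in> PiE {..<M} A1 \<times> PiE {..<N} A2"
      have "T v j \<in> A j" if "j < M" for j
      proof (cases "j \<in> J")
        case True
        then have "snd v (h j) \<in> A2 (h j)" using v J by (auto simp: mem_Times_iff PiE_iff)
        then show ?thesis using True that J by (auto simp: A2_def T_def)
      next
        case False
        have "fst v j \<in> A1 j" using v that by (auto simp: mem_Times_iff PiE_iff)
        then show ?thesis using False that by (simp add: A1_def T_def)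
      qed
      then show "v \<in> T -` PiE {..<M} A \<inter> space (prodM M P \<Otimes>\<^sub>M prodM N P)"
        using v by (auto simp: T_def space_pair_measure space_prodM[OF P(2)] mem_Times_iff PiE_iff)
    qed
    moreover have "PiE {..<M} A \<in> sets (spaceM M)"
      unfolding spaceM_def using A P(2) by (intro sets_PiM_I_finite) auto
    ultimately have "emeasure (distr (prodM M P \<Otimes>\<^sub>M prodM N P) (spaceM M) T) (PiE {..<M} A)
        = emeasure (prodM M P \<Otimes>\<^sub>M prodM N P) (PiE {..<M} A1 \<times> PiE {..<N} A2)"
      using Tm by (simp add: emeasure_distr)
    also have "\<dots> = emeasure (prodM M P) (PiE {..<M} A1) * emeasure (prodM N P) (PiE {..<N} A2)"
      using A1 A2 unfolding prodM_def by (intro pN.emeasure_pair_measure_Times[unfolded prodM_def] sets_PiM_I_finite) auto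
    also have "\<dots> = (\<Prod>j<M. emeasure P (A1 j)) * (\<Prod>k<N. emeasure P (A2 k))"
      using A1 A2 emeasure_prodM[OF P(1)] by simp
    also have "(\<Prod>k<N. emeasure P (A2 k)) = (\<Prod>k\<in>h ` J. emeasure P (A2 k))"
      using J(3) UN by (intro prod.mono_neutral_right) (auto simp: A2_def)
    also have "\<dots> = (\<Prod>j\<in>J. emeasure P (A j))"
      using J by (subst prod.reindex) (auto simp: A2_def)
    also have "(\<Prod>j<M. emeasure P (A1 j)) = (\<Prod>j\<in>{..<M} - J. emeasure P (A1 j))"
      using UN by (intro prod.mono_neutral_right) (auto simp: A1_def)
    also have "\<dots> = (\<Prod>j\<in>{..<M} - J. emeasure P (A j))" by (intro prod.cong) (auto simp: A1_def)
    also have "(\<Prod>j\<in>{..<M} - J. emeasure P (A j)) * (\<Prod>j\<in>J. emeasure P (A j)) = (\<Prod>j<M. emeasure P (A j))"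
      by (rule prod.subset_diff[OF J(1), symmetric]) simp
    finally show "emeasure (distr (prodM M P \<Otimes>\<^sub>M prodM N P) (spaceM M) T) (PiE {..<M} A) = (\<Prod>j<M. emeasure P (A j))" .
  qed
qed

text \<open>An involution that exchanges the first block of length \<open>N\<close> with block
  \<open>b\<close>, except at position \<open>i\<close> and its partner \<open>b * N + i\<close>:
  coordinate \<open>i\<close> is kept while its companions are replaced by fresh ones. For
  \<open>b = 0\<close> it is the identity.\<close>

definition block_swap :: "nat \<Rightarrow> nat \<Rightarrow> nat \<Rightarrow> nat \<Rightarrow> nat" where
  "block_swap N i b j = (if j < N \<and> j \<noteq> i then b * N + j
     else if b * N \<le> j \<and> j < b * N + N \<and> j \<noteq> b * N + i then j - b * N else j)"

lemma block_swap_permutes: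
  assumes "i < N" "b * N + N \<le> M"
  shows "block_swap N i b \<in> perms M"
proof -
  have inv: "block_swap N i b (block_swap N i b j) = j" for j
  proof (cases "b = 0")
    case False
    then obtain m where m: "b * N = m" "N \<le> m" by (cases b) auto
    show ?thesis unfolding block_swap_def m(1) using m(2) assms(1) by auto
  qed (auto simp: block_swap_def)
  have "block_swap N i b j = j" if "j \<notin> {..<M}" for j using that assms by (auto simp: block_swap_def)
  moreover have "\<exists>!x. block_swap N i b x = y" for y
  proof (rule ex1I[of _ "block_swap N i b y"])
    fix x assume "block_swap N i b x = y"
    then show "x = block_swap N i b y" using inv[of x] by simp
  qed (rule inv)
  ultimately show ?thesis unfolding perms_def permutes_def by blast
qed

lemma exch_plan_integral:
  fixes g :: "_ \<Rightarrow> real"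
  assumes "exch_plan X P M \<mu>" "\<sigma> \<in> perms M" "g \<in> borel_measurable (spaceM M \<Otimes>\<^sub>M spaceM M)"
  shows "(\<integral>z. g z \<partial>\<mu>) = (\<integral>z. g (permute M \<sigma> (fst z), permute M \<sigma> (snd z)) \<partial>\<mu>)"
proof -
  note measurable_permute[OF assms(2), measurable]
  have [measurable_cong]: "sets \<mu> = sets (spaceM M \<Otimes>\<^sub>M spaceM M)" using assms(1) by (simp add: exch_plan_def)
  have "(\<integral>z. g z \<partial>\<mu>) = (\<integral>z. g z \<partial>distr \<mu> (spaceM M \<Otimes>\<^sub>M spaceM M)
        (\<lambda>z. (permute M \<sigma> (fst z), permute M \<sigma> (snd z))))"
    using assms by (simp add: exch_plan_def)
  also have "\<dots> = (\<integral>z. g (permute M \<sigma> (fst z), permute M \<sigma> (snd z)) \<partial>\<mu>)"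
    by (rule integral_distr) (use assms(3) in measurable)
  finally show ?thesis .
qed

lemma exch_plan_nn_integral:
  assumes "exch_plan X P M \<mu>" "\<sigma> \<in> perms M" "g \<in> borel_measurable (spaceM M \<Otimes>\<^sub>M spaceM M)"
  shows "(\<integral>\<^sup>+z. g z \<partial>\<mu>) = (\<integral>\<^sup>+z. g (permute M \<sigma> (fst z), permute M \<sigma> (snd z)) \<partial>\<mu>)"
proof -
  note measurable_permute[OF assms(2), measurable]
  have [measurable_cong]: "sets \<mu> = sets (spaceM M \<Otimes>\<^sub>M spaceM M)" using assms(1) by (simp add: exch_plan_def)
  have "(\<integral>\<^sup>+z. g z \<partial>\<mu>) = (\<integral>\<^sup>+z. g z \<partial>distr \<mu> (spaceM M \<Otimes>\<^sub>M spaceM M)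
        (\<lambda>z. (permute M \<sigma> (fst z), permute M \<sigma> (snd z))))"
    using assms by (simp add: exch_plan_def)
  also have "\<dots> = (\<integral>\<^sup>+z. g (permute M \<sigma> (fst z), permute M \<sigma> (snd z)) \<partial>\<mu>)"
    by (rule nn_integral_distr) (use assms(3) in measurable)
  finally show ?thesis .
qed

lemma transpose_perms: "i < M \<Longrightarrow> j < M \<Longrightarrow> Transposition.transpose i j \<in> perms M"
  unfolding perms_def using permutes_swap_id[of i "{..<M}" j] by simp

text \<open>Averaging \<open>\<phi>\<close> over disjoint blocks of the \<open>y\<close>-coordinates does not change the expectation, by
  exchangeability; the block averages converge in mean square to a function of \<open>y i\<close> alone, to
  which the conditional centering applies.\<close>

lemma near_independence:
  fixes X :: "'a::euclidean_space set" and \<phi> :: "(nat \<Rightarrow> 'a) \<Rightarrow> real"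
  assumes plan: "exch_plan X P M \<mu>" and P: "prob_space P" "sets P = sets borel"
    and B: "0 < B" "B * N \<le> M" and i: "i < N"
    and xi[measurable]: "\<xi> \<in> borel_measurable borel" and xiR: "\<And>x. \<bar>\<xi> x\<bar> \<le> R"
    and f[measurable]: "f \<in> borel_measurable borel" and fR: "\<And>x. \<bar>f x\<bar> \<le> R"
    and ce: "\<And>\<psi> C. \<psi> \<in> borel_measurable borel \<Longrightarrow> (\<And>y. \<bar>\<psi> y\<bar> \<le> C) \<Longrightarrow>
      (\<integral>z. (\<xi> (fst z 0) - f (snd z 0)) * \<psi> (snd z 0) \<partial>\<mu>) = 0"
    and phi[measurable]: "\<phi> \<in> borel_measurable (spaceM N)" and phiL: "\<And>y. \<bar>\<phi> y\<bar> \<le> L"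
  shows "\<bar>\<integral>z. (\<xi> (fst z i) - f (snd z i)) * \<phi> (prN N (snd z)) \<partial>\<mu>\<bar> \<le> 2 * (L\<^sup>2 + R\<^sup>2) / sqrt (real B)"
proof -
  interpret mu: prob_space \<mu> using plan by (simp add: exch_plan_def)
  interpret pM: prob_space "prodM M P" by (rule prob_space_prodM[OF P(1)])
  interpret pN: prob_space "prodM N P" by (rule prob_space_prodM[OF P(1)])
  interpret pp: pair_sigma_finite "prodM M P" "prodM N P" ..
  interpret ppp: pair_prob_space "prodM M P" "prodM N P" ..
  have NM: "N \<le> M" using B by (metis One_nat_def Suc_leI le_trans mult_1 mult_le_mono1)
  then have iM: "i < M" using i by simp
  have [measurable_cong]: "sets \<mu> = sets (spaceM M \<Otimes>\<^sub>M spaceM M)" using plan by (simp add: exch_plan_def)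
  have [measurable_cong]: "sets (prodM M P) = sets (spaceM M)" "sets (prodM N P) = sets (spaceM N)"
    using sets_prodM[OF P(2)] by auto
  note [measurable] = measurable_coord[OF iM] measurable_prN[OF NM]
  define D where "D z = \<xi> (fst z i) - f (snd z i)" for z :: "(nat \<Rightarrow> 'a) \<times> (nat \<Rightarrow> 'a)"
  have [measurable]: "D \<in> borel_measurable (spaceM M \<Otimes>\<^sub>M spaceM M)" unfolding D_def by measurable
  have DR: "\<bar>D z\<bar> \<le> 2 * R" for z unfolding D_def using xiR[of "fst z i"] fR[of "snd z i"] by linarith
  have R0: "0 \<le> R" using xiR[of undefined] by linarith
  have L0: "0 \<le> L" using phiL[of undefined] by linarith
  \<comment> \<open>The companions of coordinate \<open>i\<close> are read from block
    \<open>b\<close>; coordinate \<open>i\<close> itself is always the original one.\<close>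
  define t where "t b y = restrict (\<lambda>j. y (if j = i then i else b * N + j)) {..<N}" for b and y :: "nat \<Rightarrow> 'a"
  have bM: "b * N + N \<le> M" if "b < B" for b
    using B(2) mult_le_mono1[of "Suc b" B N] that by simp
  have tm[measurable]: "t b \<in> measurable (spaceM M) (spaceM N)" if "b < B" for b
    unfolding t_def using bM[OF that] iM by (intro measurable_reindex) auto
  define \<Phi> where "\<Phi> b y = \<phi> (t b y)" for b y
  have Phm[measurable]: "\<Phi> b \<in> borel_measurable (spaceM M)" if "b < B" for b
    unfolding \<Phi>_def using tm[OF that] by measurable
  have PhL: "\<bar>\<Phi> b y\<bar> \<le> L" for b y unfolding \<Phi>_def by (rule phiL)
  define e where "e = (\<integral>z. D z * \<phi> (prN N (snd z)) \<partial>\<mu>)"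
  \<comment> \<open>The swap fixes \<open>i\<close>, hence \<open>D\<close>, and moves the
    companions into block \<open>b\<close>; invariance of the plan gives every block the same mean
    \<open>e\<close>.\<close>
  have eb: "e = (\<integral>z. D z * \<Phi> b (snd z) \<partial>\<mu>)" if b: "b < B" for b
  proof -
    have m: "(\<lambda>z. D z * \<phi> (prN N (snd z))) \<in> borel_measurable (spaceM M \<Otimes>\<^sub>M spaceM M)" by measurable
    have bs: "block_swap N i b \<in> perms M" using i bM[OF b] by (rule block_swap_permutes)
    have si: "block_swap N i b i = i" using i by (cases b) (auto simp: block_swap_def)
    have pt: "prN N (permute M (block_swap N i b) y) = t b y" for y
    proof
      fix j show "prN N (permute M (block_swap N i b) y) j = t b y j"
        using NM i si by (cases "j = i") (auto simp: prN_def permute_def t_def block_swap_def)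
    qed
    show ?thesis
      unfolding e_def exch_plan_integral[OF plan bs m]
      using pt si iM by (simp add: D_def \<Phi>_def permute_def comp_def)
  qed
  \<comment> \<open>Under the product law this is the conditional mean of \<open>\<Phi> b\<close>
    given \<open>y i\<close>, the same for all blocks.\<close>
  define \<theta> where "\<theta> x = (\<integral>w. \<phi> (w(i := x)) \<partial>prodM N P)" for x
  have updm: "(\<lambda>v. \<phi> ((snd v)(i := fst v))) \<in> borel_measurable (borel \<Otimes>\<^sub>M prodM N P)"
  proof -
    have "(\<lambda>v. (snd v)(i := fst v)) \<in> measurable (borel \<Otimes>\<^sub>M prodM N P) (spaceM N)"
      unfolding spaceM_def
      by (rule measurable_fun_upd[where J = "{..<N}"])
         (use i sets_prodM[OF P(2), of N] in \<open>auto simp: spaceM_def[symmetric]\<close>)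
    then show ?thesis by measurable
  qed
  have [measurable]: "\<theta> \<in> borel_measurable borel"
    unfolding \<theta>_def
    using pN.borel_measurable_lebesgue_integral[of "\<lambda>x w. \<phi> (w(i := x))" borel] updm
    by (simp add: case_prod_beta')
  have thL: "\<bar>\<theta> x\<bar> \<le> L" for x
  proof -
    have "\<bar>\<theta> x\<bar> \<le> (\<integral>w. \<bar>\<phi> (w(i := x))\<bar> \<partial>prodM N P)" unfolding \<theta>_def by (rule integral_abs_bound)
    also have "\<dots> \<le> (\<integral>w. L \<partial>prodM N P)"
      using L0 phiL by (intro integral_mono_AE') auto
    finally show ?thesis by (simp add: pN.prob_space)
  qed
  \<comment> \<open>The centering \<open>ce\<close> concerns coordinate 0 only; a transposition
    carries it to \<open>i\<close>.\<close>
  have zero: "(\<integral>z. D z * \<theta> (snd z i) \<partial>\<mu>) = 0"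
  proof -
    have M0: "0 < M" using iM by simp
    note measurable_coord[OF M0, measurable]
    have m: "(\<lambda>z. (\<xi> (fst z 0) - f (snd z 0)) * \<theta> (snd z 0)) \<in> borel_measurable (spaceM M \<Otimes>\<^sub>M spaceM M)"
      by measurable
    have tr: "Transposition.transpose 0 i \<in> perms M" using M0 iM by (rule transpose_perms)
    have "0 = (\<integral>z. (\<xi> (fst z 0) - f (snd z 0)) * \<theta> (snd z 0) \<partial>\<mu>)"
      by (rule ce[OF _ thL, symmetric]) measurable
    also have "\<dots> = (\<integral>z. D z * \<theta> (snd z i) \<partial>\<mu>)"
      unfolding exch_plan_integral[OF plan tr m] using M0 by (simp add: D_def permute_def)
    finally show ?thesis by simp
  qed
  define E where "E b y = \<Phi> b y - \<theta> (y i)" for b y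
  have Em[measurable]: "E b \<in> borel_measurable (spaceM M)" if "b < B" for b
    unfolding E_def using Phm[OF that] by measurable
  have EL: "\<bar>E b y\<bar> \<le> 2 * L" for b y unfolding E_def using PhL[of b y] thL[of "y i"] by linarith
  \<comment> \<open>Given \<open>y i\<close>, different blocks are independent. Redrawing block
    \<open>b\<close> changes neither \<open>y i\<close> nor the companions in block
    \<open>b'\<close>, and integrating it out leaves \<open>E b\<close> with mean zero.\<close>
  have orth: "(\<integral>y. E b y * E b' y \<partial>prodM M P) = 0" if b: "b < B" "b' < B" "b \<noteq> b'" for b b'
  proof -
    note [measurable] = Em[OF b(1)] Em[OF b(2)]
    define J where "J = (\<lambda>j. b * N + j) ` ({..<N} - {i})"
    define h where "h j = j - b * N" for j
    define T where "T v = restrict (\<lambda>j. if j \<in> J then snd v (h j) else fst v j) {..<M}"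
      for v :: "(nat \<Rightarrow> 'a) \<times> (nat \<Rightarrow> 'a)"
    have J: "J \<subseteq> {..<M}" "inj_on h J" "h ` J \<subseteq> {..<N}"
      using bM[OF b(1)] by (auto simp: J_def h_def inj_on_def)
    have Tm: "T \<in> measurable (prodM M P \<Otimes>\<^sub>M prodM N P) (spaceM M)"
      and Td: "distr (prodM M P \<Otimes>\<^sub>M prodM N P) (spaceM M) T = prodM M P"
      using distr_prodM_resample[OF P J] unfolding T_def[abs_def] by auto
    have iJ: "i \<notin> J" using i by (cases b) (auto simp: J_def)
    have bJ: "b' * N + j \<notin> J" if "j < N" for j
    proof
      assume "b' * N + j \<in> J"
      then obtain k where k: "k < N" "b' * N + j = b * N + k" by (auto simp: J_def)
      have "(b' * N + j) div N = b'" "(b * N + k) div N = b" using that k(1) i by auto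
      then show False using k(2) b(3) by simp
    qed
    have T1: "\<Phi> b (T (y, w)) = \<phi> (w(i := y i))" if w: "w \<in> extensional {..<N}" for y w
    proof -
      have "t b (T (y, w)) = w(i := y i)"
      proof
        fix j show "t b (T (y, w)) j = (w(i := y i)) j"
          using w i iM iJ bM[OF b(1)]
          by (auto simp: t_def T_def J_def h_def extensional_def)
      qed
      then show ?thesis by (simp add: \<Phi>_def)
    qed
    have T2: "\<Phi> b' (T (y, w)) = \<Phi> b' y" for y w
    proof -
      have "t b' (T (y, w)) = t b' y"
      proof
        fix j show "t b' (T (y, w)) j = t b' y j"
          using bJ[of j] iJ iM bM[OF b(2)] by (auto simp: t_def T_def)
      qed
      then show ?thesis by (simp add: \<Phi>_def)
    qed
    have T3: "T (y, w) i = y i" for y w using iJ iM by (simp add: T_def)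
    have "(\<integral>y. E b y * E b' y \<partial>prodM M P) = (\<integral>v. E b (T v) * E b' (T v) \<partial>(prodM M P \<Otimes>\<^sub>M prodM N P))"
      by (subst Td[symmetric], rule integral_distr[OF Tm]) measurable
    also have "\<dots> = (\<integral>y. \<integral>w. E b (T (y, w)) * E b' (T (y, w)) \<partial>prodM N P \<partial>prodM M P)"
    proof (rule pp.integral_fst'[symmetric])
      have bd: "\<bar>E b x * E b' x\<bar> \<le> 2 * L * (2 * L)" for x
        unfolding abs_mult using EL L0 by (intro mult_mono) auto
      have "(\<lambda>v. E b (T v) * E b' (T v)) \<in> borel_measurable (prodM M P \<Otimes>\<^sub>M prodM N P)"
        using Tm by measurable
      then show "integrable (prodM M P \<Otimes>\<^sub>M prodM N P) (\<lambda>v. E b (T v) * E b' (T v))"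
        using bd by (intro ppp.P.integrable_const_bound[where B = "2 * L * (2 * L)"]) auto
    qed
    also have "\<dots> = (\<integral>y. 0 \<partial>prodM M P)"
    proof (intro Bochner_Integration.integral_cong refl)
      fix y assume y: "y \<in> space (prodM M P)"
      have wm: "(\<lambda>w. \<phi> (w(i := y i))) \<in> borel_measurable (prodM N P)"
        using measurable_compose[OF measurable_Pair1'[of "y i" borel "prodM N P"] updm] by simp
      have int: "integrable (prodM N P) (\<lambda>w. \<phi> (w(i := y i)))"
        using wm phiL by (intro pN.integrable_const_bound[where B = L]) auto
      have "(\<integral>w. E b (T (y, w)) * E b' (T (y, w)) \<partial>prodM N P)
          = (\<integral>w. (\<phi> (w(i := y i)) - \<theta> (y i)) * E b' y \<partial>prodM N P)"
        using T1 T2 T3 by (intro Bochner_Integration.integral_cong refl)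
          (simp add: E_def space_prodM[OF P(2)])
      also have "\<dots> = ((\<integral>w. \<phi> (w(i := y i)) \<partial>prodM N P) - \<theta> (y i)) * E b' y"
        using int by (simp add: pN.prob_space)
      finally show "(\<integral>w. E b (T (y, w)) * E b' (T (y, w)) \<partial>prodM N P) = 0" by (simp add: \<theta>_def)
    qed
    finally show ?thesis by simp
  qed
  define S where "S y = (\<Sum>b<B. E b y)" for y
  have Sm[measurable]: "S \<in> borel_measurable (spaceM M)" unfolding S_def using Em by (intro borel_measurable_sum) auto
  have SL: "\<bar>S y\<bar> \<le> real B * (2 * L)" for y
    unfolding S_def using EL by (intro order_trans[OF sum_abs] order_trans[OF sum_bounded_above]) auto
  have EEi: "integrable (prodM M P) (\<lambda>y. E b y * E b' y)" if "b < B" "b' < B" for b b'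
  proof (rule pM.integrable_const_bound[where B = "2 * L * (2 * L)"])
    show "AE y in prodM M P. norm (E b y * E b' y) \<le> 2 * L * (2 * L)"
      unfolding real_norm_def abs_mult using EL L0 by (intro AE_I2 mult_mono) auto
    show "(\<lambda>y. E b y * E b' y) \<in> borel_measurable (prodM M P)"
      using Em[OF that(1)] Em[OF that(2)] by measurable
  qed
  \<comment> \<open>Orthogonality leaves the \<open>B\<close> diagonal terms, so the second moment
    of the sum grows like \<open>B\<close> instead of \<open>B ^ 2\<close>.\<close>
  have S2: "(\<integral>y. (S y)\<^sup>2 \<partial>prodM M P) \<le> real B * (4 * L\<^sup>2)"
  proof -
    have "(\<integral>y. (S y)\<^sup>2 \<partial>prodM M P) = (\<integral>y. (\<Sum>b<B. \<Sum>b'<B. E b y * E b' y) \<partial>prodM M P)"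
      by (simp add: S_def power2_eq_square sum_product)
    also have "\<dots> = (\<Sum>b<B. \<Sum>b'<B. \<integral>y. E b y * E b' y \<partial>prodM M P)"
      using EEi by (subst Bochner_Integration.integral_sum; (intro sum.cong refl Bochner_Integration.integral_sum Bochner_Integration.integrable_sum)?) auto
    also have "\<dots> = (\<Sum>b<B. \<Sum>b'<B. if b' = b then \<integral>y. E b y * E b y \<partial>prodM M P else 0)"
      using orth by (intro sum.cong refl) auto
    also have "\<dots> = (\<Sum>b<B. \<integral>y. E b y * E b y \<partial>prodM M P)" by (simp add: sum.delta)
    also have "\<dots> \<le> (\<Sum>b<B. 4 * L\<^sup>2)"
    proof (intro sum_mono)
      fix b assume b: "b \<in> {..<B}"
      have "E b y * E b y \<le> 4 * L\<^sup>2" for y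
        using power_mono[OF EL[of b y], of 2] by (simp add: power2_eq_square)
      then have "(\<integral>y. E b y * E b y \<partial>prodM M P) \<le> (\<integral>y. 4 * L\<^sup>2 \<partial>prodM M P)"
        using EEi b by (intro integral_mono) auto
      then show "(\<integral>y. E b y * E b y \<partial>prodM M P) \<le> 4 * L\<^sup>2" by (simp add: pM.prob_space)
    qed
    finally show ?thesis by simp
  qed
  have bdi: "integrable \<mu> g" if "g \<in> borel_measurable (spaceM M \<Otimes>\<^sub>M spaceM M)" "\<And>z. \<bar>g z\<bar> \<le> C" for g and C :: real
    using that by (intro mu.integrable_const_bound[where B = C]) auto
  have DE: "\<bar>D z * E b (snd z)\<bar> \<le> 2 * R * (2 * L)" for z b
    unfolding abs_mult using DR EL R0 by (intro mult_mono) auto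
  have Dt: "\<bar>D z * \<theta> (snd z i)\<bar> \<le> 2 * R * L" for z
    unfolding abs_mult using DR thL R0 by (intro mult_mono) auto
  have DP: "\<bar>D z * \<Phi> b (snd z)\<bar> \<le> 2 * R * L" for z b
    unfolding abs_mult using DR PhL R0 by (intro mult_mono) auto
  have eE: "e = (\<integral>z. D z * E b (snd z) \<partial>\<mu>)" if b: "b < B" for b
  proof -
    note [measurable] = Phm[OF b]
    have "(\<integral>z. D z * E b (snd z) \<partial>\<mu>) = (\<integral>z. D z * \<Phi> b (snd z) - D z * \<theta> (snd z i) \<partial>\<mu>)"
      by (simp add: E_def right_diff_distrib)
    also have "\<dots> = (\<integral>z. D z * \<Phi> b (snd z) \<partial>\<mu>) - (\<integral>z. D z * \<theta> (snd z i) \<partial>\<mu>)"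
      by (intro Bochner_Integration.integral_diff bdi[OF _ DP] bdi[OF _ Dt]) measurable
    finally show ?thesis using eb[OF b] zero by simp
  qed
  have sumE: "real B * e = (\<integral>z. D z * S (snd z) \<partial>\<mu>)"
  proof -
    have "real B * e = (\<Sum>b<B. e)" by simp
    also have "\<dots> = (\<Sum>b<B. \<integral>z. D z * E b (snd z) \<partial>\<mu>)" by (intro sum.cong refl eE) simp
    also have "\<dots> = (\<integral>z. (\<Sum>b<B. D z * E b (snd z)) \<partial>\<mu>)"
    proof (rule Bochner_Integration.integral_sum[symmetric])
      fix b assume "b \<in> {..<B}"
      then have [measurable]: "E b \<in> borel_measurable (spaceM M)" using Em by simp
      show "integrable \<mu> (\<lambda>z. D z * E b (snd z))" by (rule bdi[OF _ DE]) measurable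
    qed
    finally show ?thesis by (simp add: S_def sum_distrib_left)
  qed
  \<comment> \<open>The weight for Young's inequality: \<open>S ^ 2\<close> has mean of order
    \<open>B\<close> and \<open>D\<close> is of order 1, so \<open>sqrt B\<close> balances the two
    terms. Dividing by \<open>B\<close> afterwards leaves \<open>1 / sqrt B\<close>.\<close>
  define q where "q = sqrt (real B)"
  have q: "q > 0" "q * q = real B" using B(1) by (auto simp: q_def)
  have S2i: "integrable \<mu> (\<lambda>z. (S (snd z))\<^sup>2)"
  proof (rule bdi)
    show "\<bar>(S (snd z))\<^sup>2\<bar> \<le> (real B * (2 * L))\<^sup>2" for z
      using power_mono[OF SL[of "snd z"], of 2] by simp
  qed measurable
  have S2mu: "(\<integral>z. (S (snd z))\<^sup>2 \<partial>\<mu>) = (\<integral>y. (S y)\<^sup>2 \<partial>prodM M P)"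
  proof -
    have "prodM M P = distr \<mu> (spaceM M) snd" using plan by (simp add: exch_plan_def)
    then show ?thesis by (simp add: integral_distr)
  qed
  have "\<bar>\<integral>z. D z * S (snd z) \<partial>\<mu>\<bar> \<le> (\<integral>z. \<bar>D z * S (snd z)\<bar> \<partial>\<mu>)" by (rule integral_abs_bound)
  also have "\<dots> \<le> (\<integral>z. ((S (snd z))\<^sup>2 / q + q * (2 * R)\<^sup>2) / 2 \<partial>\<mu>)"
  proof (rule integral_mono)
    show "integrable \<mu> (\<lambda>z. \<bar>D z * S (snd z)\<bar>)"
    proof (rule bdi)
      show "\<bar>\<bar>D z * S (snd z)\<bar>\<bar> \<le> 2 * R * (real B * (2 * L))" for z
        unfolding abs_abs abs_mult using DR SL R0 by (intro mult_mono) auto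
    qed measurable
    show "integrable \<mu> (\<lambda>z. ((S (snd z))\<^sup>2 / q + q * (2 * R)\<^sup>2) / 2)" using S2i by simp
    fix z
    have "\<bar>D z * S (snd z)\<bar> \<le> 2 * R * \<bar>S (snd z)\<bar>" unfolding abs_mult using DR by (intro mult_right_mono) auto
    moreover have "0 \<le> (\<bar>S (snd z)\<bar> - q * (2 * R))\<^sup>2 / q" using q by simp
    moreover have "(\<bar>S (snd z)\<bar> - q * (2 * R))\<^sup>2 / q = (S (snd z))\<^sup>2 / q + q * (2 * R)\<^sup>2 - 2 * (2 * R * \<bar>S (snd z)\<bar>)"
      using q(1) by (simp add: power2_eq_square field_simps)
    moreover have "x \<le> a / 2" if "x \<le> y" "0 \<le> w" "w = a - 2 * y" for x y w a :: real
      using that by simp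
    ultimately show "\<bar>D z * S (snd z)\<bar> \<le> ((S (snd z))\<^sup>2 / q + q * (2 * R)\<^sup>2) / 2" by blast
  qed
  also have "\<dots> = ((\<integral>y. (S y)\<^sup>2 \<partial>prodM M P) / q + q * (2 * R)\<^sup>2) / 2"
    using S2i by (simp add: S2mu mu.prob_space)
  also have "\<dots> \<le> (real B * (4 * L\<^sup>2) / q + q * (2 * R)\<^sup>2) / 2"
    using S2 q by (intro divide_right_mono add_right_mono) auto
  also have "real B * (4 * L\<^sup>2) / q = q * (4 * L\<^sup>2)" using q by (simp add: q(2)[symmetric])
  also have "(q * (4 * L\<^sup>2) + q * (2 * R)\<^sup>2) / 2 = q * (2 * (L\<^sup>2 + R\<^sup>2))"
    by (simp add: power_mult_distrib algebra_simps)
  finally have "\<bar>real B * e\<bar> \<le> q * (2 * (L\<^sup>2 + R\<^sup>2))" unfolding sumE .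
  then have "q * (q * \<bar>e\<bar>) \<le> q * (2 * (L\<^sup>2 + R\<^sup>2))" using q by (simp add: abs_mult mult.assoc[symmetric])
  then have "q * \<bar>e\<bar> \<le> 2 * (L\<^sup>2 + R\<^sup>2)" using q(1) by simp
  then have "\<bar>e\<bar> \<le> 2 * (L\<^sup>2 + R\<^sup>2) / q" using q(1) by (simp add: pos_le_divide_eq mult.commute)
  then show ?thesis by (simp add: e_def D_def q_def)
qed

section \<open>The transport setting\<close>

locale dro =
  fixes X :: "'a::euclidean_space set" and c :: "'a \<Rightarrow> 'a \<Rightarrow> real"
    and P :: "'a measure" and \<rho> :: real and N :: nat and l :: "(nat \<Rightarrow> 'a) \<Rightarrow> real"
  assumes X_ne: "X \<noteq> {}" and X_closed: "closed X" and X_convex: "convex X"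
    and tc: "transport_cost X c" and proper: "proper_cost X c"
    and c_convex: "\<forall>x\<in>X. convex_on X (c x)"
    and P_on: "P \<in> probs_on borel X" and P_moment: "finite_moment c X P"
    and \<rho>_pos: "\<rho> > 0" and N_pos: "N \<ge> 1"
    and l_growth: "growth N X c l" and l_usc: "usc_on (tup N X) l" and l_concave: "concave_tup N X l"
begin

text \<open>Outside \<open>X\<close> the cost and the loss are arbitrary, possibly non-measurable functions; setting them
  to \<open>0\<close> there makes them Borel without changing any integral that occurs.\<close>

definition cX :: "'a \<Rightarrow> 'a \<Rightarrow> real" where
  "cX x y = (if x \<in> X \<and> y \<in> X then c x y else 0)"

definition lX :: "(nat \<Rightarrow> 'a) \<Rightarrow> real" where
  "lX x = (if x \<in> tup N X then l x else 0)"

lemma P_sets [measurable_cong]: "sets P = sets borel" and P_prob: "prob_space P" and P_X: "AE y in P. y \<in> X"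
proof -
  show s: "sets P = sets borel" and p: "prob_space P" using P_on by (auto simp: probs_on_def)
  interpret prob_space P by fact
  have "emeasure P X = 1" using P_on by (auto simp: probs_on_def)
  moreover have "X \<in> sets P" using X_closed s by auto
  ultimately show "AE y in P. y \<in> X" by (intro prob_eq_1[THEN iffD1]) (auto simp: emeasure_eq_measure)
qed

lemma P_space [simp]: "space P = UNIV"
  using sets_eq_imp_space_eq[OF P_sets] by simp

lemma X_sets [measurable]: "X \<in> sets borel"
  using X_closed by auto

lemma cX_nonneg: "0 \<le> cX x y" and cX_sym: "cX x y = cX y x" and cX_refl: "cX x x = 0"
  using tc by (auto simp: cX_def transport_cost_def)

lemma cX_usc: "usc_on (X \<times> X) (\<lambda>z. - cX (fst z) (snd z))"
  unfolding usc_on_def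
proof (intro ballI allI impI)
  fix z t assume z: "z \<in> X \<times> X" and t: "- cX (fst z) (snd z) < t"
  then have "- t < c (fst z) (snd z)" by (auto simp: cX_def)
  then have "eventually (\<lambda>w. - t < c (fst w) (snd w)) (at z within X \<times> X)"
    using tc z unfolding transport_cost_def by blast
  moreover have "eventually (\<lambda>w. w \<in> X \<times> X) (at z within X \<times> X)" by (simp add: eventually_at_filter)
  ultimately show "eventually (\<lambda>w. - cX (fst w) (snd w) < t) (at z within X \<times> X)"
    by eventually_elim (auto simp: cX_def)
qed

lemma cX_measurable: "(\<lambda>z. cX (fst z) (snd z)) \<in> borel_measurable (borel \<Otimes>\<^sub>M borel)"
proof -
  have "(\<lambda>z. if z \<in> X \<times> X then - cX (fst z) (snd z) else 0) \<in> borel_measurable borel"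
    by (intro usc_on_borel_measurable cX_usc closed_Times X_closed)
  then have "(\<lambda>z. - (if z \<in> X \<times> X then - cX (fst z) (snd z) else 0)) \<in> borel_measurable borel" by simp
  moreover have "(\<lambda>z. - (if z \<in> X \<times> X then - cX (fst z) (snd z) else 0)) = (\<lambda>z. cX (fst z) (snd z))"
    by (auto simp: cX_def)
  ultimately show ?thesis by (simp add: borel_prod)
qed

lemma cX_measurable' [measurable (raw)]:
  assumes "f \<in> borel_measurable M'" "g \<in> borel_measurable M'"
  shows "(\<lambda>x. cX (f x) (g x)) \<in> borel_measurable M'"
  using measurable_compose[OF measurable_Pair[OF assms] cX_measurable] by simp

lemma cX_convex:
  assumes "y \<in> X" shows "convex_on X (\<lambda>x. cX x y)"
proof -
  have "convex_on X (\<lambda>x. c y x)" using c_convex assms by simp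
  moreover have "c y x = cX x y" if "x \<in> X" for x using that assms tc by (auto simp: cX_def transport_cost_def)
  ultimately show ?thesis using X_convex unfolding convex_on_def by (metis convexD)
qed

lemma lX_measurable [measurable]: "lX \<in> borel_measurable (spaceM N)"
  using usc_on_tup_measurable[OF l_usc X_closed] by (simp add: lX_def[abs_def])

definition K where "K = (SOME K. K > 0 \<and> (\<forall>x\<in>X. \<forall>y\<in>X. \<forall>z\<in>X. c x y \<le> K * (c x z + c z y)))"

lemma K_pos: "0 < K" and cX_triangle: "x \<in> X \<Longrightarrow> y \<in> X \<Longrightarrow> z \<in> X \<Longrightarrow> cX x y \<le> K * (cX x z + cX z y)"
proof -
  have "K > 0 \<and> (\<forall>x\<in>X. \<forall>y\<in>X. \<forall>z\<in>X. c x y \<le> K * (c x z + c z y))"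
    unfolding K_def by (rule someI_ex) (use proper in \<open>simp add: proper_cost_def\<close>)
  then show "0 < K" "x \<in> X \<Longrightarrow> y \<in> X \<Longrightarrow> z \<in> X \<Longrightarrow> cX x y \<le> K * (cX x z + cX z y)"
    by (auto simp: cX_def)
qed

definition z0 where "z0 = (SOME x. x \<in> X)"

lemma z0 [simp]: "z0 \<in> X"
  unfolding z0_def using X_ne by (simp add: some_in_eq)

lemma moment_at:
  assumes "z \<in> X" shows "(\<integral>\<^sup>+ y. ennreal (cX z y) \<partial>P) < \<infinity>"
proof -
  obtain x0 where x0: "x0 \<in> X" "(\<integral>\<^sup>+ x. ennreal (c x0 x) \<partial>P) < \<infinity>"
    using P_moment by (auto simp: finite_moment_def)
  have "(\<integral>\<^sup>+ y. ennreal (cX z y) \<partial>P) \<le> (\<integral>\<^sup>+ y. ennreal K * (ennreal (cX z x0) + ennreal (cX x0 y)) \<partial>P)"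
  proof (intro nn_integral_mono_AE)
    show "AE y in P. ennreal (cX z y) \<le> ennreal K * (ennreal (cX z x0) + ennreal (cX x0 y))"
      using P_X
    proof eventually_elim
      case (elim y)
      have "ennreal (cX z y) \<le> ennreal (K * (cX z x0 + cX x0 y))"
        using cX_triangle[OF assms elim x0(1)] by (rule ennreal_leI)
      then show ?case using K_pos cX_nonneg by (simp add: ennreal_mult ennreal_plus)
    qed
  qed
  also have "\<dots> = ennreal K * (ennreal (cX z x0) + (\<integral>\<^sup>+ y. ennreal (cX x0 y) \<partial>P))"
  proof -
    have [measurable]: "(\<lambda>y. ennreal (cX x0 y)) \<in> borel_measurable P" by measurable
    show ?thesis
      using prob_space.emeasure_space_1[OF P_prob]
      by (subst nn_integral_cmult, measurable, subst nn_integral_add) simp_all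
  qed
  also have "(\<integral>\<^sup>+ y. ennreal (cX x0 y) \<partial>P) = (\<integral>\<^sup>+ x. ennreal (c x0 x) \<partial>P)"
    using P_X x0(1) by (intro nn_integral_cong_AE) (auto simp: cX_def elim!: eventually_mono)
  finally show ?thesis using x0(2) by (metis ennreal_add_eq_top ennreal_mult_eq_top_iff ennreal_neq_top infinity_ennreal_def less_top neq_top_trans)
qed

text \<open>Convexity upgrades compact sublevel sets to linear growth.\<close>

lemma linear_growth: "\<exists>r>0. \<forall>x\<in>X. norm (x - z0) \<le> r * (1 + cX z0 x)"
proof -
  have "compact {x\<in>X. c z0 x \<le> 1}" using proper by (auto simp: proper_cost_def)
  then obtain b where b: "\<And>x. x \<in> X \<Longrightarrow> c z0 x \<le> 1 \<Longrightarrow> norm x \<le> b"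
    using compact_imp_bounded bounded_iff by (metis (no_types, lifting) mem_Collect_eq)
  define r where "r = \<bar>b\<bar> + norm z0 + 1"
  have r: "r > 0" unfolding r_def using norm_ge_zero[of z0] by linarith
  have far: "cX z0 x > 1" if "x \<in> X" "norm (x - z0) \<ge> r" for x
  proof (rule ccontr)
    assume "\<not> cX z0 x > 1"
    then have "norm x \<le> b" using b[OF that(1)] that(1) by (simp add: cX_def)
    then show False using that(2) norm_triangle_ineq4[of x z0] unfolding r_def by linarith
  qed
  have "norm (x - z0) \<le> r * (1 + cX z0 x)" if x: "x \<in> X" for x
  proof (cases "norm (x - z0) \<le> r")
    case True
    have "r * 1 \<le> r * (1 + cX z0 x)" using r cX_nonneg by (intro mult_left_mono) auto
    with True show ?thesis by simp
  next
    case False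
    \<comment> \<open>Pull \<open>x\<close> back along the segment to distance \<open>r\<close> from
      \<open>z0\<close>, where the cost exceeds 1. As \<open>cX z0 z0 = 0\<close>, convexity turns
      this into a cost above \<open>norm (x - z0) / r\<close> at \<open>x\<close>.\<close>
    define s where "s = r / norm (x - z0)"
    have s: "0 < s" "s \<le> 1" using False r by (auto simp: s_def divide_simps)
    define w where "w = s *\<^sub>R x + (1 - s) *\<^sub>R z0"
    have w: "w \<in> X" unfolding w_def using x s X_convex by (intro convexD) auto
    have "w - z0 = s *\<^sub>R (x - z0)" by (simp add: w_def algebra_simps)
    moreover have "norm (x - z0) > 0" using False r by linarith
    ultimately have "norm (w - z0) = r" using s(1) r by (simp add: s_def)
    then have "1 < cX z0 w" using far[OF w] by simp
    also have "cX z0 w \<le> s * cX z0 x + (1 - s) * cX z0 z0"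
    proof -
      have "cX w z0 \<le> s * cX x z0 + (1 - s) * cX z0 z0"
        unfolding w_def using s by (intro cX_convex[OF z0, unfolded convex_on_def, THEN conjunct2, rule_format] x z0) auto
      then show ?thesis unfolding cX_sym[of z0 w] cX_sym[of z0 x] .
    qed
    finally have "1 < r * cX z0 x / norm (x - z0)" by (simp add: cX_refl s_def)
    then have "norm (x - z0) < r * cX z0 x" using False r by (simp add: divide_simps split: if_splits)
    then show ?thesis using r by (simp add: distrib_left)
  qed
  with r show ?thesis by blast
qed

definition lin where "lin = (SOME r. r > 0 \<and> (\<forall>x\<in>X. norm (x - z0) \<le> r * (1 + cX z0 x)))"

lemma lin_pos: "0 < lin" and lin: "x \<in> X \<Longrightarrow> norm (x - z0) \<le> lin * (1 + cX z0 x)"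
proof -
  have "lin > 0 \<and> (\<forall>x\<in>X. norm (x - z0) \<le> lin * (1 + cX z0 x))"
    unfolding lin_def by (rule someI_ex) (use linear_growth in blast)
  then show "0 < lin" "x \<in> X \<Longrightarrow> norm (x - z0) \<le> lin * (1 + cX z0 x)" by auto
qed

definition mom where "mom = enn2real (\<integral>\<^sup>+ y. ennreal (cX z0 y) \<partial>P)"

lemma mom: "(\<integral>\<^sup>+ y. ennreal (cX z0 y) \<partial>P) = ennreal mom" "0 \<le> mom"
  using moment_at[OF z0] by (auto simp: mom_def)

section \<open>Truncated barycentric projections of a plan\<close>

lemma plan_measurable:
  assumes "sets \<mu> = sets (spaceM M \<Otimes>\<^sub>M spaceM M)" "i < M"
  shows "(\<lambda>z. fst z i) \<in> measurable \<mu> borel" "(\<lambda>z. snd z i) \<in> measurable \<mu> borel"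
    "(\<lambda>z. snd z i) \<in> measurable \<mu> P"
proof -
  show "(\<lambda>z. fst z i) \<in> measurable \<mu> borel" and *: "(\<lambda>z. snd z i) \<in> measurable \<mu> borel"
    unfolding measurable_cong_sets[OF assms(1) refl] using measurable_coord[OF assms(2)] by measurable
  then show "(\<lambda>z. snd z i) \<in> measurable \<mu> P" unfolding measurable_cong_sets[OF refl P_sets] by simp
qed

lemma plan_facts:
  assumes "exch_plan X P M \<mu>"
  shows "prob_space \<mu>" "sets \<mu> = sets (spaceM M \<Otimes>\<^sub>M spaceM M)"
    and "i < M \<Longrightarrow> distr \<mu> P (\<lambda>z. snd z i) = P"
    and "i < M \<Longrightarrow> AE z in \<mu>. fst z i \<in> X"
    and "i < M \<Longrightarrow> AE z in \<mu>. snd z i \<in> X"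
    and "N \<le> M \<Longrightarrow> distr \<mu> (spaceM N) (\<lambda>z. prN N (snd z)) = prodM N P"
    and "N \<le> M \<Longrightarrow> AE z in \<mu>. prN N (fst z) \<in> tup N X"
proof -
  show p: "prob_space \<mu>" and s[measurable_cong]: "sets \<mu> = sets (spaceM M \<Otimes>\<^sub>M spaceM M)"
    using assms by (auto simp: exch_plan_def)
  have d: "distr \<mu> (spaceM M) snd = prodM M P" and t: "AE z in \<mu>. fst z \<in> tup M X"
    using assms by (auto simp: exch_plan_def)
  note [measurable_cong] = sets_prodM[OF P_sets]
  show di: "distr \<mu> P (\<lambda>z. snd z i) = P" if i: "i < M" for i
  proof -
    note [measurable] = measurable_coord[OF i] plan_measurable[OF s i]
    have cP: "(\<lambda>y. y i) \<in> measurable (spaceM M) P"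
      using measurable_coord[OF i] unfolding measurable_cong_sets[OF refl P_sets] .
    have "P = distr (prodM M P) P (\<lambda>y. y i)"
      unfolding prodM_def using i P_prob by (intro distr_PiM_component[symmetric]) auto
    also have "\<dots> = distr (distr \<mu> (spaceM M) snd) P (\<lambda>y. y i)" by (simp add: d)
    also have "\<dots> = distr \<mu> P (\<lambda>z. snd z i)" by (subst distr_distr[OF cP]) (auto simp: comp_def)
    finally show ?thesis by simp
  qed
  show "AE z in \<mu>. fst z i \<in> X" if "i < M" for i
    using t by eventually_elim (use that in \<open>simp add: tup_def PiE_iff\<close>)
  show "AE z in \<mu>. snd z i \<in> X" if i: "i < M" for i
  proof -
    have "AE y in distr \<mu> P (\<lambda>z. snd z i). y \<in> X" unfolding di[OF i] by (rule P_X)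
    then show ?thesis by (subst (asm) AE_distr_iff) (auto simp: X_closed plan_measurable[OF s i])
  qed
  show "distr \<mu> (spaceM N) (\<lambda>z. prN N (snd z)) = prodM N P" if NM: "N \<le> M"
  proof -
    note measurable_prN[OF NM, measurable]
    have "prodM N P = distr (prodM M P) (prodM N P) (prN N)"
      unfolding prodM_def prN_def[abs_def]
      using distr_PiM_reindex[of "{..<M}" "\<lambda>_. P" "\<lambda>i. i" "{..<N}"] P_prob NM by auto
    also have "\<dots> = distr (prodM M P) (spaceM N) (prN N)"
      by (intro distr_cong refl) (simp add: sets_prodM[OF P_sets])
    also have "\<dots> = distr (distr \<mu> (spaceM M) snd) (spaceM N) (prN N)" by (simp add: d)
    also have "\<dots> = distr \<mu> (spaceM N) (\<lambda>z. prN N (snd z))" by (subst distr_distr) (auto simp: comp_def)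
    finally show ?thesis by simp
  qed
  show "AE z in \<mu>. prN N (fst z) \<in> tup N X" if "N \<le> M"
    using t
  proof eventually_elim
    case (elim z)
    then have "fst z i \<in> X" if "i < N" for i using that \<open>N \<le> M\<close> by (simp add: tup_def PiE_iff)
    then show ?case by (simp add: tup_def prN_def)
  qed
qed

text \<open>Far points are sent to \<open>z0\<close>, not to the boundary of the ball: the cost of
  such a pair becomes \<open>cX z0 y\<close>, which depends on the reference point alone and has
  finite mean.\<close>

definition trunc :: "real \<Rightarrow> 'a \<Rightarrow> 'a" where
  "trunc R x = (if x \<in> X \<and> norm (x - z0) \<le> R then x else z0)"

lemma trunc_measurable [measurable]: "trunc R \<in> borel_measurable borel"
  unfolding trunc_def by measurable

lemma trunc_mem: "0 \<le> R \<Longrightarrow> trunc R x \<in> X \<inter> cball z0 R"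
  by (auto simp: trunc_def dist_norm norm_minus_commute)

text \<open>Truncation supplies the compact convex set \<open>X \<inter> cball z0 R\<close> that the
  barycenter and Jensen lemmas require. Only the pair with index 0 is treated; by exchangeability
  the same \<open>f\<close> serves every index.\<close>

lemma truncated_barycenter:
  assumes plan: "exch_plan X P M \<mu>" and M: "0 < M" and R: "0 \<le> R"
  shows "\<exists>f. f \<in> borel_measurable borel \<and> (\<forall>y. f y \<in> X \<inter> cball z0 R) \<and>
    (\<forall>p. cond_exp_fun \<mu> P (\<lambda>z. snd z 0) (\<lambda>z. p \<bullet> trunc R (fst z 0)) (\<lambda>y. p \<bullet> f y)) \<and>
    (\<integral>\<^sup>+ y. ennreal (cX (f y) y) \<partial>P) \<le> (\<integral>\<^sup>+ z. ennreal (cX (trunc R (fst z 0)) (snd z 0)) \<partial>\<mu>)"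
proof -
  note pf = plan_facts[OF plan]
  note [measurable_cong] = pf(2)
  note [measurable] = plan_measurable(1,2)[OF pf(2) M]
  have Y: "(\<lambda>z. snd z 0) \<in> measurable \<mu> P" by (rule plan_measurable(3)[OF pf(2) M])
  have KK: "compact (X \<inter> cball z0 R)" "convex (X \<inter> cball z0 R)" "X \<inter> cball z0 R \<noteq> {}"
    using X_closed X_convex trunc_mem[OF R, of z0] by (blast intro: closed_Int_compact convex_Int compact_cball convex_cball)+
  have xm: "(\<lambda>z. trunc R (fst z 0)) \<in> borel_measurable \<mu>" by measurable
  obtain f where f: "f \<in> borel_measurable P" "\<And>y. f y \<in> X \<inter> cball z0 R"
    "\<And>p. cond_exp_fun \<mu> P (\<lambda>z. snd z 0) (\<lambda>z. p \<bullet> trunc R (fst z 0)) (\<lambda>y. p \<bullet> f y)"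
    using conditional_barycenter[OF pf(1) Y pf(3)[OF M] KK xm] trunc_mem[OF R] by (metis AE_I2)
  have "(\<integral>\<^sup>+ y. ennreal (cX (f y) y) \<partial>P) \<le> (\<integral>\<^sup>+ z. ennreal (cX (trunc R (fst z 0)) (snd z 0)) \<partial>\<mu>)"
  proof (rule parametrized_jensen[OF pf(1) Y pf(3)[OF M] P_sets KK(1,2) X_sets])
    show "usc_on ((X \<inter> cball z0 R) \<times> X) (\<lambda>z. - cX (fst z) (snd z))"
      using cX_usc unfolding usc_on_def
      by (meson IntD1 Sigma_mono at_le filter_leD inf_le1 mem_Times_iff order_refl subsetD)
    show "convex_on (X \<inter> cball z0 R) (\<lambda>x. cX x y)" if "y \<in> X" for y
      using convex_on_subset[OF cX_convex[OF that]] KK(2) by auto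
    show "AE z in \<mu>. trunc R (fst z 0) \<in> X \<inter> cball z0 R" using trunc_mem[OF R] by (intro AE_I2) auto
    show "AE z in \<mu>. snd z 0 \<in> X" using pf(5)[OF M] .
    show "f y \<in> X \<inter> cball z0 R" for y using f(2) .
    show "cond_exp_fun \<mu> P (\<lambda>z. snd z 0) (\<lambda>z. p \<bullet> trunc R (fst z 0)) (\<lambda>y. p \<bullet> f y)" for p using f(3) .
  qed (auto simp: cX_nonneg)
  with f show ?thesis by (intro exI[of _ f]) (auto simp: measurable_cong_sets[OF P_sets refl])
qed


text \<open>\<open>q\<close> and \<open>\<gamma>\<close> are the slope and the intercept of an affine function selected measurably from the
  reference sample.\<close>

definition selection :: "((nat \<Rightarrow> 'a) \<Rightarrow> nat \<Rightarrow> 'a) \<Rightarrow> ((nat \<Rightarrow> 'a) \<Rightarrow> real) \<Rightarrow> real \<Rightarrow> bool" where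
  "selection q \<gamma> \<Lambda> \<longleftrightarrow> (\<forall>i<N. (\<lambda>y. q y i) \<in> borel_measurable (spaceM N)) \<and>
     \<gamma> \<in> borel_measurable (spaceM N) \<and> (\<forall>y. (\<Sum>i<N. norm (q y i)) + \<bar>\<gamma> y\<bar> \<le> \<Lambda>)"

lemma selection_aff_bound:
  assumes "selection q \<gamma> \<Lambda>" "\<And>i. i < N \<Longrightarrow> norm (u i) \<le> b" "0 \<le> b"
  shows "\<bar>aff N (q y) (\<gamma> y) u\<bar> \<le> \<Lambda> * (1 + b)"
proof -
  have "\<bar>aff N (q y) (\<gamma> y) u\<bar> \<le> \<bar>\<Sum>i<N. q y i \<bullet> u i\<bar> + \<bar>\<gamma> y\<bar>" unfolding aff_def by (rule abs_triangle_ineq)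
  also have "\<dots> \<le> (\<Sum>i<N. norm (q y i) * b) + \<bar>\<gamma> y\<bar> * (1 + b)"
  proof (intro add_mono order_trans[OF sum_abs] sum_mono)
    fix i assume "i \<in> {..<N}"
    then have "norm (q y i) * norm (u i) \<le> norm (q y i) * b" using assms(2) by (intro mult_left_mono) auto
    then show "\<bar>q y i \<bullet> u i\<bar> \<le> norm (q y i) * b" using Cauchy_Schwarz_ineq2 order_trans by blast
  qed (use assms(3) in \<open>simp add: algebra_simps\<close>)
  also have "\<dots> \<le> ((\<Sum>i<N. norm (q y i)) + \<bar>\<gamma> y\<bar>) * (1 + b)"
  proof -
    have "0 \<le> (\<Sum>i<N. norm (q y i))" by (rule sum_nonneg) simp
    then show ?thesis using assms(3) by (simp add: sum_distrib_right[symmetric] distrib_left distrib_right)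
  qed
  also have "\<dots> \<le> \<Lambda> * (1 + b)" using assms(1,3) by (intro mult_right_mono) (auto simp: selection_def)
  finally show ?thesis .
qed

lemma selection_measurable:
  assumes "selection q \<gamma> \<Lambda>" "i < N"
  shows "(\<lambda>y. q y i) \<in> borel_measurable (spaceM N)"
  using assms by (simp add: selection_def)

lemma selection_aff_measurable:
  assumes "selection q \<gamma> \<Lambda>" "Y \<in> measurable A (spaceM N)" "\<And>i. i < N \<Longrightarrow> (\<lambda>w. h w i) \<in> borel_measurable A"
  shows "(\<lambda>w. aff N (q (Y w)) (\<gamma> (Y w)) (h w)) \<in> borel_measurable A"
proof -
  have [measurable]: "\<gamma> \<in> borel_measurable (spaceM N)" using assms(1) by (simp add: selection_def)
  note assms(2)[measurable]
  have "(\<lambda>w. q (Y w) i \<bullet> h w i) \<in> borel_measurable A" if "i < N" for i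
    using measurable_compose[OF assms(2) selection_measurable[OF assms(1) that]] assms(3)[OF that] by measurable
  then show ?thesis unfolding aff_def by (intro borel_measurable_add borel_measurable_sum) auto
qed

text \<open>The affine test functional as a product law sees it, with the sample mapped
  coordinatewise by \<open>h\<close>. It is affine in \<open>h\<close>, so lower bounds pass to
  midpoint combinations.\<close>

definition \<Gamma> :: "((nat \<Rightarrow> 'a) \<Rightarrow> nat \<Rightarrow> 'a) \<Rightarrow> ((nat \<Rightarrow> 'a) \<Rightarrow> real) \<Rightarrow> ('a \<Rightarrow> 'a) \<Rightarrow> real" where
  "\<Gamma> q \<gamma> h = (\<integral>y. aff N (q y) (\<gamma> y) (\<lambda>i. h (y i)) \<partial>prodM N P)"

lemma \<Gamma>_measurable:
  assumes "selection q \<gamma> \<Lambda>" "h \<in> borel_measurable borel"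
  shows "(\<lambda>y. aff N (q y) (\<gamma> y) (\<lambda>i. h (y i))) \<in> borel_measurable (prodM N P)"
  unfolding measurable_cong_sets[OF sets_prodM[OF P_sets] refl]
  by (intro selection_aff_measurable[OF assms(1)] measurable_ident_sets refl measurable_compose[OF measurable_coord assms(2)])

lemma \<Gamma>_integrable:
  assumes "selection q \<gamma> \<Lambda>" "h \<in> borel_measurable borel" "\<And>y. norm (h y) \<le> b"
  shows "integrable (prodM N P) (\<lambda>y. aff N (q y) (\<gamma> y) (\<lambda>i. h (y i)))"
proof -
  interpret prob_space "prodM N P" by (rule prob_space_prodM[OF P_prob])
  have "0 \<le> b" using assms(3) norm_ge_zero order_trans by blast
  then show ?thesis
    using \<Gamma>_measurable[OF assms(1,2)] selection_aff_bound[OF assms(1)] assms(3)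
    by (intro integrable_const_bound[where B = "\<Lambda> * (1 + b)"] AE_I2) auto
qed

text \<open>The intercept cancels, and the remaining inner products split over \<open>N\<close>
  coordinates and \<open>DIM('a)\<close> directions. Each term is an instance of
  \<open>near_independence\<close> whose test function is a component of \<open>q y i\<close>,
  bounded by \<open>\<Lambda>\<close>, while \<open>norm z0 + R\<close> bounds the components of
  \<open>trunc R\<close> and \<open>f\<close>.\<close>

lemma \<Gamma>_near:
  assumes sel: "selection q \<gamma> \<Lambda>" and plan: "exch_plan X P M \<mu>" and B: "0 < B" "B * N \<le> M" and R: "0 \<le> R"
    and f[measurable]: "f \<in> borel_measurable borel" and fR: "\<And>y. f y \<in> X \<inter> cball z0 R"
    and ce: "\<And>p. cond_exp_fun \<mu> P (\<lambda>z. snd z 0) (\<lambda>z. p \<bullet> trunc R (fst z 0)) (\<lambda>y. p \<bullet> f y)"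
  shows "\<bar>(\<integral>z. aff N (q (prN N (snd z))) (\<gamma> (prN N (snd z))) (\<lambda>i. trunc R (fst z i)) \<partial>\<mu>) - \<Gamma> q \<gamma> f\<bar>
    \<le> real N * real DIM('a) * (2 * (\<Lambda>\<^sup>2 + (norm z0 + R)\<^sup>2) / sqrt (real B))"
proof -
  note pf = plan_facts[OF plan]
  interpret mu: prob_space \<mu> by (rule pf(1))
  have NM: "N \<le> M" using B by (metis One_nat_def Suc_leI le_trans mult_1 mult_le_mono1)
  have M0: "0 < M" using NM N_pos by simp
  have iM: "i < M" if "i < N" for i using that NM by simp
  note xm = plan_measurable(1)[OF pf(2) iM] and ym = plan_measurable(2)[OF pf(2) iM]
  have Ym: "(\<lambda>z. prN N (snd z)) \<in> measurable \<mu> (spaceM N)"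
    unfolding measurable_cong_sets[OF pf(2) refl] using measurable_compose[OF measurable_snd measurable_prN[OF NM]] .
  have nb: "norm w \<le> norm z0 + R" if "w \<in> cball z0 R" for w
    using that norm_triangle_ineq2[of w z0] by (simp add: dist_norm norm_minus_commute)
  have tb: "norm (trunc R x) \<le> norm z0 + R" and fb: "norm (f x) \<le> norm z0 + R" for x
    using trunc_mem[OF R, of x] fR[of x] by (auto intro: nb)
  have b0: "0 \<le> norm z0 + R" using R by simp
  define F1 where "F1 z = aff N (q (prN N (snd z))) (\<gamma> (prN N (snd z))) (\<lambda>i. trunc R (fst z i))"
    for z :: "(nat \<Rightarrow> 'a) \<times> (nat \<Rightarrow> 'a)"
  define F2 where "F2 z = aff N (q (prN N (snd z))) (\<gamma> (prN N (snd z))) (\<lambda>i. f (snd z i))"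
    for z :: "(nat \<Rightarrow> 'a) \<times> (nat \<Rightarrow> 'a)"
  have "F1 \<in> borel_measurable \<mu>" "F2 \<in> borel_measurable \<mu>"
    unfolding F1_def[abs_def] F2_def[abs_def]
    by (intro selection_aff_measurable[OF sel Ym] measurable_compose[OF xm trunc_measurable] measurable_compose[OF ym f]; assumption)+
  then have i12: "integrable \<mu> F1" "integrable \<mu> F2"
    using selection_aff_bound[OF sel _ b0] tb fb unfolding F1_def[abs_def] F2_def[abs_def]
    by (auto intro!: mu.integrable_const_bound[where B = "\<Lambda> * (1 + (norm z0 + R))"] AE_I2)
  have "\<Gamma> q \<gamma> f = (\<integral>y. aff N (q y) (\<gamma> y) (\<lambda>i. f (y i)) \<partial>distr \<mu> (spaceM N) (\<lambda>z. prN N (snd z)))"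
    unfolding \<Gamma>_def pf(6)[OF NM] ..
  also have "\<dots> = (\<integral>z. aff N (q (prN N (snd z))) (\<gamma> (prN N (snd z))) (\<lambda>i. f (prN N (snd z) i)) \<partial>\<mu>)"
    by (rule integral_distr[OF Ym])
       (use \<Gamma>_measurable[OF sel f] in \<open>simp add: measurable_cong_sets[OF sets_prodM[OF P_sets] refl]\<close>)
  also have "\<dots> = integral\<^sup>L \<mu> F2" unfolding F2_def[abs_def] by (simp add: aff_def prN_def)
  finally have G: "\<Gamma> q \<gamma> f = integral\<^sup>L \<mu> F2" .
  have FF: "F1 z - F2 z = (\<Sum>i<N. \<Sum>b\<in>Basis. ((trunc R (fst z i) \<bullet> b) - f (snd z i) \<bullet> b) * (q (prN N (snd z)) i \<bullet> b))" for z
  proof -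
    have "F1 z - F2 z = (\<Sum>i<N. q (prN N (snd z)) i \<bullet> (trunc R (fst z i) - f (snd z i)))"
      by (simp add: F1_def F2_def aff_def sum_subtractf[symmetric] inner_diff_right)
    also have "\<dots> = (\<Sum>i<N. \<Sum>b\<in>Basis. ((trunc R (fst z i) \<bullet> b) - f (snd z i) \<bullet> b) * (q (prN N (snd z)) i \<bullet> b))"
      by (intro sum.cong refl) (subst euclidean_inner, simp add: inner_diff_left mult.commute)
    finally show ?thesis .
  qed
  have term_int: "integrable \<mu> (\<lambda>z. ((trunc R (fst z i) \<bullet> b) - f (snd z i) \<bullet> b) * (q (prN N (snd z)) i \<bullet> b))"
    and term_bd: "\<bar>\<integral>z. ((trunc R (fst z i) \<bullet> b) - f (snd z i) \<bullet> b) * (q (prN N (snd z)) i \<bullet> b) \<partial>\<mu>\<bar>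
      \<le> 2 * (\<Lambda>\<^sup>2 + (norm z0 + R)\<^sup>2) / sqrt (real B)"
    if i: "i < N" and b: "b \<in> Basis" for i b
  proof -
    note [measurable] = xm[OF i] ym[OF i] selection_measurable[OF sel i]
    have ib: "\<bar>w \<bullet> b\<bar> \<le> norm w" for w using Basis_le_norm[OF b] by simp
    have tR: "\<bar>trunc R x \<bullet> b\<bar> \<le> norm z0 + R" and fR': "\<bar>f x \<bullet> b\<bar> \<le> norm z0 + R" for x
      using ib[of "trunc R x"] ib[of "f x"] tb[of x] fb[of x] by linarith+
    have qL: "\<bar>q y i \<bullet> b\<bar> \<le> \<Lambda>" for y
    proof -
      have "norm (q y i) \<le> (\<Sum>i<N. norm (q y i))" using i by (intro member_le_sum) auto
      moreover have "(\<Sum>i<N. norm (q y i)) + \<bar>\<gamma> y\<bar> \<le> \<Lambda>" using sel by (simp add: selection_def)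
      ultimately show ?thesis using ib[of "q y i"] by linarith
    qed
    have qm: "(\<lambda>z. q (prN N (snd z)) i) \<in> borel_measurable \<mu>"
      using measurable_compose[OF Ym selection_measurable[OF sel i]] .
    note [measurable] = qm
    show "integrable \<mu> (\<lambda>z. ((trunc R (fst z i) \<bullet> b) - f (snd z i) \<bullet> b) * (q (prN N (snd z)) i \<bullet> b))"
    proof (rule mu.integrable_const_bound[where B = "(norm z0 + R + (norm z0 + R)) * \<Lambda>"])
      show "AE z in \<mu>. norm (((trunc R (fst z i) \<bullet> b) - f (snd z i) \<bullet> b) * (q (prN N (snd z)) i \<bullet> b))
          \<le> (norm z0 + R + (norm z0 + R)) * \<Lambda>"
        unfolding real_norm_def abs_mult
        using tR fR' qL b0 by (intro AE_I2 mult_mono order_trans[OF abs_triangle_ineq4] add_mono) auto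
    qed measurable
    show "\<bar>\<integral>z. ((trunc R (fst z i) \<bullet> b) - f (snd z i) \<bullet> b) * (q (prN N (snd z)) i \<bullet> b) \<partial>\<mu>\<bar>
      \<le> 2 * (\<Lambda>\<^sup>2 + (norm z0 + R)\<^sup>2) / sqrt (real B)"
    proof (rule near_independence[OF plan P_prob P_sets B i, where \<xi> = "\<lambda>x. trunc R x \<bullet> b" and f = "\<lambda>y. f y \<bullet> b"
          and \<phi> = "\<lambda>y. q y i \<bullet> b"])
      fix \<psi> :: "'a \<Rightarrow> real" and C assume psm[measurable]: "\<psi> \<in> borel_measurable borel" and psC: "\<And>y. \<bar>\<psi> y\<bar> \<le> C"
      note [measurable] = plan_measurable(1,2)[OF pf(2) M0]
      have psm': "\<psi> \<in> borel_measurable P" unfolding measurable_cong_sets[OF P_sets refl] by measurable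
      have y0: "(\<lambda>z. snd z 0) \<in> measurable \<mu> P" by (rule plan_measurable(3)[OF pf(2) M0])
      have fm: "(\<lambda>y. b \<bullet> f y * \<psi> y) \<in> borel_measurable P" unfolding measurable_cong_sets[OF P_sets refl] by measurable
      have C0: "0 \<le> C" using psC[of undefined] by linarith
      have e: "(\<integral>z. b \<bullet> trunc R (fst z 0) * \<psi> (snd z 0) \<partial>\<mu>) = (\<integral>z. b \<bullet> f (snd z 0) * \<psi> (snd z 0) \<partial>\<mu>)"
        using cond_exp_funD[OF ce psm' psC, of b] integral_distr[OF y0 fm] unfolding pf(3)[OF M0] by simp
      have bd: "\<bar>w \<bullet> b * \<psi> y\<bar> \<le> (norm z0 + R) * C" if "\<bar>w \<bullet> b\<bar> \<le> norm z0 + R" for w y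
        unfolding abs_mult using that psC b0 by (intro mult_mono) auto
      have "integrable \<mu> (\<lambda>z. trunc R (fst z 0) \<bullet> b * \<psi> (snd z 0))"
        by (rule mu.integrable_const_bound[where B = "(norm z0 + R) * C"]) (use bd tR in auto)
      moreover have "integrable \<mu> (\<lambda>z. f (snd z 0) \<bullet> b * \<psi> (snd z 0))"
        by (rule mu.integrable_const_bound[where B = "(norm z0 + R) * C"]) (use bd fR' in auto)
      ultimately show "(\<integral>z. (trunc R (fst z 0) \<bullet> b - f (snd z 0) \<bullet> b) * \<psi> (snd z 0) \<partial>\<mu>) = 0"
        using e by (simp add: left_diff_distrib inner_commute[of b])
    qed (use tR fR' qL in auto)
  qed
  have "(\<integral>z. F1 z \<partial>\<mu>) - \<Gamma> q \<gamma> f = (\<integral>z. F1 z - F2 z \<partial>\<mu>)" using i12 G by simp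
  also have "\<dots> = (\<Sum>i<N. \<Sum>b\<in>Basis. \<integral>z. ((trunc R (fst z i) \<bullet> b) - f (snd z i) \<bullet> b) * (q (prN N (snd z)) i \<bullet> b) \<partial>\<mu>)"
    unfolding FF using term_int
    by (subst Bochner_Integration.integral_sum; (intro sum.cong refl Bochner_Integration.integral_sum Bochner_Integration.integrable_sum)?) auto
  also have "\<bar>\<dots>\<bar> \<le> (\<Sum>i<N. \<Sum>b\<in>(Basis :: 'a set). 2 * (\<Lambda>\<^sup>2 + (norm z0 + R)\<^sup>2) / sqrt (real B))"
    by (intro order_trans[OF sum_abs] sum_mono term_bd) auto
  finally show ?thesis by (simp add: F1_def)
qed

text \<open>A pointwise comparison in three cases. On \<open>D\<close>, with all coordinates inside
  the radius, the selected function majorises \<open>l\<close>. If a coordinate leaves the radius,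
  or off \<open>D\<close> where the selection vanishes, \<open>l\<close> is bounded by
  \<open>A\<close> plus its excess over \<open>A\<close>. The exceptional cases are paid for by
  their probabilities.\<close>

lemma expectation_le_selected:
  assumes sel: "selection q \<gamma> \<Lambda>" and plan: "exch_plan X P M \<mu>" and NM: "N \<le> M" and R: "0 \<le> R"
    and D: "D \<in> sets (spaceM N)"
    and maj: "\<And>y u. y \<in> D \<Longrightarrow> u \<in> tup N X \<Longrightarrow> l u \<le> aff N (q y) (\<gamma> y) u"
    and off: "\<And>y i. y \<notin> D \<Longrightarrow> i < N \<Longrightarrow> q y i = 0" "\<And>y. y \<notin> D \<Longrightarrow> \<gamma> y = 0"
    and bad: "measure \<mu> {z \<in> space \<mu>. R < norm (fst z 0 - z0)} \<le> pk"
    and li: "integrable \<mu> (\<lambda>z. lX (prN N (fst z)))" "v \<le> (\<integral>z. lX (prN N (fst z)) \<partial>\<mu>)"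
    and A: "0 \<le> A" "(\<integral>\<^sup>+ z. ennreal (lX (prN N (fst z)) - A) \<partial>\<mu>) \<le> ennreal \<epsilon>" and eps: "0 \<le> \<epsilon>"
  shows "v \<le> (\<integral>z. aff N (q (prN N (snd z))) (\<gamma> (prN N (snd z))) (\<lambda>i. trunc R (fst z i)) \<partial>\<mu>)
    + (\<Lambda> * (1 + (norm z0 + R)) + A) * (real N * pk) + A * (1 - measure (prodM N P) D) + \<epsilon>"
proof -
  note pf = plan_facts[OF plan]
  interpret mu: prob_space \<mu> by (rule pf(1))
  interpret pN: prob_space "prodM N P" by (rule prob_space_prodM[OF P_prob])
  have iM: "i < M" if "i < N" for i using that NM by simp
  have M0: "0 < M" using NM N_pos by simp
  note xm = plan_measurable(1)[OF pf(2) iM]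
  have Ym[measurable]: "(\<lambda>z. prN N (snd z)) \<in> measurable \<mu> (spaceM N)"
    and Xm[measurable]: "(\<lambda>z. prN N (fst z)) \<in> measurable \<mu> (spaceM N)"
    unfolding measurable_cong_sets[OF pf(2) refl]
    using measurable_compose[OF measurable_snd measurable_prN[OF NM]]
      measurable_compose[OF measurable_fst measurable_prN[OF NM]] .
  note D[measurable]
  define T where "T z = aff N (q (prN N (snd z))) (\<gamma> (prN N (snd z))) (\<lambda>i. trunc R (fst z i))"
    for z :: "(nat \<Rightarrow> 'a) \<times> (nat \<Rightarrow> 'a)"
  define W where "W = \<Lambda> * (1 + (norm z0 + R))"
  have b0: "0 \<le> norm z0 + R" using R by simp
  have tb: "norm (trunc R x) \<le> norm z0 + R" for x
    using trunc_mem[OF R, of x] norm_triangle_ineq2[of "trunc R x" z0] by (simp add: dist_norm norm_minus_commute)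
  have TW: "\<bar>T z\<bar> \<le> W" for z unfolding T_def W_def using selection_aff_bound[OF sel _ b0] tb by simp
  have W0: "0 \<le> W" using TW[of undefined] by linarith
  have "T \<in> borel_measurable \<mu>"
    unfolding T_def[abs_def] by (intro selection_aff_measurable[OF sel Ym] measurable_compose[OF xm trunc_measurable]; assumption)
  then have Ti: "integrable \<mu> T" using TW by (intro mu.integrable_const_bound[where B = W]) auto
  define G where "G i = {z \<in> space \<mu>. R < norm (fst z i - z0)}" for i
  have Gm: "G i \<in> sets \<mu>" if "i < N" for i
  proof -
    note xm[OF that, measurable]
    show ?thesis unfolding G_def by measurable
  qed
  \<comment> \<open>\<open>bad\<close> concerns coordinate 0; exchangeability gives the same bound
    at the others.\<close>
  have G0: "measure \<mu> (G i) \<le> pk" if i: "i < N" for i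
  proof -
    have tr: "Transposition.transpose 0 i \<in> perms M" using M0 iM[OF i] by (rule transpose_perms)
    note measurable_coord[OF M0, measurable] measurable_coord[OF iM[OF i], measurable]
    have m: "(\<lambda>z. if R < norm (fst z 0 - z0) then 1 else 0 :: real) \<in> borel_measurable (spaceM M \<Otimes>\<^sub>M spaceM M)" by measurable
    have "measure \<mu> (G j) = (\<integral>z. (if R < norm (fst z j - z0) then 1 else 0) \<partial>\<mu>)" if "j < N" for j
    proof -
      have "(\<integral>z. (if R < norm (fst z j - z0) then 1 else 0 :: real) \<partial>\<mu>) = (\<integral>z. indicator (G j) z \<partial>\<mu>)"
        by (intro Bochner_Integration.integral_cong) (auto simp: G_def)
      then show ?thesis using Gm[OF that] by simp
    qed
    then have "measure \<mu> (G i) = measure \<mu> (G 0)"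
      using i N_pos exch_plan_integral[OF plan tr m] M0 by (simp add: permute_def)
    then show ?thesis using bad by (simp add: G_def)
  qed
  define I where "I z = (\<Sum>i<N. indicator (G i) z :: real)" for z
  define E where "E z = (if prN N (snd z) \<in> D then 0 else 1 :: real)" for z :: "(nat \<Rightarrow> 'a) \<times> (nat \<Rightarrow> 'a)"
  define pos where "pos z = max 0 (lX (prN N (fst z)) - A)" for z :: "(nat \<Rightarrow> 'a) \<times> (nat \<Rightarrow> 'a)"
  have Ii: "integrable \<mu> I"
    unfolding I_def[abs_def] using Gm by (intro Bochner_Integration.integrable_sum) (auto simp: less_top[symmetric])
  have [measurable]: "E \<in> borel_measurable \<mu>" unfolding E_def by measurable
  have Ei: "integrable \<mu> E" by (rule mu.integrable_const_bound[where B = 1]) (auto simp: E_def)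
  have posi: "integrable \<mu> pos" unfolding pos_def[abs_def] using li(1) by auto
  have pos0: "0 \<le> pos z" for z by (simp add: pos_def)
  have pw: "AE z in \<mu>. lX (prN N (fst z)) \<le> T z + (W + A) * I z + A * E z + pos z"
    using pf(7)[OF NM] AE_space
  proof eventually_elim
    case (elim z)
    have I0: "0 \<le> I z" unfolding I_def by (simp add: sum_nonneg)
    have E01: "E z = (if prN N (snd z) \<in> D then 0 else 1)" by (simp add: E_def)
    have lp: "lX (prN N (fst z)) \<le> A + pos z" by (simp add: pos_def)
    consider (off) "prN N (snd z) \<notin> D" | (bad) "prN N (snd z) \<in> D" "\<exists>i<N. z \<in> G i"
      | (good) "prN N (snd z) \<in> D" "\<forall>i<N. z \<notin> G i" by blast
    then show ?case
    proof cases
      case off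
      then have "T z = 0" using assms(7,8) by (simp add: T_def aff_def)
      moreover have "0 \<le> (W + A) * I z" using W0 A(1) I0 by simp
      ultimately show ?thesis using lp E01 off by simp
    next
      case bad
      then obtain i where i: "i < N" "z \<in> G i" by blast
      have "indicator (G i) z \<le> I z" unfolding I_def using i by (intro member_le_sum) auto
      then have "1 \<le> I z" using i by simp
      \<comment> \<open>\<open>W\<close> compensates for \<open>T\<close>, which can be as low as
        \<open>- W\<close>, and \<open>A\<close> pays for \<open>l\<close>.\<close>
      then have "(W + A) * 1 \<le> (W + A) * I z" using W0 A(1) by (intro mult_left_mono) auto
      moreover have "- W \<le> T z" using TW[of z] by linarith
      ultimately show ?thesis using lp E01 bad by simp
    next
      case good
      have tx: "trunc R (fst z i) = prN N (fst z) i" if "i < N" for i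
      proof -
        have "norm (fst z i - z0) \<le> R" using good(2) that elim(2) by (auto simp: G_def not_less)
        moreover have "fst z i \<in> X" using elim(1) that by (auto simp: tup_def PiE_iff prN_def)
        ultimately show ?thesis using that by (simp add: trunc_def prN_def)
      qed
      have "lX (prN N (fst z)) \<le> aff N (q (prN N (snd z))) (\<gamma> (prN N (snd z))) (prN N (fst z))"
        using maj[OF good(1) elim(1)] elim(1) by (simp add: lX_def)
      also have "\<dots> = T z" by (simp add: T_def aff_def tx)
      finally have "lX (prN N (fst z)) \<le> T z" .
      moreover have "0 \<le> (W + A) * I z" using W0 A(1) I0 by simp
      ultimately show ?thesis using pos0[of z] E01 good by simp
    qed
  qed
  have "v \<le> (\<integral>z. T z + (W + A) * I z + A * E z + pos z \<partial>\<mu>)"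
    using li(2) integral_mono_AE[OF li(1) _ pw] Ti Ii Ei posi by (force intro: order_trans)
  also have "\<dots> = integral\<^sup>L \<mu> T + (W + A) * integral\<^sup>L \<mu> I + A * integral\<^sup>L \<mu> E + integral\<^sup>L \<mu> pos"
    using Ti Ii Ei posi by simp
  also have "\<dots> \<le> integral\<^sup>L \<mu> T + (W + A) * (real N * pk) + A * (1 - measure (prodM N P) D) + \<epsilon>"
  proof (intro add_mono mult_left_mono order_refl)
    have "integral\<^sup>L \<mu> I = (\<Sum>i<N. measure \<mu> (G i))"
      unfolding I_def[abs_def] using Gm by (subst Bochner_Integration.integral_sum) (auto simp: less_top[symmetric])
    also have "\<dots> \<le> (\<Sum>i<N. pk)" using G0 by (intro sum_mono) auto
    finally show "integral\<^sup>L \<mu> I \<le> real N * pk" by simp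
    have "integral\<^sup>L \<mu> E = (\<integral>z. 1 - indicator D (prN N (snd z)) \<partial>\<mu>)"
      by (intro Bochner_Integration.integral_cong) (auto simp: E_def)
    also have "\<dots> = (\<integral>y. 1 - indicator D y \<partial>distr \<mu> (spaceM N) (\<lambda>z. prN N (snd z)))"
      by (rule integral_distr[symmetric]) measurable
    also have "\<dots> = (\<integral>y. 1 - indicator D y \<partial>prodM N P)" by (simp only: pf(6)[OF NM])
    also have "\<dots> = 1 - measure (prodM N P) D"
    proof -
      have "D \<in> sets (prodM N P)" using D sets_prodM[OF P_sets] by simp
      then show ?thesis by (simp add: pN.prob_space less_top[symmetric])
    qed
    finally show "integral\<^sup>L \<mu> E \<le> 1 - measure (prodM N P) D" by simp
    have "ennreal (integral\<^sup>L \<mu> pos) = (\<integral>\<^sup>+ z. ennreal (pos z) \<partial>\<mu>)"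
      using posi pos0 by (intro nn_integral_eq_integral[symmetric]) auto
    also have "\<dots> = (\<integral>\<^sup>+ z. ennreal (lX (prN N (fst z)) - A) \<partial>\<mu>)"
      by (intro nn_integral_cong) (simp add: pos_def max_def ennreal_neg)
    also note A(2)
    finally show "integral\<^sup>L \<mu> pos \<le> \<epsilon>" unfolding ennreal_le_iff[OF eps] .
  qed (use W0 A(1) in auto)
  finally show ?thesis unfolding T_def[abs_def] W_def .
qed

text \<open>Affinity of \<open>\<Gamma>\<close> gives the midpoint step. Measurability and
  boundedness are carried through the induction so that the integrals may be split; the bound may
  depend on the function.\<close>

lemma \<Gamma>_midpoint_hull:
  assumes sel: "selection q \<gamma> \<Lambda>" and f: "\<And>k. f k \<in> borel_measurable borel" "\<And>k y. norm (f k y) \<le> b k"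
    and w: "\<And>k. m \<le> k \<Longrightarrow> w \<le> \<Gamma> q \<gamma> (f k)"
  shows "g \<in> midpoint_hull f m \<Longrightarrow> w \<le> \<Gamma> q \<gamma> g"
proof -
  assume g: "g \<in> midpoint_hull f m"
  have "g \<in> borel_measurable borel \<and> (\<exists>r. \<forall>y. norm (g y) \<le> r) \<and> w \<le> \<Gamma> q \<gamma> g"
    using g
  proof (induction rule: midpoint_hull.induct)
    case (base k) then show ?case using f w by blast
  next
    case (mid g h)
    then obtain r s where r: "\<And>y. norm (g y) \<le> r" and s: "\<And>y. norm (h y) \<le> s" by blast
    have m[measurable]: "g \<in> borel_measurable borel" "h \<in> borel_measurable borel" using mid by auto
    have i: "integrable (prodM N P) (\<lambda>y. aff N (q y) (\<gamma> y) (\<lambda>i. g (y i)))"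
      "integrable (prodM N P) (\<lambda>y. aff N (q y) (\<gamma> y) (\<lambda>i. h (y i)))"
      using \<Gamma>_integrable[OF sel m(1) r] \<Gamma>_integrable[OF sel m(2) s] by auto
    have "aff N p \<beta> (\<lambda>i. (1/2) *\<^sub>R (u i + u' i)) = (aff N p \<beta> u + aff N p \<beta> u') / 2" for p \<beta> and u u' :: "nat \<Rightarrow> 'a"
      by (simp add: aff_def inner_add_right sum.distrib add_divide_distrib sum_divide_distrib)
    then have "\<Gamma> q \<gamma> (\<lambda>y. (1/2) *\<^sub>R (g y + h y)) = (\<Gamma> q \<gamma> g + \<Gamma> q \<gamma> h) / 2"
      unfolding \<Gamma>_def by (simp only: Bochner_Integration.integral_divide_zero Bochner_Integration.integral_add[OF i])
    moreover have "norm ((1/2) *\<^sub>R (g y + h y)) \<le> r + s" for y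
    proof -
      have "0 \<le> r" "0 \<le> s" using r[of y] s[of y] norm_ge_zero order_trans by blast+
      then show ?thesis using norm_triangle_ineq[of "g y" "h y"] r[of y] s[of y] by simp
    qed
    ultimately have "\<exists>r. \<forall>y. norm ((1/2) *\<^sub>R (g y + h y)) \<le> r"
      "w \<le> \<Gamma> q \<gamma> (\<lambda>y. (1/2) *\<^sub>R (g y + h y))" using mid by (blast, simp)
    then show ?case by (intro conjI) measurable
  qed
  then show ?thesis by blast
qed

text \<open>No uniform bound on the maps \<open>g m\<close> is at hand, only one at the coordinates
  of samples in \<open>D\<close>. Off \<open>D\<close> all slopes vanish, so the integrands still
  have a common constant bound and dominated convergence applies.\<close>

lemma \<Gamma>_tendsto:
  assumes sel: "selection q \<gamma> \<Lambda>" and g: "\<And>m. g m \<in> borel_measurable borel" and fs: "fs \<in> borel_measurable borel"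
    and lim: "AE y in prodM N P. \<forall>i<N. (\<lambda>m. g m (y i)) \<longlonglongrightarrow> fs (y i)"
    and bd: "\<And>y i m. y \<in> D \<Longrightarrow> i < N \<Longrightarrow> norm (g m (y i)) \<le> b" and b: "0 \<le> b"
    and off: "\<And>y i. y \<notin> D \<Longrightarrow> i < N \<Longrightarrow> q y i = 0"
  shows "(\<lambda>m. \<Gamma> q \<gamma> (g m)) \<longlonglongrightarrow> \<Gamma> q \<gamma> fs"
  unfolding \<Gamma>_def
proof (rule integral_dominated_convergence)
  interpret pN: prob_space "prodM N P" by (rule prob_space_prodM[OF P_prob])
  show "integrable (prodM N P) (\<lambda>_. \<Lambda> * (1 + b))" by simp
  show "AE y in prodM N P. (\<lambda>m. aff N (q y) (\<gamma> y) (\<lambda>i. g m (y i))) \<longlonglongrightarrow> aff N (q y) (\<gamma> y) (\<lambda>i. fs (y i))"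
    using lim unfolding aff_def by eventually_elim (auto intro!: tendsto_intros)
  show "AE y in prodM N P. norm (aff N (q y) (\<gamma> y) (\<lambda>i. g m (y i))) \<le> \<Lambda> * (1 + b)" for m
  proof (rule AE_I2)
    fix y show "norm (aff N (q y) (\<gamma> y) (\<lambda>i. g m (y i))) \<le> \<Lambda> * (1 + b)"
    proof (cases "y \<in> D")
      case True then show ?thesis using selection_aff_bound[OF sel _ b, of "\<lambda>i. g m (y i)" y] bd by simp
    next
      case False
      then have "aff N (q y) (\<gamma> y) (\<lambda>i. g m (y i)) = aff N (q y) (\<gamma> y) (\<lambda>i. 0)" using off by (simp add: aff_def)
      then show ?thesis using selection_aff_bound[OF sel _ b, of "\<lambda>i. 0" y] b by simp
    qed
  qed
qed (use \<Gamma>_measurable[OF sel] g fs in auto)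

end

section \<open>Extended integrals, null sets of products, and the passage to the limit\<close>

lemma ext_integral_eq:
  assumes "integrable M f" shows "ext_integral M f = ereal (\<integral>x. f x \<partial>M)"
proof -
  have "(\<integral>\<^sup>+ x. ennreal (f x) \<partial>M) < \<infinity>" "(\<integral>\<^sup>+ x. ennreal (- f x) \<partial>M) < \<infinity>"
    using integrableD(2)[OF assms] integrableD(3)[OF assms] by (auto simp: less_top)
  then have "enn2ereal (\<integral>\<^sup>+ x. ennreal (f x) \<partial>M) = ereal (enn2real (\<integral>\<^sup>+ x. ennreal (f x) \<partial>M))"
    "enn2ereal (\<integral>\<^sup>+ x. ennreal (- f x) \<partial>M) = ereal (enn2real (\<integral>\<^sup>+ x. ennreal (- f x) \<partial>M))"
    by (metis enn2ereal_ennreal enn2real_nonneg ennreal_enn2real infinity_ennreal_def)+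
  then show ?thesis unfolding ext_integral_def real_lebesgue_integral_def[OF assms] by simp
qed

text \<open>\<open>Q\<close> may fail to be measurable, so a measurable null set covering its
  failures is pulled back along each coordinate.\<close>

lemma AE_prodM:
  assumes P: "prob_space P" and Q: "AE y in P. Q y"
  shows "AE y in prodM N P. \<forall>i<N. Q (y i)"
proof -
  have "AE y in prodM N P. Q (y i)" if i: "i < N" for i
  proof -
    obtain S where S: "{y \<in> space P. \<not> Q y} \<subseteq> S" "S \<in> null_sets P"
      using Q by (auto simp: eventually_ae_filter)
    have "distr (prodM N P) P (\<lambda>y. y i) = P"
      unfolding prodM_def using i P by (intro distr_PiM_component) auto
    moreover have m: "(\<lambda>y. y i) \<in> measurable (prodM N P) P"
      unfolding prodM_def using i by (intro measurable_component_singleton) simp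
    moreover have "AE y in P. y \<notin> S" using S(2) by (rule AE_not_in)
    ultimately have "AE y in distr (prodM N P) P (\<lambda>y. y i). y \<notin> S" by metis
    then have "AE y in prodM N P. y i \<notin> S"
      using m S(2) by (subst (asm) AE_distr_iff) (auto simp: sets.sets_into_space)
    then show ?thesis using AE_space
    proof eventually_elim
      case (elim y)
      then have "y i \<in> space P" using measurable_space[OF m] by blast
      then show ?case using elim S(1) by blast
    qed
  qed
  then have "AE y in prodM N P. \<forall>i\<in>{..<N}. Q (y i)" by (intro AE_ball_countable[THEN iffD2]) auto
  then show ?thesis by eventually_elim auto
qed

context dro
begin

text \<open>Averaging over \<open>4096 ^ k\<close> blocks leaves an error of order \<open>(R k)\<^sup>2 / 64 ^ k\<close>, which vanishes because
  \<open>R k \<le> 4 ^ k\<close>.\<close>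

lemma limit_expectation:
  fixes \<mu> :: "nat \<Rightarrow> ((nat \<Rightarrow> 'a) \<times> (nat \<Rightarrow> 'a)) measure"
  assumes plan: "\<And>k. exch_plan X P (M k) (\<mu> k)" and M: "\<And>k. 4096 ^ k * N \<le> M k"
    and R: "\<And>k. 1 \<le> R k" "\<And>k. R k \<le> 4 ^ k"
    and bad: "\<And>k. R k * measure (\<mu> k) {z \<in> space (\<mu> k). R k < norm (fst z 0 - z0)} \<le> C1 / real (k + 1)"
    and f: "\<And>k. f k \<in> borel_measurable borel" "\<And>k y. f k y \<in> X \<inter> cball z0 (R k)"
      "\<And>k p. cond_exp_fun (\<mu> k) P (\<lambda>z. snd z 0) (\<lambda>z. p \<bullet> trunc (R k) (fst z 0)) (\<lambda>y. p \<bullet> f k y)"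
    and g: "\<And>n. g n \<in> midpoint_hull f n" and fs: "fs \<in> borel_measurable borel" "\<And>y. fs y \<in> X"
    and lim: "AE y in P. (\<lambda>n. g n y) \<longlonglongrightarrow> fs y"
    and li: "\<And>k. integrable (\<mu> k) (\<lambda>z. lX (prN N (fst z)))" "\<And>k. v \<le> (\<integral>z. lX (prN N (fst z)) \<partial>\<mu> k)"
    and ui: "\<And>\<epsilon>::real. 0 < \<epsilon> \<Longrightarrow> \<exists>A\<ge>0. \<forall>k. (\<integral>\<^sup>+ z. ennreal (lX (prN N (fst z)) - A) \<partial>\<mu> k) \<le> ennreal \<epsilon>"
  defines "L \<equiv> (\<lambda>y. lX (restrict (\<lambda>i. fs (y i)) {..<N}))"
  assumes Lfin: "(\<integral>\<^sup>+ y. ennreal (L y) \<partial>prodM N P) < \<infinity>"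
  shows "integrable (prodM N P) L" "v \<le> (\<integral>y. L y \<partial>prodM N P)"
proof -
  interpret pN: prob_space "prodM N P" by (rule prob_space_prodM[OF P_prob])
  have [measurable_cong]: "sets (prodM N P) = sets (spaceM N)" by (rule sets_prodM[OF P_sets])
  obtain p :: "nat \<Rightarrow> nat \<Rightarrow> 'a" and \<beta> :: "nat \<Rightarrow> real"
    where maj: "\<And>n u. u \<in> tup N X \<Longrightarrow> l u \<le> aff N (p n) (\<beta> n) u"
    and appr: "\<And>u t. u \<in> tup N X \<Longrightarrow> l u < t \<Longrightarrow> \<exists>n. aff N (p n) (\<beta> n) u < t"
    using countable_affine_majorants[OF X_closed X_convex X_ne l_usc l_concave] by metis
  define u where "u y = restrict (\<lambda>i. fs (y i)) {..<N}" for y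
  have um[measurable]: "u \<in> measurable (spaceM N) (spaceM N)"
  proof -
    have "(\<lambda>y. restrict (\<lambda>i. fs (y i)) {..<N}) \<in> measurable (spaceM N) (PiM {..<N} (\<lambda>_. borel))"
      by (intro measurable_restrict measurable_compose[OF measurable_coord fs(1)]) auto
    then show ?thesis by (simp add: u_def[abs_def] spaceM_def)
  qed
  have ut: "u y \<in> tup N X" for y using fs(2) by (auto simp: u_def tup_def)
  have L: "L y = l (u y)" for y using ut[of y] by (simp add: L_def lX_def u_def)
  have Lm[measurable]: "L \<in> borel_measurable (spaceM N)" unfolding L_def u_def[symmetric] by measurable
  have gm: "g n \<in> borel_measurable borel" for n using midpoint_hull_measurable[OF f(1) g] .
  \<comment> \<open>\<open>Lfin\<close> controls the positive part of \<open>L\<close> only, and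
    integrability of \<open>L\<close> is part of the claim; \<open>Lp\<close> serves as integrable
    upper bound until the negative part is under control.\<close>
  define Lp where "Lp y = max 0 (L y)" for y
  have Lpi: "integrable (prodM N P) Lp"
  proof (subst integrable_iff_bounded, intro conjI)
    have "(\<integral>\<^sup>+ y. ennreal (norm (Lp y)) \<partial>prodM N P) = (\<integral>\<^sup>+ y. ennreal (L y) \<partial>prodM N P)"
      by (intro nn_integral_cong) (auto simp: Lp_def max_def ennreal_neg)
    then show "(\<integral>\<^sup>+ y. ennreal (norm (Lp y)) \<partial>prodM N P) < \<infinity>" using Lfin by simp
    show "Lp \<in> borel_measurable (prodM N P)" unfolding Lp_def by measurable
  qed
  have main: "integrable (prodM N P) L \<and> v - 2 * \<epsilon> \<le> (\<integral>y. L y \<partial>prodM N P)" if eps: "0 < \<epsilon>" for \<epsilon>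
  proof -
    obtain A where A: "0 \<le> A" "\<And>k. (\<integral>\<^sup>+ z. ennreal (lX (prN N (fst z)) - A) \<partial>\<mu> k) \<le> ennreal \<epsilon>"
      using ui[OF eps] by blast
    \<comment> \<open>The first majorant within \<open>\<epsilon>\<close> of \<open>l\<close> at the
      limit point \<open>u y\<close>. It depends on \<open>y\<close> and not on \<open>k\<close>, so
      the resulting selection can be tested against every plan.\<close>
    define J where "J y = (LEAST j. aff N (p j) (\<beta> j) (u y) < L y + \<epsilon>)" for y
    have J: "aff N (p (J y)) (\<beta> (J y)) (u y) < L y + \<epsilon>" for y
    proof -
      have "\<exists>j. aff N (p j) (\<beta> j) (u y) < L y + \<epsilon>" by (rule appr[OF ut]) (use eps in \<open>simp add: L\<close>)
      then show ?thesis unfolding J_def by (rule LeastI_ex)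
    qed
    have affm[measurable]: "(\<lambda>y. aff N (p j) (\<beta> j) (u y)) \<in> borel_measurable (spaceM N)" for j
      unfolding aff_def
      by (intro borel_measurable_add borel_measurable_sum borel_measurable_inner measurable_compose[OF um measurable_coord]) auto
    have Jm[measurable]: "J \<in> measurable (spaceM N) (count_space UNIV)"
      unfolding J_def by (intro measurable_Least) measurable
    \<comment> \<open>Bounds the whole sequence \<open>g\<close> and its limit at once, as
      domination of the integrands along \<open>g\<close> demands.\<close>
    define S where "S n = {x. (\<forall>m. norm (g m x) \<le> real n) \<and> norm (fs x) \<le> real n}" for n :: nat
    have Sm: "S n \<in> sets borel" for n
    proof -
      note gm[measurable] fs(1)[measurable]
      have "{x\<in>space borel. (\<forall>m. norm (g m x) \<le> real n) \<and> norm (fs x) \<le> real n} \<in> sets borel" by measurable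
      then show ?thesis by (simp add: S_def)
    qed
    \<comment> \<open>Restricting to finitely many majorants makes slopes and intercepts bounded by
      \<open>\<Lambda> n\<close>; restricting to bounded orbits makes the limit along
      \<open>g\<close> dominated.\<close>
    define D where "D n = tup N (S n) \<inter> {y \<in> space (spaceM N). J y \<le> n}" for n
    have Dm[measurable]: "D n \<in> sets (spaceM N)" for n
    proof -
      have "{y \<in> space (spaceM N). J y \<le> n} \<in> sets (spaceM N)" by measurable
      then show ?thesis unfolding D_def using sets_tup[OF Sm] by (rule sets.Int[rotated])
    qed
    have DS: "y i \<in> S n" if "y \<in> D n" "i < N" for y i n using that by (auto simp: D_def tup_def)
    define \<Lambda> where "\<Lambda> n = (\<Sum>j\<le>n. (\<Sum>i<N. norm (p j i)) + \<bar>\<beta> j\<bar>)" for n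
    have Lam: "(\<Sum>i<N. norm (p j i)) + \<bar>\<beta> j\<bar> \<le> \<Lambda> n" if "j \<le> n" for j n
      unfolding \<Lambda>_def using that
      by (intro member_le_sum[of j "{..n}" "\<lambda>j. (\<Sum>i<N. norm (p j i)) + \<bar>\<beta> j\<bar>"])
        (auto intro!: add_nonneg_nonneg sum_nonneg)
    have Lam0: "0 \<le> \<Lambda> n" for n unfolding \<Lambda>_def by (intro sum_nonneg add_nonneg_nonneg) auto
    define q where "q n y i = (if y \<in> D n then p (J y) i else 0)" for n y i
    define \<gamma> where "\<gamma> n y = (if y \<in> D n then \<beta> (J y) else 0)" for n y
    have sel: "selection (q n) (\<gamma> n) (\<Lambda> n)" for n
      unfolding selection_def
    proof (intro conjI allI impI)
      have b: "(\<lambda>y. \<beta> (J y)) \<in> borel_measurable (spaceM N)" by (rule measurable_compose[OF Jm]) simp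
      then show "\<gamma> n \<in> borel_measurable (spaceM N)" unfolding \<gamma>_def by measurable
      show "(\<lambda>y. q n y i) \<in> borel_measurable (spaceM N)" if "i < N" for i
      proof -
        have "(\<lambda>y. p (J y) i) \<in> borel_measurable (spaceM N)" by (rule measurable_compose[OF Jm]) simp
        then show ?thesis unfolding q_def by measurable
      qed
      show "(\<Sum>i<N. norm (q n y i)) + \<bar>\<gamma> n y\<bar> \<le> \<Lambda> n" for y
        using Lam[of "J y" n] Lam0[of n] by (auto simp: q_def \<gamma>_def D_def)
    qed
    \<comment> \<open>With \<open>n\<close> fixed, the errors at stage \<open>k\<close> vanish
      first; the bound then passes to the hull elements \<open>g m\<close> and on to
      \<open>fs\<close>. What remains is \<open>\<epsilon>\<close> and the mass outside
      \<open>D n\<close>.\<close>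
    have claim: "v - A * (1 - measure (prodM N P) (D n)) - \<epsilon> \<le> \<Gamma> (q n) (\<gamma> n) fs" for n
    proof (rule field_le_epsilon)
      fix \<delta> :: real assume \<delta>: "0 < \<delta>"
      \<comment> \<open>\<open>c1\<close> collects the loss from coordinates beyond the radius,
        where \<open>R k\<close> times the bad mass is of order \<open>1 / k\<close>;
        \<open>c2\<close> collects the error of the block averages.\<close>
      define c1 where "c1 = (\<Lambda> n * (2 + norm z0) + A) * real N * C1"
      define c2 where "c2 = real N * real DIM('a) * (2 * ((\<Lambda> n)\<^sup>2 + (norm z0 + 1)\<^sup>2))"
      have step: "v - A * (1 - measure (prodM N P) (D n)) - \<epsilon> \<le> \<Gamma> (q n) (\<gamma> n) (f k) + (c1 / real (k + 1) + c2 * (1/4) ^ k)" for k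
      proof -
        define pk where "pk = measure (\<mu> k) {z \<in> space (\<mu> k). R k < norm (fst z 0 - z0)}"
        have NM: "N \<le> M k" using M[of k] by (metis le_trans mult_le_mono1 nat_mult_1 one_le_power one_le_numeral)
        have R0: "0 \<le> R k" using R(1)[of k] by simp
        define I where "I = (\<integral>z. aff N (q n (prN N (snd z))) (\<gamma> n (prN N (snd z))) (\<lambda>i. trunc (R k) (fst z i)) \<partial>\<mu> k)"
        have "v \<le> I + (\<Lambda> n * (1 + (norm z0 + R k)) + A) * (real N * pk) + A * (1 - measure (prodM N P) (D n)) + \<epsilon>"
          unfolding I_def
        proof (rule expectation_le_selected[OF sel plan NM R0 Dm _ _ _ _ li A(1) A(2)])
          show "l w \<le> aff N (q n y) (\<gamma> n y) w" if "y \<in> D n" "w \<in> tup N X" for y w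
            using maj[OF that(2), of "J y"] that(1) by (simp add: q_def \<gamma>_def aff_def)
        qed (use eps in \<open>auto simp: q_def \<gamma>_def pk_def\<close>)
        moreover have "\<bar>I - \<Gamma> (q n) (\<gamma> n) (f k)\<bar> \<le> real N * real DIM('a) * (2 * ((\<Lambda> n)\<^sup>2 + (norm z0 + R k)\<^sup>2) / sqrt (real (4096 ^ k)))"
          unfolding I_def using M[of k] by (intro \<Gamma>_near[OF sel plan _ _ R0 f(1,2,3)]) auto
        moreover have "(\<Lambda> n * (1 + (norm z0 + R k)) + A) * (real N * pk) \<le> c1 / real (k + 1)"
        proof -
          have "(norm z0 + 1) * 1 \<le> (norm z0 + 1) * R k" using R(1)[of k] by (intro mult_left_mono) auto
          then have "1 + (norm z0 + R k) \<le> (2 + norm z0) * R k" by (simp add: algebra_simps)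
          then have "\<Lambda> n * (1 + (norm z0 + R k)) + A * 1 \<le> \<Lambda> n * ((2 + norm z0) * R k) + A * R k"
            using Lam0 A(1) R(1)[of k] by (intro add_mono mult_left_mono) auto
          then have "(\<Lambda> n * (1 + (norm z0 + R k)) + A) * (real N * pk) \<le> (\<Lambda> n * ((2 + norm z0) * R k) + A * R k) * (real N * pk)"
            by (intro mult_right_mono) (auto simp: pk_def)
          also have "\<dots> = (\<Lambda> n * (2 + norm z0) + A) * real N * (R k * pk)" by (simp add: algebra_simps)
          also have "\<dots> \<le> (\<Lambda> n * (2 + norm z0) + A) * real N * (C1 / real (k + 1))"
            using bad[of k] Lam0 A(1) by (intro mult_left_mono) (auto simp: pk_def)
          finally show ?thesis by (simp add: c1_def)
        qed
        moreover have "real N * real DIM('a) * (2 * ((\<Lambda> n)\<^sup>2 + (norm z0 + R k)\<^sup>2) / sqrt (real (4096 ^ k))) \<le> c2 * (1/4) ^ k"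
        proof -
          have s: "sqrt (real (4096 ^ k)) = 64 ^ k"
          proof (rule real_sqrt_unique)
            have "((64::real) ^ k)\<^sup>2 = (64\<^sup>2) ^ k" by (simp only: power_mult[symmetric] mult.commute)
            then show "((64::real) ^ k)\<^sup>2 = real (4096 ^ k)" by simp
          qed simp
          have four: "(1::real) \<le> 4 ^ k" by simp
          have "norm z0 * 1 \<le> norm z0 * 4 ^ k" using four by (intro mult_left_mono) auto
          then have "norm z0 + R k \<le> (norm z0 + 1) * 4 ^ k" using R(2)[of k] by (simp add: algebra_simps)
          then have "(norm z0 + R k)\<^sup>2 \<le> ((norm z0 + 1) * 4 ^ k)\<^sup>2" using R0 by (intro power_mono) auto
          also have "\<dots> = (norm z0 + 1)\<^sup>2 * ((4::real) ^ k)\<^sup>2" by (rule power_mult_distrib)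
          also have "((4::real) ^ k)\<^sup>2 = 16 ^ k"
          proof -
            have "((4::real) ^ k)\<^sup>2 = (4\<^sup>2) ^ k" by (simp only: power_mult[symmetric] mult.commute)
            then show ?thesis by simp
          qed
          finally have "(norm z0 + R k)\<^sup>2 \<le> (norm z0 + 1)\<^sup>2 * 16 ^ k" .
          moreover have "(\<Lambda> n)\<^sup>2 * 1 \<le> (\<Lambda> n)\<^sup>2 * 16 ^ k" by (intro mult_left_mono) auto
          ultimately have "(\<Lambda> n)\<^sup>2 + (norm z0 + R k)\<^sup>2 \<le> ((\<Lambda> n)\<^sup>2 + (norm z0 + 1)\<^sup>2) * 16 ^ k"
            by (simp add: distrib_right)
          then have "real N * real DIM('a) * (2 * ((\<Lambda> n)\<^sup>2 + (norm z0 + R k)\<^sup>2) / 64 ^ k)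
              \<le> real N * real DIM('a) * (2 * (((\<Lambda> n)\<^sup>2 + (norm z0 + 1)\<^sup>2) * 16 ^ k) / 64 ^ k)"
            by (intro mult_left_mono divide_right_mono) auto
          also have "\<dots> = c2 * (16 ^ k / 64 ^ k)" by (simp add: c2_def)
          also have "(16::real) ^ k / 64 ^ k = (1/4) ^ k" by (simp add: power_divide[symmetric])
          finally show ?thesis by (simp only: s)
        qed
        moreover have "v - a - \<epsilon> \<le> G + (x + y)"
          if "v \<le> I + b + a + \<epsilon>" "\<bar>I - G\<bar> \<le> d" "b \<le> x" "d \<le> y" for a b d G x y using that by linarith
        ultimately show ?thesis by blast
      qed
      have "(\<lambda>k. c1 / real (k + 1) + c2 * (1/4) ^ k) \<longlonglongrightarrow> 0 + c2 * 0"
      proof (intro tendsto_intros LIMSEQ_power_zero)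
        show "(\<lambda>k. c1 / real (k + 1)) \<longlonglongrightarrow> 0"
          using LIMSEQ_ignore_initial_segment[OF lim_const_over_n[of c1], of 1] by simp
      qed simp
      then have "eventually (\<lambda>k. c1 / real (k + 1) + c2 * (1/4) ^ k < \<delta>) sequentially"
        using \<delta> by (intro order_tendstoD) auto
      then obtain k0 where k0: "\<And>k. k0 \<le> k \<Longrightarrow> c1 / real (k + 1) + c2 * (1/4) ^ k < \<delta>"
        by (auto simp: eventually_sequentially)
      define w where "w = v - A * (1 - measure (prodM N P) (D n)) - \<epsilon> - \<delta>"
      have wf: "w \<le> \<Gamma> (q n) (\<gamma> n) (f k)" if "k0 \<le> k" for k
        using step[of k] k0[OF that] unfolding w_def by linarith
      have fb: "norm (f k y) \<le> norm z0 + R k" for k y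
        using f(2)[of k y] norm_triangle_ineq2[of "f k y" z0] by (simp add: dist_norm norm_minus_commute)
      have wg: "w \<le> \<Gamma> (q n) (\<gamma> n) (g m)" if "k0 \<le> m" for m
        by (rule \<Gamma>_midpoint_hull[OF sel f(1) fb _ g]) (use wf that in auto)
      have "(\<lambda>m. \<Gamma> (q n) (\<gamma> n) (g m)) \<longlonglongrightarrow> \<Gamma> (q n) (\<gamma> n) fs"
      proof (rule \<Gamma>_tendsto[OF sel gm fs(1), where D = "D n" and b = "real n"])
        show "AE y in prodM N P. \<forall>i<N. (\<lambda>m. g m (y i)) \<longlonglongrightarrow> fs (y i)" by (rule AE_prodM[OF P_prob lim])
        show "norm (g m (y i)) \<le> real n" if "y \<in> D n" "i < N" for y i m using DS[OF that] by (simp add: S_def)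
      qed (auto simp: q_def)
      then have "w \<le> \<Gamma> (q n) (\<gamma> n) fs" using wg by (intro LIMSEQ_le_const) auto
      then show "v - A * (1 - measure (prodM N P) (D n)) - \<epsilon> \<le> \<Gamma> (q n) (\<gamma> n) fs + \<delta>" by (simp add: w_def)
    qed
    have fsb: "norm (u y i) \<le> real n" if "y \<in> D n" "i < N" for y i n
      using DS[OF that] that(2) by (simp add: S_def u_def)
    have Lb: "\<bar>L y\<bar> \<le> \<Lambda> n * (1 + real n) + \<epsilon>" if y: "y \<in> D n" for n y
    proof -
      have c: "\<bar>aff N (p j) (\<beta> j) (u y)\<bar> \<le> \<Lambda> n * (1 + real n)" if "j \<le> n" for j
      proof -
        have "selection (\<lambda>_. p j) (\<lambda>_. \<beta> j) (\<Lambda> n)" using Lam[OF that] by (simp add: selection_def)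
        from selection_aff_bound[OF this fsb[OF y]] show ?thesis by simp
      qed
      have "L y \<le> aff N (p 0) (\<beta> 0) (u y)" unfolding L by (rule maj[OF ut])
      moreover have "J y \<le> n" using y by (simp add: D_def)
      ultimately show ?thesis using c[of 0] c[of "J y"] J[of y] eps by linarith
    qed
    define LD where "LD n y = (if y \<in> D n then L y else 0)" for n y
    have LDi: "integrable (prodM N P) (LD n)" for n
    proof (rule pN.integrable_const_bound[where B = "\<Lambda> n * (1 + real n) + \<epsilon>"])
      have "0 \<le> \<Lambda> n * (1 + real n) + \<epsilon>" using Lam0[of n] eps by (intro add_nonneg_nonneg) auto
      then show "AE y in prodM N P. norm (LD n y) \<le> \<Lambda> n * (1 + real n) + \<epsilon>"
        using Lb by (intro AE_I2) (auto simp: LD_def)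
    qed (unfold LD_def, measurable)
    have LDint: "v - A * (1 - measure (prodM N P) (D n)) - 2 * \<epsilon> \<le> (\<integral>y. LD n y \<partial>prodM N P)" for n
    proof -
      have "\<Gamma> (q n) (\<gamma> n) fs \<le> (\<integral>y. LD n y + \<epsilon> \<partial>prodM N P)"
        unfolding \<Gamma>_def
      proof (rule integral_mono)
        show "integrable (prodM N P) (\<lambda>y. aff N (q n y) (\<gamma> n y) (\<lambda>i. fs (y i)))"
        proof (rule pN.integrable_const_bound[where B = "\<Lambda> n * (1 + real n)"])
          show "AE y in prodM N P. norm (aff N (q n y) (\<gamma> n y) (\<lambda>i. fs (y i))) \<le> \<Lambda> n * (1 + real n)"
          proof (rule AE_I2)
            fix y show "norm (aff N (q n y) (\<gamma> n y) (\<lambda>i. fs (y i))) \<le> \<Lambda> n * (1 + real n)"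
            proof (cases "y \<in> D n")
              case True
              then show ?thesis
                using selection_aff_bound[OF sel, where u = "\<lambda>i. fs (y i)" and b = "real n"] DS[OF True]
                by (simp add: S_def)
            next
              case False
              then show ?thesis using Lam0[of n] by (simp add: aff_def q_def \<gamma>_def)
            qed
          qed
        qed (rule \<Gamma>_measurable[OF sel fs(1)])
        show "integrable (prodM N P) (\<lambda>y. LD n y + \<epsilon>)" using LDi by simp
        fix y show "aff N (q n y) (\<gamma> n y) (\<lambda>i. fs (y i)) \<le> LD n y + \<epsilon>"
          using J[of y] eps by (cases "y \<in> D n") (auto simp: aff_def q_def \<gamma>_def LD_def u_def)
      qed
      also have "\<dots> = (\<integral>y. LD n y \<partial>prodM N P) + \<epsilon>" using LDi by (simp add: pN.prob_space)
      finally show ?thesis using claim[of n] by linarith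
    qed
    \<comment> \<open>A convergent sequence is bounded, so almost every sample lies in
      \<open>D n\<close> once \<open>n\<close> exceeds its bounds and its index
      \<open>J y\<close>.\<close>
    have ev: "AE y in prodM N P. eventually (\<lambda>n. y \<in> D n) sequentially"
      using AE_prodM[OF P_prob lim] AE_space
    proof eventually_elim
      case (elim y)
      have "\<exists>r. \<forall>m. norm (g m (y i)) \<le> r" if "i < N" for i
        using elim(1) that Bseq_def convergent_imp_Bseq convergentI by (metis)
      then obtain r where r: "\<And>i m. i < N \<Longrightarrow> norm (g m (y i)) \<le> r i" by metis
      obtain n0 :: nat where n0: "(\<Sum>i<N. \<bar>r i\<bar> + norm (fs (y i))) \<le> real n0" using real_arch_simple by blast
      have "y \<in> D n" if n: "max n0 (J y) \<le> n" for n
      proof -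
        have "y i \<in> S n" if i: "i < N" for i
        proof -
          have "\<bar>r i\<bar> + norm (fs (y i)) \<le> (\<Sum>i<N. \<bar>r i\<bar> + norm (fs (y i)))"
            using i by (intro member_le_sum) auto
          then have b: "\<bar>r i\<bar> + norm (fs (y i)) \<le> real n" using n0 n by linarith
          have "norm (g m (y i)) \<le> real n" for m using r[OF i, of m] b norm_ge_zero[of "fs (y i)"] by linarith
          moreover have "norm (fs (y i)) \<le> real n" using b by linarith
          ultimately show ?thesis by (simp add: S_def)
        qed
        then show ?thesis using elim(2) n by (auto simp: D_def tup_def PiE_iff space_prodM[OF P_sets])
      qed
      then show ?case unfolding eventually_sequentially by blast
    qed
    have Dlim: "(\<lambda>n. measure (prodM N P) (D n)) \<longlonglongrightarrow> 1"
    proof -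
      have "(\<lambda>n. \<integral>y. indicator (D n) y \<partial>prodM N P) \<longlonglongrightarrow> (\<integral>y. (1::real) \<partial>prodM N P)"
      proof (rule integral_dominated_convergence[where w = "\<lambda>_. 1"])
        show "AE y in prodM N P. (\<lambda>n. indicator (D n) y) \<longlonglongrightarrow> (1::real)"
          using ev by eventually_elim (intro tendsto_eventually, auto elim!: eventually_mono)
      qed auto
      then show ?thesis by (simp add: pN.prob_space)
    qed
    define Ip where "Ip = (\<integral>y. Lp y \<partial>prodM N P)"
    have nn: "0 \<le> Lp y - LD n y" for y n by (auto simp: Lp_def LD_def)
    \<comment> \<open>Fatou for \<open>Lp - LD n \<ge> 0\<close>: on \<open>D n\<close> this is the
      negative part of \<open>L\<close>, off \<open>D n\<close> it is \<open>Lp\<close>. One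
      estimate thus yields both integrability of \<open>L\<close> and the lower bound for its
      mean.\<close>
    have fat: "(\<integral>\<^sup>+ y. ennreal (- L y) \<partial>prodM N P) \<le> liminf (\<lambda>n. \<integral>\<^sup>+ y. ennreal (Lp y - LD n y) \<partial>prodM N P)"
    proof -
      have "(\<integral>\<^sup>+ y. ennreal (- L y) \<partial>prodM N P) = (\<integral>\<^sup>+ y. liminf (\<lambda>n. ennreal (Lp y - LD n y)) \<partial>prodM N P)"
      proof (rule nn_integral_cong_AE)
        show "AE y in prodM N P. ennreal (- L y) = liminf (\<lambda>n. ennreal (Lp y - LD n y))"
          using ev
        proof eventually_elim
          case (elim y)
          have "(\<lambda>n. ennreal (Lp y - LD n y)) \<longlonglongrightarrow> ennreal (- L y)"
          proof (rule tendsto_eventually)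
            have e: "ennreal (Lp y - L y) = ennreal (- L y)" by (simp add: Lp_def max_def ennreal_neg)
            show "\<forall>\<^sub>F n in sequentially. ennreal (Lp y - LD n y) = ennreal (- L y)"
              using elim by (rule eventually_mono) (simp add: LD_def e)
          qed
          then show ?case by (simp add: lim_imp_Liminf)
        qed
      qed
      also have "\<dots> \<le> liminf (\<lambda>n. \<integral>\<^sup>+ y. ennreal (Lp y - LD n y) \<partial>prodM N P)"
        using LDi Lpi by (intro nn_integral_liminf) auto
      finally show ?thesis .
    qed
    have "liminf (\<lambda>n. \<integral>\<^sup>+ y. ennreal (Lp y - LD n y) \<partial>prodM N P)
        \<le> liminf (\<lambda>n. ennreal (Ip - v + A * (1 - measure (prodM N P) (D n)) + 2 * \<epsilon>))"
    proof (intro Liminf_mono always_eventually allI)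
      fix n
      have "(\<integral>\<^sup>+ y. ennreal (Lp y - LD n y) \<partial>prodM N P) = ennreal (Ip - (\<integral>y. LD n y \<partial>prodM N P))"
        using LDi Lpi nn unfolding Ip_def by (subst nn_integral_eq_integral) auto
      also have "\<dots> \<le> ennreal (Ip - v + A * (1 - measure (prodM N P) (D n)) + 2 * \<epsilon>)"
        using LDint[of n] by (intro ennreal_leI) linarith
      finally show "(\<integral>\<^sup>+ y. ennreal (Lp y - LD n y) \<partial>prodM N P) \<le> ennreal (Ip - v + A * (1 - measure (prodM N P) (D n)) + 2 * \<epsilon>)" .
    qed
    also have "\<dots> = ennreal (Ip - v + A * (1 - 1) + 2 * \<epsilon>)"
      by (intro lim_imp_Liminf tendsto_ennrealI tendsto_intros Dlim) simp
    finally have neg: "(\<integral>\<^sup>+ y. ennreal (- L y) \<partial>prodM N P) \<le> ennreal (Ip - v + 2 * \<epsilon>)" using fat by simp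
    have pos: "0 \<le> Ip - v + 2 * \<epsilon>"
    proof (rule LIMSEQ_le_const)
      have "(\<lambda>n. Ip - v + A * (1 - measure (prodM N P) (D n)) + 2 * \<epsilon>) \<longlonglongrightarrow> Ip - v + A * (1 - 1) + 2 * \<epsilon>"
        by (intro tendsto_intros Dlim)
      then show "(\<lambda>n. Ip - v + A * (1 - measure (prodM N P) (D n)) + 2 * \<epsilon>) \<longlonglongrightarrow> Ip - v + 2 * \<epsilon>" by simp
      have "0 \<le> Ip - v + A * (1 - measure (prodM N P) (D n)) + 2 * \<epsilon>" for n
      proof -
        have "0 \<le> (\<integral>y. Lp y - LD n y \<partial>prodM N P)" using nn by (intro integral_nonneg_AE) auto
        also have "\<dots> = Ip - (\<integral>y. LD n y \<partial>prodM N P)" using LDi Lpi by (simp add: Ip_def)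
        finally show ?thesis using LDint[of n] by linarith
      qed
      then show "\<exists>n0. \<forall>n\<ge>n0. 0 \<le> Ip - v + A * (1 - measure (prodM N P) (D n)) + 2 * \<epsilon>" by blast
    qed
    have negfin: "(\<integral>\<^sup>+ y. ennreal (- L y) \<partial>prodM N P) < \<infinity>" using neg by (rule le_less_trans) simp
    have Li: "integrable (prodM N P) L"
      using Lfin negfin by (subst real_integrable_def) auto
    moreover have "(\<integral>y. L y \<partial>prodM N P) = Ip - enn2real (\<integral>\<^sup>+ y. ennreal (- L y) \<partial>prodM N P)"
    proof -
      have "Ip = enn2real (\<integral>\<^sup>+ y. ennreal (Lp y) \<partial>prodM N P)"
        unfolding Ip_def by (rule integral_eq_nn_integral) (use Lpi in \<open>auto simp: Lp_def\<close>)
      also have "(\<integral>\<^sup>+ y. ennreal (Lp y) \<partial>prodM N P) = (\<integral>\<^sup>+ y. ennreal (L y) \<partial>prodM N P)"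
        by (intro nn_integral_cong) (auto simp: Lp_def max_def ennreal_neg)
      finally show ?thesis unfolding real_lebesgue_integral_def[OF Li] by simp
    qed
    moreover have "enn2real (\<integral>\<^sup>+ y. ennreal (- L y) \<partial>prodM N P) \<le> Ip - v + 2 * \<epsilon>"
      using enn2real_mono[OF neg] pos by simp
    ultimately show ?thesis by linarith
  qed
  show "integrable (prodM N P) L" using main[of 1] by simp
  show "v \<le> (\<integral>y. L y \<partial>prodM N P)"
  proof (rule field_le_epsilon)
    fix e :: real assume "0 < e"
    then show "v \<le> (\<integral>y. L y \<partial>prodM N P) + e" using main[of "e / 2"] by simp
  qed
qed

end

section \<open>Tails, growth bounds, first moments and radii\<close>

lemma nn_integral_tail_small:
  assumes "f \<in> borel_measurable M" "(\<integral>\<^sup>+ x. ennreal (f x) \<partial>M) < \<infinity>" "0 < (\<epsilon>::real)"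
  shows "\<exists>A\<ge>0. (\<integral>\<^sup>+ x. ennreal (f x - A) \<partial>M) \<le> ennreal \<epsilon>"
proof -
  note assms(1)[measurable]
  have "(\<lambda>n. \<integral>\<^sup>+ x. ennreal (f x - real n) \<partial>M) \<longlonglongrightarrow> (\<integral>\<^sup>+ x. 0 \<partial>M)"
  proof (rule nn_integral_dominated_convergence[where w = "\<lambda>x. ennreal (f x)"])
    show "AE x in M. (\<lambda>n. ennreal (f x - real n)) \<longlonglongrightarrow> 0"
    proof (rule AE_I2)
      fix x
      obtain n0 :: nat where "f x \<le> real n0" using real_arch_simple by blast
      then have "\<forall>\<^sub>F n in sequentially. ennreal (f x - real n) = 0"
        unfolding eventually_sequentially by (intro exI[of _ n0]) (auto intro!: ennreal_neg)
      then show "(\<lambda>n. ennreal (f x - real n)) \<longlonglongrightarrow> 0" by (rule tendsto_eventually)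
    qed
  qed (use assms in \<open>auto intro!: ennreal_leI\<close>)
  then have "\<forall>\<^sub>F n in sequentially. (\<integral>\<^sup>+ x. ennreal (f x - real n) \<partial>M) < ennreal \<epsilon>"
    using assms(3) by (intro order_tendstoD(2)) auto
  then obtain n where "(\<integral>\<^sup>+ x. ennreal (f x - real n) \<partial>M) < ennreal \<epsilon>"
    by (meson eventually_happens' sequentially_bot)
  then show ?thesis by (intro exI[of _ "real n"]) auto
qed

text \<open>If the newest power is below \<open>s\<close>, the earlier terms add up to no more than
  that power, so the total is at most twice it; otherwise it contributes nothing.\<close>

lemma sum_powers_below:
  fixes s :: real
  assumes "0 \<le> s" shows "(\<Sum>j<n. if 2 ^ j < s then 2 ^ j else 0 :: real) \<le> 2 * s"
proof (induction n)
  case (Suc n)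
  have le: "(\<Sum>j<n. if (2::real) ^ j < s then 2 ^ j else 0 :: real) \<le> 2 ^ n"
  proof (induction n)
    case (Suc n)
    have "(\<Sum>j<Suc n. if (2::real) ^ j < s then 2 ^ j else 0 :: real)
        = (\<Sum>j<n. if (2::real) ^ j < s then 2 ^ j else 0) + (if 2 ^ n < s then 2 ^ n else 0)" by simp
    also have "\<dots> \<le> 2 ^ n + 2 ^ n" using Suc by (intro add_mono) auto
    finally show ?case by simp
  qed simp
  show ?case
  proof (cases "2 ^ n < s")
    case True then show ?thesis using le by simp
  qed (use Suc in simp)
qed (use assms in simp)

context dro
begin

lemma growth_at_z0:
  assumes "xh \<in> tup N X" "x \<in> tup N X"
  shows "costM N c xh x \<le> K * (\<Sum>i<N. cX (xh i) z0) + K * (\<Sum>i<N. cX z0 (x i))"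
proof -
  have "costM N c xh x = (\<Sum>i<N. cX (xh i) (x i))"
    unfolding costM_def using assms by (intro sum.cong) (auto simp: cX_def tup_def PiE_iff)
  also have "\<dots> \<le> (\<Sum>i<N. K * (cX (xh i) z0 + cX z0 (x i)))"
    using assms by (intro sum_mono cX_triangle) (auto simp: tup_def PiE_iff)
  finally show ?thesis by (simp add: sum_distrib_left sum.distrib distrib_left)
qed

lemma l_linear_growth: "\<exists>C\<ge>0. \<forall>x\<in>tup N X. l x \<le> C * (1 + (\<Sum>i<N. cX z0 (x i)))"
proof -
  obtain C xh where C: "C > 0" "xh \<in> tup N X" "\<And>x. x \<in> tup N X \<Longrightarrow> l x \<le> C * (1 + costM N c xh x)"
    using l_growth by (auto simp: growth_def)
  define b where "b = K * (\<Sum>i<N. cX (xh i) z0)"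
  have b: "0 \<le> b" unfolding b_def using K_pos cX_nonneg by (simp add: sum_nonneg)
  have "l x \<le> (C * (1 + b + K)) * (1 + (\<Sum>i<N. cX z0 (x i)))" if x: "x \<in> tup N X" for x
  proof -
    define s where "s = (\<Sum>i<N. cX z0 (x i))"
    have s: "0 \<le> s" unfolding s_def using cX_nonneg by (simp add: sum_nonneg)
    have "1 + costM N c xh x \<le> 1 + (b + K * s)" using growth_at_z0[OF C(2) x] by (simp add: b_def s_def)
    also have "\<dots> \<le> (1 + b + K) * (1 + s)"
    proof -
      have "0 \<le> s + b * s + K" using b s K_pos by simp
      then show ?thesis by (simp add: algebra_simps)
    qed
    finally have "C * (1 + costM N c xh x) \<le> C * ((1 + b + K) * (1 + s))" using C(1) by (intro mult_left_mono) auto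
    then show ?thesis using C(3)[OF x] by (simp add: s_def mult.assoc)
  qed
  then show ?thesis using C(1) b K_pos by (intro exI[of _ "C * (1 + b + K)"]) auto
qed

text \<open>\<open>Y\<close> has law \<open>P\<close> and hence its cost moment; the quasi-triangle
  inequality transfers it to \<open>x\<close> at the price of the transport cost, and
  \<open>lin\<close> converts cost into distance.\<close>

lemma first_moments:
  assumes A: "prob_space A" and x: "x \<in> borel_measurable A" and Y: "Y \<in> measurable A P" "distr A P Y = P"
    and X: "AE w in A. x w \<in> X" "AE w in A. Y w \<in> X"
    and cost: "(\<integral>\<^sup>+ w. ennreal (cX (x w) (Y w)) \<partial>A) \<le> ennreal r" and r: "0 \<le> r"
  shows "(\<integral>\<^sup>+ w. ennreal (cX z0 (x w)) \<partial>A) \<le> ennreal (K * (mom + r))"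
    and "(\<integral>\<^sup>+ w. ennreal (norm (x w - z0)) \<partial>A) \<le> ennreal (lin * (1 + K * (mom + r)))"
proof -
  interpret prob_space A by (rule A)
  note x[measurable]
  have [measurable]: "Y \<in> borel_measurable A" using Y(1) unfolding measurable_cong_sets[OF refl P_sets] .
  have Ym: "(\<integral>\<^sup>+ w. ennreal (cX z0 (Y w)) \<partial>A) = ennreal mom"
  proof -
    have m: "(\<lambda>y. ennreal (cX z0 y)) \<in> borel_measurable (distr A P Y)" by measurable
    show ?thesis using nn_integral_distr[OF Y(1) m] unfolding Y(2) mom(1) by simp
  qed
  have "(\<integral>\<^sup>+ w. ennreal (cX z0 (x w)) \<partial>A) \<le> (\<integral>\<^sup>+ w. ennreal K * (ennreal (cX z0 (Y w)) + ennreal (cX (x w) (Y w))) \<partial>A)"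
  proof (rule nn_integral_mono_AE)
    show "AE w in A. ennreal (cX z0 (x w)) \<le> ennreal K * (ennreal (cX z0 (Y w)) + ennreal (cX (x w) (Y w)))"
      using X
    proof eventually_elim
      case (elim w)
      have "ennreal (cX z0 (x w)) \<le> ennreal (K * (cX z0 (Y w) + cX (x w) (Y w)))"
        using cX_triangle[OF z0 elim] by (intro ennreal_leI) (simp add: cX_sym[of "Y w"])
      then show ?case using K_pos cX_nonneg by (simp add: ennreal_mult ennreal_plus)
    qed
  qed
  also have "\<dots> = ennreal K * (ennreal mom + (\<integral>\<^sup>+ w. ennreal (cX (x w) (Y w)) \<partial>A))"
    by (subst nn_integral_cmult, measurable, subst nn_integral_add) (simp_all add: Ym)
  also have "\<dots> \<le> ennreal K * (ennreal mom + ennreal r)" using cost by (intro mult_left_mono add_left_mono) auto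
  also have "\<dots> = ennreal (K * (mom + r))" using K_pos mom(2) r by (simp add: ennreal_mult ennreal_plus)
  finally show 1: "(\<integral>\<^sup>+ w. ennreal (cX z0 (x w)) \<partial>A) \<le> ennreal (K * (mom + r))" .
  have "(\<integral>\<^sup>+ w. ennreal (norm (x w - z0)) \<partial>A) \<le> (\<integral>\<^sup>+ w. ennreal lin * (1 + ennreal (cX z0 (x w))) \<partial>A)"
  proof (rule nn_integral_mono_AE)
    show "AE w in A. ennreal (norm (x w - z0)) \<le> ennreal lin * (1 + ennreal (cX z0 (x w)))"
      using X(1)
    proof eventually_elim
      case (elim w)
      have "ennreal (norm (x w - z0)) \<le> ennreal (lin * (1 + cX z0 (x w)))" using lin[OF elim] by (rule ennreal_leI)
      then show ?case using lin_pos cX_nonneg by (simp add: ennreal_mult ennreal_plus)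
    qed
  qed
  also have "\<dots> = ennreal lin * (1 + (\<integral>\<^sup>+ w. ennreal (cX z0 (x w)) \<partial>A))"
    by (subst nn_integral_cmult, measurable, subst nn_integral_add) (simp_all add: emeasure_space_1)
  also have "\<dots> \<le> ennreal lin * (1 + ennreal (K * (mom + r)))" using 1 by (intro mult_left_mono add_left_mono) auto
  also have "\<dots> = ennreal (lin * (1 + K * (mom + r)))"
    using lin_pos K_pos mom(2) r by (simp add: ennreal_mult ennreal_plus)
  finally show "(\<integral>\<^sup>+ w. ennreal (norm (x w - z0)) \<partial>A) \<le> ennreal (lin * (1 + K * (mom + r)))" .
qed

text \<open>Pigeonhole over dyadic radii: some radius \<open>R\<close> between \<open>2 ^ k\<close> and \<open>4 ^ k\<close> has
  \<open>R * P(norm > R)\<close> of order \<open>1 / k\<close>, although first moments need not be uniformly integrable.\<close>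

lemma good_radius:
  assumes A: "prob_space A" and x[measurable]: "x \<in> borel_measurable A"
    and mo: "(\<integral>\<^sup>+ w. ennreal (norm (x w - z0)) \<partial>A) \<le> ennreal b" and b: "0 \<le> b"
  shows "\<exists>R\<ge>1. R \<le> 4 ^ k \<and> R * measure A {w \<in> space A. R < norm (x w - z0)} \<le> 2 * b / real (k + 1)"
proof (rule ccontr)
  assume neg: "\<not> ?thesis"
  interpret prob_space A by (rule A)
  define B where "B j = {w \<in> space A. 2 ^ j < norm (x w - z0)}" for j :: nat
  have Bm[measurable]: "B j \<in> sets A" for j unfolding B_def by measurable
  have big: "2 * b / real (k + 1) < 2 ^ j * measure A (B j)" if j: "j \<in> {k..2 * k}" for j
  proof -
    have "(2::real) ^ j \<le> 2 ^ (2 * k)" using j by (intro power_increasing) auto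
    also have "\<dots> = 4 ^ k" by (simp add: power_mult)
    finally show ?thesis using neg one_le_power[of "2::real" j] unfolding B_def by force
  qed
  have ni: "integrable A (\<lambda>w. norm (x w - z0))"
    unfolding integrable_iff_bounded using le_less_trans[OF mo] by simp
  have "(\<integral>w. norm (x w - z0) \<partial>A) \<le> b"
  proof -
    have "ennreal (\<integral>w. norm (x w - z0) \<partial>A) = (\<integral>\<^sup>+ w. ennreal (norm (x w - z0)) \<partial>A)"
      using ni by (intro nn_integral_eq_integral[symmetric]) auto
    also note mo
    finally show ?thesis unfolding ennreal_le_iff[OF b] .
  qed
  \<comment> \<open>There are \<open>k + 1\<close> exponents between \<open>k\<close> and
    \<open>2 * k\<close>. If every radius \<open>2 ^ j\<close> failed, these weighted tail masses
    would add up to more than \<open>2 * b\<close>, yet pointwise they are at most twice the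
    distance.\<close>
  have "2 * b = (\<Sum>j\<in>{k..2 * k}. 2 * b / real (k + 1))" by simp
  also have "\<dots> < (\<Sum>j\<in>{k..2 * k}. 2 ^ j * measure A (B j))"
    by (intro sum_strict_mono big) auto
  also have "\<dots> = (\<integral>w. (\<Sum>j\<in>{k..2 * k}. 2 ^ j * indicator (B j) w) \<partial>A)"
    by (subst Bochner_Integration.integral_sum) (auto simp: less_top[symmetric])
  also have "\<dots> \<le> (\<integral>w. 2 * norm (x w - z0) \<partial>A)"
  proof (rule integral_mono)
    show "integrable A (\<lambda>w. \<Sum>j\<in>{k..2 * k}. 2 ^ j * indicator (B j) w :: real)"
      by (intro Bochner_Integration.integrable_sum) (auto simp: less_top[symmetric])
    show "integrable A (\<lambda>w. 2 * norm (x w - z0))" using ni by simp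
    fix w assume "w \<in> space A"
    then have "(\<Sum>j\<in>{k..2 * k}. 2 ^ j * indicator (B j) w) = (\<Sum>j\<in>{k..2 * k}. if (2::real) ^ j < norm (x w - z0) then 2 ^ j else 0 :: real)"
      by (intro sum.cong) (auto simp: B_def)
    also have "\<dots> \<le> (\<Sum>j<Suc (2 * k). if (2::real) ^ j < norm (x w - z0) then 2 ^ j else 0 :: real)"
      by (intro sum_mono2) auto
    also have "\<dots> \<le> 2 * norm (x w - z0)" by (rule sum_powers_below) simp
    finally show "(\<Sum>j\<in>{k..2 * k}. 2 ^ j * indicator (B j) w :: real) \<le> 2 * norm (x w - z0)" .
  qed
  also have "\<dots> \<le> 2 * b" using \<open>(\<integral>w. norm (x w - z0) \<partial>A) \<le> b\<close> by simp
  finally show False by simp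
qed

section \<open>Limit maps, their push-forward laws, and the lower bound for the product
  value\<close>

lemma cost_midpoint_hull:
  assumes f: "\<And>k. f k \<in> borel_measurable borel" "\<And>k y. f k y \<in> X"
    and b: "\<And>k. m \<le> k \<Longrightarrow> (\<integral>\<^sup>+ y. ennreal (cX (f k y) y) \<partial>P) \<le> ennreal b"
  shows "g \<in> midpoint_hull f m \<Longrightarrow> (\<integral>\<^sup>+ y. ennreal (cX (g y) y) \<partial>P) \<le> ennreal b"
proof (induction rule: midpoint_hull.induct)
  case (mid g h)
  have [measurable]: "g \<in> borel_measurable borel" "h \<in> borel_measurable borel"
    using mid midpoint_hull_measurable[OF f(1)] by auto
  have gX: "g y \<in> X" "h y \<in> X" for y using mid midpoint_hull_mem[where y = y and f = f, OF X_convex f(2)] by auto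
  have "(\<integral>\<^sup>+ y. ennreal (cX ((1/2) *\<^sub>R (g y + h y)) y) \<partial>P)
      \<le> (\<integral>\<^sup>+ y. ennreal (1/2) * (ennreal (cX (g y) y) + ennreal (cX (h y) y)) \<partial>P)"
  proof (rule nn_integral_mono_AE)
    show "AE y in P. ennreal (cX ((1/2) *\<^sub>R (g y + h y)) y) \<le> ennreal (1/2) * (ennreal (cX (g y) y) + ennreal (cX (h y) y))"
      using P_X
    proof eventually_elim
      case (elim y)
      have "cX ((1/2) *\<^sub>R g y + (1/2) *\<^sub>R h y) y \<le> (1/2) * cX (g y) y + (1/2) * cX (h y) y"
        by (intro cX_convex[OF elim, unfolded convex_on_def, THEN conjunct2, rule_format] gX) auto
      then have "ennreal (cX ((1/2) *\<^sub>R (g y + h y)) y) \<le> ennreal ((1/2) * (cX (g y) y + cX (h y) y))"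
        by (intro ennreal_leI) (simp add: scaleR_add_right)
      also have "\<dots> = ennreal (1/2) * (ennreal (cX (g y) y) + ennreal (cX (h y) y))"
        using cX_nonneg by (simp only: ennreal_mult ennreal_plus add_nonneg_nonneg)
      finally show ?case .
    qed
  qed
  also have "\<dots> = ennreal (1/2) * ((\<integral>\<^sup>+ y. ennreal (cX (g y) y) \<partial>P) + (\<integral>\<^sup>+ y. ennreal (cX (h y) y) \<partial>P))"
    by (subst nn_integral_cmult, measurable, subst nn_integral_add) simp_all
  also have "\<dots> \<le> ennreal (1/2) * (ennreal b + ennreal b)" using mid by (intro mult_left_mono add_mono) auto
  also have "\<dots> = ennreal b"
  proof (cases "0 \<le> b")
    case True
    then have "ennreal (1/2) * (ennreal b + ennreal b) = ennreal ((1/2) * (b + b))"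
      by (simp only: ennreal_mult ennreal_plus add_nonneg_nonneg)
    then show ?thesis by simp
  qed (simp add: ennreal_neg)
  finally show ?case .
qed (use b in auto)

lemma cX_lsc_liminf:
  assumes "y \<in> X" "x \<in> X" "\<And>n. s n \<in> X" "s \<longlonglongrightarrow> x"
  shows "ennreal (cX x y) \<le> liminf (\<lambda>n. ennreal (cX (s n) y))"
  unfolding le_Liminf_iff
proof (intro allI impI)
  fix t assume t: "t < ennreal (cX x y)"
  then have fin: "t = ennreal (enn2real t)" by (metis ennreal_enn2real less_top order_less_le_trans top_greatest)
  have lt: "enn2real t < cX x y" using t fin cX_nonneg by (metis enn2real_nonneg ennreal_less_iff)
  obtain U where U: "open U" "\<And>z. z \<in> X \<times> X \<Longrightarrow> - cX (fst z) (snd z) < - enn2real t \<longleftrightarrow> z \<in> U"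
    using usc_on_open[OF cX_usc] by blast
  have "(x, y) \<in> U" using U(2)[of "(x, y)"] lt assms by simp
  moreover have "(\<lambda>n. (s n, y)) \<longlonglongrightarrow> (x, y)" using assms(4) by (intro tendsto_intros)
  ultimately have "\<forall>\<^sub>F n in sequentially. (s n, y) \<in> U" using U(1) topological_tendstoD by blast
  then show "\<forall>\<^sub>F n in sequentially. t < ennreal (cX (s n) y)"
  proof eventually_elim
    case (elim n)
    then have "enn2real t < cX (s n) y" using U(2)[of "(s n, y)"] assms by simp
    then show ?case using fin by (metis enn2real_nonneg ennreal_less_iff)
  qed
qed

text \<open>The graph coupling, the law of \<open>(fs y, y)\<close> under \<open>P\<close>, has
  exactly the assumed cost; the moment condition comes from \<open>first_moments\<close>.\<close>

lemma pushforward_in_ball: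
  assumes fs[measurable]: "fs \<in> borel_measurable borel" and fsX: "\<And>y. fs y \<in> X"
    and cost: "(\<integral>\<^sup>+ y. ennreal (cX (fs y) y) \<partial>P) \<le> ennreal \<rho>"
  shows "distr P borel fs \<in> OTball borel X c \<rho> P"
proof -
  interpret P: prob_space P by (rule P_prob)
  define Q where "Q = distr P borel fs"
  have fsP: "fs \<in> measurable P borel" using fs by measurable
  have sQ[measurable_cong]: "sets Q = sets borel" by (simp add: Q_def)
  have QX: "AE x in Q. x \<in> X" unfolding Q_def by (subst AE_distr_iff[OF fsP]) (auto simp: fsX X_closed)
  have "emeasure Q X = 1"
  proof -
    have "fs -` X \<inter> space P = space P" using fsX by auto
    then show ?thesis unfolding Q_def using P.emeasure_space_1 by (subst emeasure_distr[OF fsP X_sets]) simp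
  qed
  then have "Q \<in> probs_on borel X" using P.prob_space_distr[OF fsP] by (simp add: probs_on_def Q_def)
  moreover have "finite_moment c X Q"
  proof -
    have idP: "(\<lambda>y. y) \<in> measurable P P" by simp
    have "(\<integral>\<^sup>+ x. ennreal (c z0 x) \<partial>Q) = (\<integral>\<^sup>+ x. ennreal (cX z0 x) \<partial>Q)"
      using QX by (intro nn_integral_cong_AE) (auto simp: cX_def elim!: eventually_mono)
    also have "\<dots> = (\<integral>\<^sup>+ y. ennreal (cX z0 (fs y)) \<partial>P)" unfolding Q_def by (subst nn_integral_distr) auto
    also have "\<dots> \<le> ennreal (K * (mom + \<rho>))"
      by (rule first_moments(1)[OF P_prob fsP idP _ _ P_X cost]) (use fsX \<rho>_pos in \<open>auto simp: distr_id2\<close>)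
    also have "\<dots> < \<infinity>" by simp
    finally show ?thesis unfolding finite_moment_def by (intro bexI[of _ z0]) auto
  qed
  moreover have "OT c Q P \<le> ennreal \<rho>"
  proof -
    define \<pi> where "\<pi> = distr P (borel \<Otimes>\<^sub>M borel) (\<lambda>y. (fs y, y))"
    have pm[measurable]: "(\<lambda>y. (fs y, y)) \<in> measurable P (borel \<Otimes>\<^sub>M borel)" by measurable
    have "distr \<pi> Q fst = distr P Q fs" unfolding \<pi>_def by (subst distr_distr) (auto simp: comp_def)
    also have "\<dots> = Q" unfolding Q_def by (intro distr_cong) auto
    finally have 1: "distr \<pi> Q fst = Q" .
    have sm: "snd \<in> measurable (borel \<Otimes>\<^sub>M borel) P" by measurable
    have "distr \<pi> P snd = distr P P (\<lambda>y. y)" unfolding \<pi>_def by (subst distr_distr[OF sm pm]) (simp add: comp_def)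
    then have 2: "distr \<pi> P snd = P" by (simp add: distr_id2)
    have 3: "sets \<pi> = sets (Q \<Otimes>\<^sub>M P)" unfolding \<pi>_def by (simp cong: sets_pair_measure_cong add: sets_pair_measure_cong[OF sQ P_sets])
    have "\<pi> \<in> couplings Q P" using 1 2 3 by (simp add: couplings_def)
    then have "OT c Q P \<le> (\<integral>\<^sup>+ z. ennreal (c (fst z) (snd z)) \<partial>\<pi>)" unfolding OT_def by (rule INF_lower)
    also have "\<dots> = (\<integral>\<^sup>+ z. ennreal (cX (fst z) (snd z)) \<partial>\<pi>)"
    proof (rule nn_integral_cong_AE)
      have XX: "{z \<in> space (borel \<Otimes>\<^sub>M borel). z \<in> X \<times> X} \<in> sets (borel \<Otimes>\<^sub>M borel)" by measurable
      have "AE z in \<pi>. z \<in> X \<times> X"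
        unfolding \<pi>_def using P_X fsX by (subst AE_distr_iff[OF pm XX]) auto
      then show "AE z in \<pi>. ennreal (c (fst z) (snd z)) = ennreal (cX (fst z) (snd z))"
        by eventually_elim (auto simp: cX_def)
    qed
    also have "\<dots> = (\<integral>\<^sup>+ y. ennreal (cX (fs y) y) \<partial>P)"
      unfolding \<pi>_def by (subst nn_integral_distr[OF pm]) auto
    finally show ?thesis using cost by simp
  qed
  ultimately show ?thesis by (simp add: OTball_def Q_def)
qed

text \<open>Applying \<open>fs\<close> in every coordinate maps the product of \<open>P\<close> to
  the product of its image, so the integral is the value of an admissible competitor in
  \<open>S_val\<close>.\<close>

lemma S_val_ge_pushforward:
  assumes fs[measurable]: "fs \<in> borel_measurable borel" and fsX: "\<And>y. fs y \<in> X"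
    and cost: "(\<integral>\<^sup>+ y. ennreal (cX (fs y) y) \<partial>P) \<le> ennreal \<rho>"
    and L: "integrable (prodM N P) (\<lambda>y. lX (restrict (\<lambda>i. fs (y i)) {..<N}))"
  shows "ereal (\<integral>y. lX (restrict (\<lambda>i. fs (y i)) {..<N}) \<partial>prodM N P) \<le> S_val X c \<rho> P N l"
proof -
  interpret P: prob_space P by (rule P_prob)
  define Q where "Q = distr P borel fs"
  have fsP: "fs \<in> measurable P Q" unfolding Q_def by measurable
  have fsPb: "fs \<in> measurable P borel" by measurable
  have sQ: "sets Q = sets borel" by (simp add: Q_def)
  have pQ: "prob_space Q" unfolding Q_def by (rule P.prob_space_distr[OF fsPb])
  have "distr P Q fs = Q" unfolding Q_def by (intro distr_cong) auto
  then have d: "distr (prodM N P) (prodM N Q) (compose {..<N} fs) = prodM N Q"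
    unfolding prodM_def using fsP P_prob pQ
    by (subst distr_PiM_finite_prob_space') auto
  have cm: "compose {..<N} fs \<in> measurable (prodM N P) (prodM N Q)"
    unfolding prodM_def compose_def using fsP
    by (intro measurable_restrict measurable_compose[where N = P, OF _ fsP] measurable_component_singleton)
  have lm: "lX \<in> borel_measurable (prodM N Q)" unfolding measurable_cong_sets[OF sets_prodM[OF sQ] refl] by measurable
  have co: "compose {..<N} fs y = restrict (\<lambda>i. fs (y i)) {..<N}" for y by (simp add: compose_def)
  have "integrable (distr (prodM N P) (prodM N Q) (compose {..<N} fs)) lX"
    using L by (subst integrable_distr_eq[OF cm lm]) (simp add: co)
  then have li: "integrable (prodM N Q) lX" unfolding d .
  have "(\<integral>x. lX x \<partial>distr (prodM N P) (prodM N Q) (compose {..<N} fs)) = (\<integral>y. lX (restrict (\<lambda>i. fs (y i)) {..<N}) \<partial>prodM N P)"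
    by (subst integral_distr[OF cm lm]) (simp add: co)
  then have "ereal (\<integral>y. lX (restrict (\<lambda>i. fs (y i)) {..<N}) \<partial>prodM N P) = ext_integral (prodM N Q) lX"
    unfolding d using ext_integral_eq[OF li] by simp
  also have "\<dots> = Exp_on (tup N X) (prodM N Q) l" by (simp add: Exp_on_def lX_def[abs_def])
  also have "\<dots> \<le> S_val X c \<rho> P N l"
    unfolding S_val_def Q_def by (rule SUP_upper[OF pushforward_in_ball[OF fs fsX cost]])
  finally show ?thesis .
qed


text \<open>The common upper bound behind both claims, which differ only in where the plans and the
  uniform tail condition \<open>ui\<close> come from. The radii, the barycentric maps and their
  limit are constructed here.\<close>

theorem plans_le_S_val:
  fixes \<mu> :: "nat \<Rightarrow> ((nat \<Rightarrow> 'a) \<times> (nat \<Rightarrow> 'a)) measure"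
  assumes plan: "\<And>k. exch_plan X P (M k) (\<mu> k)" and M: "\<And>k. 4096 ^ k * N \<le> M k"
    and cost: "\<And>k. (\<integral>\<^sup>+ z. ennreal (cX (fst z 0) (snd z 0)) \<partial>\<mu> k) \<le> ennreal (\<rho> + 1 / real (k + 1))"
    and li: "\<And>k. integrable (\<mu> k) (\<lambda>z. lX (prN N (fst z)))" "\<And>k. v \<le> (\<integral>z. lX (prN N (fst z)) \<partial>\<mu> k)"
    and ui: "\<And>\<epsilon>::real. 0 < \<epsilon> \<Longrightarrow> \<exists>A\<ge>0. \<forall>k. (\<integral>\<^sup>+ z. ennreal (lX (prN N (fst z)) - A) \<partial>\<mu> k) \<le> ennreal \<epsilon>"
  shows "ereal v \<le> S_val X c \<rho> P N l"
proof -
  interpret P: prob_space P by (rule P_prob)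
  have idP: "(\<lambda>y. y) \<in> measurable P P" by simp
  have M0: "0 < M k" for k
  proof -
    have "1 * 1 \<le> 4096 ^ k * N" using N_pos by (intro mult_le_mono) auto
    then show ?thesis using M[of k] by linarith
  qed
  note pf = plan_facts[OF plan]
  note xm = plan_measurable(1)[OF pf(2) M0] and ym = plan_measurable(2)[OF pf(2) M0]
    and yP = plan_measurable(3)[OF pf(2) M0]
  define b where "b = lin * (1 + K * (mom + (\<rho> + 1)))"
  have b0: "0 \<le> b" unfolding b_def using lin_pos K_pos mom(2) \<rho>_pos by simp
  have cost1: "(\<integral>\<^sup>+ z. ennreal (cX (fst z 0) (snd z 0)) \<partial>\<mu> k) \<le> ennreal (\<rho> + 1)" for k
    by (rule order_trans[OF cost]) (auto intro!: ennreal_leI)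
  have mo: "(\<integral>\<^sup>+ z. ennreal (norm (fst z 0 - z0)) \<partial>\<mu> k) \<le> ennreal b" for k
    unfolding b_def
    by (rule first_moments(2)[OF pf(1) xm yP pf(3)[OF M0] pf(4)[OF M0] pf(5)[OF M0] cost1]) (use \<rho>_pos in simp)
  have "\<exists>R. \<forall>k. 1 \<le> R k \<and> R k \<le> 4 ^ k \<and>
      R k * measure (\<mu> k) {z \<in> space (\<mu> k). R k < norm (fst z 0 - z0)} \<le> 2 * b / real (k + 1)"
    by (intro choice allI) (use good_radius[OF pf(1) xm mo b0] in blast)
  then obtain R where R: "\<And>k. 1 \<le> R k" "\<And>k. R k \<le> 4 ^ k"
    and bad: "\<And>k. R k * measure (\<mu> k) {z \<in> space (\<mu> k). R k < norm (fst z 0 - z0)} \<le> 2 * b / real (k + 1)"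
    by blast
  have R0: "0 \<le> R k" for k using R(1)[of k] by simp
  have "\<exists>f. \<forall>k. f k \<in> borel_measurable borel \<and> (\<forall>y. f k y \<in> X \<inter> cball z0 (R k)) \<and>
    (\<forall>p. cond_exp_fun (\<mu> k) P (\<lambda>z. snd z 0) (\<lambda>z. p \<bullet> trunc (R k) (fst z 0)) (\<lambda>y. p \<bullet> f k y)) \<and>
    (\<integral>\<^sup>+ y. ennreal (cX (f k y) y) \<partial>P) \<le> (\<integral>\<^sup>+ z. ennreal (cX (trunc (R k) (fst z 0)) (snd z 0)) \<partial>\<mu> k)"
    by (intro choice allI truncated_barycenter[OF plan M0 R0])
  then obtain f where f: "\<And>k. f k \<in> borel_measurable borel" "\<And>k y. f k y \<in> X \<inter> cball z0 (R k)"
      "\<And>k p. cond_exp_fun (\<mu> k) P (\<lambda>z. snd z 0) (\<lambda>z. p \<bullet> trunc (R k) (fst z 0)) (\<lambda>y. p \<bullet> f k y)"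
    and fcost: "\<And>k. (\<integral>\<^sup>+ y. ennreal (cX (f k y) y) \<partial>P) \<le> (\<integral>\<^sup>+ z. ennreal (cX (trunc (R k) (fst z 0)) (snd z 0)) \<partial>\<mu> k)"
    by blast
  have fX: "f k y \<in> X" for k y using f(2) by blast
  define G where "G k = {z \<in> space (\<mu> k). R k < norm (fst z 0 - z0)}" for k
  have Gm[measurable]: "G k \<in> sets (\<mu> k)" for k
  proof -
    note xm[measurable]
    show ?thesis unfolding G_def by measurable
  qed
  have G: "measure (\<mu> k) (G k) \<le> 2 * b / real (k + 1)" for k
  proof -
    have "1 * measure (\<mu> k) (G k) \<le> R k * measure (\<mu> k) (G k)" using R(1) by (intro mult_right_mono) auto
    then show ?thesis using bad[of k] by (simp add: G_def)
  qed
  have Ylaw: "(\<integral>\<^sup>+ z. h (snd z 0) \<partial>\<mu> k) = (\<integral>\<^sup>+ y. h y \<partial>P)" if h: "h \<in> borel_measurable borel" for h :: "'a \<Rightarrow> ennreal" and k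
  proof -
    have "h \<in> borel_measurable (distr (\<mu> k) P (\<lambda>z. snd z 0))" using h by (simp add: measurable_cong_sets[OF P_sets refl])
    from nn_integral_distr[OF yP this] show ?thesis unfolding pf(3)[OF M0] by simp
  qed
  \<comment> \<open>Truncation changes the cost only on \<open>G k\<close>, where the pair becomes
    \<open>(z0, y)\<close>.\<close>
  have tcost: "(\<integral>\<^sup>+ y. ennreal (cX (f k y) y) \<partial>P)
      \<le> ennreal (\<rho> + 1 / real (k + 1)) + (\<integral>\<^sup>+ z. indicator (G k) z * ennreal (cX z0 (snd z 0)) \<partial>\<mu> k)" for k
  proof -
    note [measurable] = xm[of k] ym[of k]
    have "(\<integral>\<^sup>+ z. ennreal (cX (trunc (R k) (fst z 0)) (snd z 0)) \<partial>\<mu> k)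
        \<le> (\<integral>\<^sup>+ z. ennreal (cX (fst z 0) (snd z 0)) + indicator (G k) z * ennreal (cX z0 (snd z 0)) \<partial>\<mu> k)"
    proof (rule nn_integral_mono_AE)
      show "AE z in \<mu> k. ennreal (cX (trunc (R k) (fst z 0)) (snd z 0))
          \<le> ennreal (cX (fst z 0) (snd z 0)) + indicator (G k) z * ennreal (cX z0 (snd z 0))"
        using pf(4)[OF M0, of k] AE_space
        by eventually_elim (auto simp: trunc_def G_def split: split_indicator)
    qed
    also have "\<dots> = (\<integral>\<^sup>+ z. ennreal (cX (fst z 0) (snd z 0)) \<partial>\<mu> k) + (\<integral>\<^sup>+ z. indicator (G k) z * ennreal (cX z0 (snd z 0)) \<partial>\<mu> k)"
      by (rule nn_integral_add) measurable
    also have "\<dots> \<le> ennreal (\<rho> + 1 / real (k + 1)) + (\<integral>\<^sup>+ z. indicator (G k) z * ennreal (cX z0 (snd z 0)) \<partial>\<mu> k)"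
      by (intro add_right_mono cost)
    finally show ?thesis using fcost[of k] by (rule order_trans[rotated])
  qed
  \<comment> \<open>A crude bound for all \<open>k\<close>, from which the maps get bounded first
    moments; \<open>tail\<close> sharpens it to \<open>\<rho>\<close> in the limit.\<close>
  have ubound: "(\<integral>\<^sup>+ y. ennreal (cX (f k y) y) \<partial>P) \<le> ennreal (\<rho> + 1 + mom)" for k
  proof -
    have "(\<integral>\<^sup>+ z. indicator (G k) z * ennreal (cX z0 (snd z 0)) \<partial>\<mu> k) \<le> (\<integral>\<^sup>+ z. ennreal (cX z0 (snd z 0)) \<partial>\<mu> k)"
      by (intro nn_integral_mono) (auto split: split_indicator)
    also have "\<dots> = ennreal mom" using Ylaw[of "\<lambda>y. ennreal (cX z0 y)" k] mom(1) by simp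
    finally have "(\<integral>\<^sup>+ y. ennreal (cX (f k y) y) \<partial>P) \<le> ennreal (\<rho> + 1 / real (k + 1)) + ennreal mom"
      using tcost[of k] add_left_mono order_trans by blast
    also have "\<dots> = ennreal (\<rho> + 1 / real (k + 1) + mom)" using \<rho>_pos mom(2) by (simp add: ennreal_plus)
    also have "\<dots> \<le> ennreal (\<rho> + 1 + mom)" by (intro ennreal_leI) simp
    finally show ?thesis .
  qed
  \<comment> \<open>The reference point always has law \<open>P\<close>, so \<open>cX z0 y\<close>
    is uniformly integrable along the sequence and the vanishing events \<open>G k\<close> carry
    vanishing cost. Its excess over \<open>A\<close> uses up \<open>\<epsilon> / 2\<close>; the rest
    is of order \<open>1 / k\<close>.\<close>
  have tail: "\<exists>k0. \<forall>k\<ge>k0. (\<integral>\<^sup>+ y. ennreal (cX (f k y) y) \<partial>P) \<le> ennreal (\<rho> + \<epsilon>)" if eps: "0 < \<epsilon>" for \<epsilon>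
  proof -
    obtain A where A: "0 \<le> A" "(\<integral>\<^sup>+ y. ennreal (cX z0 y - A) \<partial>P) \<le> ennreal (\<epsilon> / 2)"
      using nn_integral_tail_small[of "cX z0" P "\<epsilon> / 2"] moment_at[OF z0] eps by auto
    have "(\<lambda>k. (1 + A * (2 * b)) / real (k + 1)) \<longlonglongrightarrow> 0"
      using LIMSEQ_ignore_initial_segment[OF lim_const_over_n[of "1 + A * (2 * b)"], of 1] by simp
    then have "eventually (\<lambda>k. (1 + A * (2 * b)) / real (k + 1) < \<epsilon> / 2) sequentially"
      using eps by (intro order_tendstoD) auto
    then obtain k0 where k0: "\<And>k. k0 \<le> k \<Longrightarrow> (1 + A * (2 * b)) / real (k + 1) < \<epsilon> / 2"
      by (auto simp: eventually_sequentially)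
    have "(\<integral>\<^sup>+ y. ennreal (cX (f k y) y) \<partial>P) \<le> ennreal (\<rho> + \<epsilon>)" if k: "k0 \<le> k" for k
    proof -
      interpret mu: prob_space "\<mu> k" by (rule pf(1))
      note [measurable] = xm[of k] ym[of k]
      have "(\<integral>\<^sup>+ z. indicator (G k) z * ennreal (cX z0 (snd z 0)) \<partial>\<mu> k)
          \<le> (\<integral>\<^sup>+ z. ennreal A * indicator (G k) z + ennreal (cX z0 (snd z 0) - A) \<partial>\<mu> k)"
      proof (rule nn_integral_mono)
        fix z :: "(nat \<Rightarrow> 'a) \<times> (nat \<Rightarrow> 'a)"
        have "ennreal (cX z0 (snd z 0)) \<le> ennreal A + ennreal (cX z0 (snd z 0) - A)"
        proof (cases "cX z0 (snd z 0) \<le> A")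
          case True then show ?thesis by (intro add_increasing2) (auto intro: ennreal_leI)
        next
          case False then show ?thesis using A(1) by (simp add: ennreal_plus[symmetric] del: ennreal_plus)
        qed
        then show "indicator (G k) z * ennreal (cX z0 (snd z 0)) \<le> ennreal A * indicator (G k) z + ennreal (cX z0 (snd z 0) - A)"
          by (simp split: split_indicator)
      qed
      also have "\<dots> = ennreal A * emeasure (\<mu> k) (G k) + (\<integral>\<^sup>+ z. ennreal (cX z0 (snd z 0) - A) \<partial>\<mu> k)"
        by (subst nn_integral_add) (auto simp: nn_integral_cmult)
      also have "\<dots> \<le> ennreal A * ennreal (2 * b / real (k + 1)) + ennreal (\<epsilon> / 2)"
      proof (intro add_mono mult_left_mono)
        show "(\<integral>\<^sup>+ z. ennreal (cX z0 (snd z 0) - A) \<partial>\<mu> k) \<le> ennreal (\<epsilon> / 2)"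
          using Ylaw[of "\<lambda>y. ennreal (cX z0 y - A)" k] A(2) by simp
        show "emeasure (\<mu> k) (G k) \<le> ennreal (2 * b / real (k + 1))"
          unfolding mu.emeasure_eq_measure using G by (rule ennreal_leI)
      qed simp
      also have "\<dots> = ennreal (A * (2 * b / real (k + 1)) + \<epsilon> / 2)"
        using A(1) b0 eps by (simp add: ennreal_mult[symmetric] ennreal_plus[symmetric] del: ennreal_plus)
      finally have "(\<integral>\<^sup>+ y. ennreal (cX (f k y) y) \<partial>P)
          \<le> ennreal (\<rho> + 1 / real (k + 1)) + ennreal (A * (2 * b / real (k + 1)) + \<epsilon> / 2)"
        by (intro order_trans[OF tcost[of k]] add_left_mono)
      also have "\<dots> = ennreal (\<rho> + ((1 + A * (2 * b)) / real (k + 1)) + \<epsilon> / 2)"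
        using \<rho>_pos A(1) b0 eps by (subst ennreal_plus[symmetric]) (auto simp: add_divide_distrib algebra_simps)
      also have "\<dots> \<le> ennreal (\<rho> + \<epsilon>)"
      proof (rule ennreal_leI)
        have "\<rho> + x + \<epsilon> / 2 \<le> \<rho> + \<epsilon>" if "x < \<epsilon> / 2" for x using that by linarith
        from this[OF k0[OF k]] show "\<rho> + (1 + A * (2 * b)) / real (k + 1) + \<epsilon> / 2 \<le> \<rho> + \<epsilon>" .
      qed
      finally show ?thesis .
    qed
    then show ?thesis by blast
  qed
  have fP: "f k \<in> borel_measurable P" for k unfolding measurable_cong_sets[OF P_sets refl] by (rule f(1))
  define C where "C = lin * (1 + K * (mom + (\<rho> + 1 + mom)))"
  have C0: "0 \<le> C" unfolding C_def using lin_pos K_pos mom(2) \<rho>_pos by simp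
  have nfi: "integrable P (\<lambda>y. norm (f k y - z0))" for k
  proof (rule P.integrable_const_bound[where B = "R k"])
    show "AE y in P. norm (norm (f k y - z0)) \<le> R k"
      using f(2)[of k] by (intro AE_I2) (auto simp: dist_norm norm_minus_commute)
  qed (use fP in measurable)
  have nfb: "(\<integral>y. norm (f k y - z0) \<partial>P) \<le> C" for k
  proof -
    have "ennreal (\<integral>y. norm (f k y - z0) \<partial>P) = (\<integral>\<^sup>+ y. ennreal (norm (f k y - z0)) \<partial>P)"
      using nfi by (intro nn_integral_eq_integral[symmetric]) auto
    also have "\<dots> \<le> ennreal C"
      unfolding C_def
      by (rule first_moments(2)[OF P_prob fP idP _ _ P_X ubound])
         (use fX \<rho>_pos mom(2) in \<open>auto simp: distr_id2\<close>)
    finally show ?thesis unfolding ennreal_le_iff[OF C0] .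
  qed
  have ni: "integrable P (\<lambda>y. norm (f k y))" "(\<integral>y. norm (f k y) \<partial>P) \<le> C + norm z0" for k
  proof -
    have le: "norm (f k y) \<le> norm (f k y - z0) + norm z0" for y using norm_triangle_sub[of "f k y" z0] by simp
    have i: "integrable P (\<lambda>y. norm (f k y - z0) + norm z0)" using nfi by simp
    show j: "integrable P (\<lambda>y. norm (f k y))"
      by (rule Bochner_Integration.integrable_bound[OF i]) (use fP le in auto)
    have "(\<integral>y. norm (f k y) \<partial>P) \<le> (\<integral>y. norm (f k y - z0) + norm z0 \<partial>P)"
      by (rule integral_mono[OF j i le])
    also have "\<dots> = (\<integral>y. norm (f k y - z0) \<partial>P) + norm z0" using nfi P.prob_space by simp
    finally show "(\<integral>y. norm (f k y) \<partial>P) \<le> C + norm z0" using nfb[of k] by linarith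
  qed
  obtain g where g: "\<And>n. g n \<in> midpoint_hull f n" and gc: "AE y in P. convergent (\<lambda>n. g n y)"
    by (rule midpoint_hull_convergent[OF P.finite_measure_axioms fP ni]) (rule that)
  have gm[measurable]: "g n \<in> borel_measurable borel" for n using midpoint_hull_measurable[OF f(1) g] .
  have gX: "g n y \<in> X" for n y using midpoint_hull_mem[where f = f and y = y, OF X_convex fX g] .
  \<comment> \<open>Where the sequence diverges, \<open>lim\<close> is arbitrary; the default
    \<open>z0\<close> keeps all values in \<open>X\<close>.\<close>
  define fs where "fs y = (let h = lim (\<lambda>n. g n y) in if h \<in> X then h else z0)" for y
  have fsm: "fs \<in> borel_measurable borel"
  proof -
    have [measurable]: "(\<lambda>y. lim (\<lambda>n. g n y)) \<in> borel_measurable borel" by (rule borel_measurable_lim_metric[OF gm])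
    show ?thesis unfolding fs_def Let_def by measurable
  qed
  have fsX: "fs y \<in> X" for y by (simp add: fs_def Let_def)
  have lim: "AE y in P. (\<lambda>n. g n y) \<longlonglongrightarrow> fs y"
    using gc
  proof eventually_elim
    case (elim y)
    then have l: "(\<lambda>n. g n y) \<longlonglongrightarrow> lim (\<lambda>n. g n y)" by (simp add: convergent_LIMSEQ_iff)
    then have "lim (\<lambda>n. g n y) \<in> X" by (rule closed_sequentially[OF X_closed gX])
    then show ?case using l by (simp add: fs_def Let_def)
  qed
  \<comment> \<open>Lower semi-continuity and Fatou. Since \<open>g n\<close> mixes only maps of
    index at least \<open>n\<close>, the bound \<open>\<rho> + e\<close> for large indices passes to
    it by convexity.\<close>
  have fscost: "(\<integral>\<^sup>+ y. ennreal (cX (fs y) y) \<partial>P) \<le> ennreal \<rho>"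
  proof (rule ennreal_le_epsilon)
    fix e :: real assume e: "0 < e"
    obtain k0 where k0: "\<And>k. k0 \<le> k \<Longrightarrow> (\<integral>\<^sup>+ y. ennreal (cX (f k y) y) \<partial>P) \<le> ennreal (\<rho> + e)"
      using tail[OF e] by blast
    have "(\<integral>\<^sup>+ y. ennreal (cX (fs y) y) \<partial>P) \<le> (\<integral>\<^sup>+ y. liminf (\<lambda>n. ennreal (cX (g n y) y)) \<partial>P)"
    proof (rule nn_integral_mono_AE)
      show "AE y in P. ennreal (cX (fs y) y) \<le> liminf (\<lambda>n. ennreal (cX (g n y) y))"
        using lim P_X by eventually_elim (rule cX_lsc_liminf[OF _ fsX gX])
    qed
    also have "\<dots> \<le> liminf (\<lambda>n. \<integral>\<^sup>+ y. ennreal (cX (g n y) y) \<partial>P)" by (rule nn_integral_liminf) measurable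
    also have "\<dots> \<le> liminf (\<lambda>n. ennreal (\<rho> + e))"
    proof (rule Liminf_mono)
      show "\<forall>\<^sub>F n in sequentially. (\<integral>\<^sup>+ y. ennreal (cX (g n y) y) \<partial>P) \<le> ennreal (\<rho> + e)"
        unfolding eventually_sequentially
        by (intro exI[of _ k0] allI impI cost_midpoint_hull[OF f(1) fX _ g] k0) (erule order_trans)
    qed
    also have "\<dots> = ennreal \<rho> + ennreal e" using e \<rho>_pos by (simp add: Liminf_const ennreal_plus)
    finally show "(\<integral>\<^sup>+ y. ennreal (cX (fs y) y) \<partial>P) \<le> ennreal \<rho> + ennreal e" .
  qed
  have Lfin: "(\<integral>\<^sup>+ y. ennreal (lX (restrict (\<lambda>i. fs (y i)) {..<N})) \<partial>prodM N P) < \<infinity>"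
  proof -
    interpret pN: prob_space "prodM N P" by (rule prob_space_prodM[OF P_prob])
    obtain C' where C': "0 \<le> C'" "\<And>x. x \<in> tup N X \<Longrightarrow> l x \<le> C' * (1 + (\<Sum>i<N. cX z0 (x i)))"
      using l_linear_growth by blast
    have fsP: "fs \<in> borel_measurable P" unfolding measurable_cong_sets[OF P_sets refl] by (rule fsm)
    have m1: "(\<integral>\<^sup>+ y. ennreal (cX z0 (fs y)) \<partial>P) \<le> ennreal (K * (mom + \<rho>))"
      by (rule first_moments(1)[OF P_prob fsP idP _ _ P_X fscost])
         (use fsX \<rho>_pos fscost in \<open>auto simp: distr_id2\<close>)
    have hm: "(\<lambda>y. ennreal (cX z0 (fs y))) \<in> borel_measurable P" using fsP by measurable
    have cm: "(\<lambda>y. y i) \<in> measurable (prodM N P) P" if "i < N" for i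
      unfolding prodM_def using that by (intro measurable_component_singleton) simp
    have mi: "(\<integral>\<^sup>+ y. ennreal (cX z0 (fs (y i))) \<partial>prodM N P) = (\<integral>\<^sup>+ y. ennreal (cX z0 (fs y)) \<partial>P)" if i: "i < N" for i
    proof -
      have "distr (prodM N P) P (\<lambda>y. y i) = P"
        unfolding prodM_def using i P_prob by (intro distr_PiM_component) auto
      then show ?thesis using nn_integral_distr[OF cm[OF i], of "\<lambda>y. ennreal (cX z0 (fs y))"] hm by simp
    qed
    have "(\<integral>\<^sup>+ y. ennreal (lX (restrict (\<lambda>i. fs (y i)) {..<N})) \<partial>prodM N P)
        \<le> (\<integral>\<^sup>+ y. ennreal C' * (1 + (\<Sum>i<N. ennreal (cX z0 (fs (y i))))) \<partial>prodM N P)"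
    proof (rule nn_integral_mono)
      fix y
      define w where "w = restrict (\<lambda>i. fs (y i)) {..<N}"
      have w: "w \<in> tup N X" using fsX by (auto simp: w_def tup_def)
      have "ennreal (lX w) \<le> ennreal (C' * (1 + (\<Sum>i<N. cX z0 (fs (y i)))))"
        using C'(2)[OF w] w by (intro ennreal_leI) (simp add: lX_def w_def)
      also have "\<dots> = ennreal C' * (1 + (\<Sum>i<N. ennreal (cX z0 (fs (y i)))))"
        using C'(1) cX_nonneg by (simp add: ennreal_mult ennreal_plus sum_nonneg sum_ennreal)
      finally show "ennreal (lX (restrict (\<lambda>i. fs (y i)) {..<N})) \<le> ennreal C' * (1 + (\<Sum>i<N. ennreal (cX z0 (fs (y i)))))"
        by (simp add: w_def)
    qed
    also have "\<dots> = ennreal C' * (1 + (\<Sum>i<N. \<integral>\<^sup>+ y. ennreal (cX z0 (fs (y i))) \<partial>prodM N P))"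
    proof -
      have m: "(\<lambda>y. ennreal (cX z0 (fs (y i)))) \<in> borel_measurable (prodM N P)" if "i \<in> {..<N}" for i
        using measurable_compose[OF cm hm] that by simp
      have ms: "(\<lambda>y. \<Sum>i<N. ennreal (cX z0 (fs (y i)))) \<in> borel_measurable (prodM N P)"
        using m by (rule borel_measurable_sum)
      have "(\<integral>\<^sup>+ y. (\<Sum>i<N. ennreal (cX z0 (fs (y i)))) \<partial>prodM N P)
          = (\<Sum>i<N. \<integral>\<^sup>+ y. ennreal (cX z0 (fs (y i))) \<partial>prodM N P)"
        using m by (rule nn_integral_sum)
      then show ?thesis using ms
        by (subst nn_integral_cmult, measurable, subst nn_integral_add) (simp_all add: pN.emeasure_space_1)
    qed
    also have "\<dots> = ennreal C' * (1 + (\<Sum>i<N. \<integral>\<^sup>+ y. ennreal (cX z0 (fs y)) \<partial>P))" using mi by simp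
    also have "\<dots> \<le> ennreal C' * (1 + (\<Sum>i<N. ennreal (K * (mom + \<rho>))))"
      using m1 by (intro mult_left_mono add_left_mono sum_mono) auto
    also have "\<dots> < \<infinity>" by (simp add: ennreal_mult_less_top of_nat_less_top)
    finally show ?thesis .
  qed
  note main = limit_expectation[OF plan M R bad f g fsm fsX lim li ui Lfin]
  have "ereal v \<le> ereal (\<integral>y. lX (restrict (\<lambda>i. fs (y i)) {..<N}) \<partial>prodM N P)" using main(2) by simp
  also have "\<dots> \<le> S_val X c \<rho> P N l" by (rule S_val_ge_pushforward[OF fsm fsX fscost main(1)])
  finally show ?thesis .
qed

end

section \<open>Symmetrising a coupling\<close>

lemma finite_perms: "finite (perms M)" and card_perms: "card (perms M) = fact M" and perms_ne: "perms M \<noteq> {}"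
proof -
  show "finite (perms M)" unfolding perms_def by (rule finite_permutations) simp
  show "card (perms M) = fact M" unfolding perms_def by (rule card_permutations) auto
  show "perms M \<noteq> {}" unfolding perms_def using permutes_id[of "{..<M}"] by blast
qed

lemma permute_permute:
  "\<tau> \<in> perms M \<Longrightarrow> permute M \<tau> (permute M \<sigma> x) = permute M (\<sigma> \<circ> \<tau>) x"
  unfolding permute_def perms_def using permutes_in_image[of \<tau> "{..<M}"] by (auto simp: fun_eq_iff)

lemma sum_perms_compose:
  assumes "\<tau> \<in> perms M" shows "(\<Sum>\<sigma>\<in>perms M. h (\<sigma> \<circ> \<tau>)) = (\<Sum>\<sigma>\<in>perms M. h \<sigma>)"
proof (rule sum.reindex_bij_betw)
  have t: "\<tau> permutes {..<M}" using assms by (simp add: perms_def)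
  show "bij_betw (\<lambda>\<sigma>. \<sigma> \<circ> \<tau>) (perms M) (perms M)"
  proof (rule bij_betwI[where g = "\<lambda>\<sigma>. \<sigma> \<circ> inv \<tau>"])
    show "(\<lambda>\<sigma>. \<sigma> \<circ> \<tau>) \<in> perms M \<rightarrow> perms M" "(\<lambda>\<sigma>. \<sigma> \<circ> inv \<tau>) \<in> perms M \<rightarrow> perms M"
      using t permutes_inv[OF t] by (auto simp: perms_def intro: permutes_compose)
  qed (simp_all add: comp_assoc permutes_inv_o[OF t])
qed

lemma distr_prodM_permute:
  assumes "prob_space P" "sets P = sets borel" "\<sigma> \<in> perms M"
  shows "distr (prodM M P) (spaceM M) (permute M \<sigma>) = prodM M P"
proof -
  have s: "\<sigma> permutes {..<M}" using assms(3) by (simp add: perms_def)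
  have "prodM M P = distr (prodM M P) (prodM M P) (permute M \<sigma>)"
    unfolding prodM_def permute_def[abs_def] comp_def
    using distr_PiM_reindex[of "{..<M}" "\<lambda>_. P" \<sigma> "{..<M}"] assms(1) permutes_inj_on[OF s] permutes_in_image[OF s]
    by (auto simp: Pi_iff)
  also have "\<dots> = distr (prodM M P) (spaceM M) (permute M \<sigma>)"
    by (intro distr_cong refl) (simp add: sets_prodM[OF assms(2)])
  finally show ?thesis by simp
qed

text \<open>A uniformly random permutation, independent of the coupling, acts on both components
  simultaneously. As an image of a product measure the mixture is a measure by construction.\<close>

definition symm_coupling ::
  "nat \<Rightarrow> ((nat \<Rightarrow> 'a::euclidean_space) \<times> (nat \<Rightarrow> 'a)) measure \<Rightarrow> ((nat \<Rightarrow> 'a) \<times> (nat \<Rightarrow> 'a)) measure" where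
  "symm_coupling M \<pi> = distr (uniform_count_measure (perms M) \<Otimes>\<^sub>M \<pi>) (spaceM M \<Otimes>\<^sub>M spaceM M)
     (\<lambda>w. (permute M (fst w) (fst (snd w)), permute M (fst w) (snd (snd w))))"

lemma nn_integral_symm_coupling:
  assumes pi: "prob_space \<pi>" "sets \<pi> = sets (spaceM M \<Otimes>\<^sub>M spaceM M)"
    and h: "h \<in> borel_measurable (spaceM M \<Otimes>\<^sub>M spaceM M)"
  shows "(\<integral>\<^sup>+ z. h z \<partial>symm_coupling M \<pi>)
    = (\<Sum>\<sigma>\<in>perms M. ennreal (1 / fact M) * (\<integral>\<^sup>+ z. h (permute M \<sigma> (fst z), permute M \<sigma> (snd z)) \<partial>\<pi>))"
proof -
  interpret prob_space \<pi> by (rule pi)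
  let ?U = "uniform_count_measure (perms M)"
  let ?T = "\<lambda>w. (permute M (fst w) (fst (snd w)), permute M (fst w) (snd (snd w)))"
  have sU: "sets ?U = sets (count_space (perms M))" by (simp add: sets_uniform_count_measure)
  have Tm: "?T \<in> measurable (?U \<Otimes>\<^sub>M \<pi>) (spaceM M \<Otimes>\<^sub>M spaceM M)"
  proof -
    have "?T \<in> measurable (count_space (perms M) \<Otimes>\<^sub>M (spaceM M \<Otimes>\<^sub>M spaceM M)) (spaceM M \<Otimes>\<^sub>M spaceM M)"
    proof (rule measurable_pair_measure_countable1)
      show "countable (perms M)" using finite_perms by (rule countable_finite)
      fix \<sigma> assume "\<sigma> \<in> perms M"
      note measurable_permute[OF this, measurable]
      show "(\<lambda>y. ?T (\<sigma>, y)) \<in> measurable (spaceM M \<Otimes>\<^sub>M spaceM M) (spaceM M \<Otimes>\<^sub>M spaceM M)" by simp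
    qed
    then show ?thesis by (simp add: measurable_cong_sets[OF sets_pair_measure_cong[OF sU pi(2)] refl])
  qed
  have hT: "(\<lambda>w. h (?T w)) \<in> borel_measurable (?U \<Otimes>\<^sub>M \<pi>)" by (rule measurable_compose[OF Tm h])
  have "(\<integral>\<^sup>+ z. h z \<partial>symm_coupling M \<pi>) = (\<integral>\<^sup>+ w. h (?T w) \<partial>(?U \<Otimes>\<^sub>M \<pi>))"
    unfolding symm_coupling_def using h by (intro nn_integral_distr[OF Tm]) simp
  also have "\<dots> = (\<integral>\<^sup>+ \<sigma>. \<integral>\<^sup>+ z. h (permute M \<sigma> (fst z), permute M \<sigma> (snd z)) \<partial>\<pi> \<partial>?U)"
    using nn_integral_fst[OF hT] by simp
  also have "\<dots> = (\<Sum>\<sigma>\<in>perms M. ennreal (1 / fact M) * (\<integral>\<^sup>+ z. h (permute M \<sigma> (fst z), permute M \<sigma> (snd z)) \<partial>\<pi>))"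
    unfolding uniform_count_measure_def
    by (subst nn_integral_point_measure_finite) (auto simp: finite_perms card_perms)
  finally show ?thesis .
qed

lemma sum_perms_const: "(\<Sum>\<sigma>\<in>perms M. ennreal (1 / fact M) * r) = r"
proof -
  have "(\<Sum>\<sigma>\<in>perms M. ennreal (1 / fact M) * r) = (of_nat (fact M) * ennreal (1 / fact M)) * r"
    by (simp add: card_perms mult.assoc)
  also have "of_nat (fact M) * ennreal (1 / fact M) = ennreal (fact M * (1 / fact M))"
    by (simp add: ennreal_of_nat_eq_real_of_nat ennreal_mult[symmetric])
  finally show ?thesis by simp
qed

context dro
begin

text \<open>The total cost is invariant under simultaneous permutations, so symmetrising a nearly
  optimal coupling preserves it, and exchangeability spreads it evenly over the \<open>M\<close>
  pairs. The slack \<open>\<epsilon>\<close> is there because the infimum in \<open>OT\<close> is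
  only approached. The last conclusion records what becomes of the first marginal.\<close>

lemma symmetrized_plan:
  assumes Pb: "Pb \<in> ballM X c \<rho> P M" and M: "0 < M" and eps: "0 < \<epsilon>"
  obtains \<mu> where "exch_plan X P M \<mu>"
    "\<And>i. i < M \<Longrightarrow> (\<integral>\<^sup>+ z. ennreal (cX (fst z i) (snd z i)) \<partial>\<mu>) \<le> ennreal (\<rho> + \<epsilon>)"
    "\<And>h. h \<in> borel_measurable (spaceM M) \<Longrightarrow> (\<integral>\<^sup>+ z. h (fst z) \<partial>\<mu>)
        = (\<Sum>\<sigma>\<in>perms M. ennreal (1 / fact M) * (\<integral>\<^sup>+ x. h (permute M \<sigma> x) \<partial>Pb))"
proof -
  have sPb[measurable_cong]: "sets Pb = sets (spaceM M)" and pPb: "prob_space Pb" and tPb: "emeasure Pb (tup M X) = 1"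
    and ot: "OT (costM M c) Pb (prodM M P) \<le> ennreal (real M * \<rho>)"
    using Pb by (auto simp: ballM_def OTball_def probs_on_def)
  interpret Pb: prob_space Pb by (rule pPb)
  interpret pM: prob_space "prodM M P" by (rule prob_space_prodM[OF P_prob])
  note sM[measurable_cong] = sets_prodM[OF P_sets, of M]
  have "ennreal (real M * \<rho>) < ennreal (real M * (\<rho> + \<epsilon>))"
    using M eps \<rho>_pos by (intro ennreal_lessI) auto
  then have "OT (costM M c) Pb (prodM M P) < ennreal (real M * (\<rho> + \<epsilon>))" using ot by (rule le_less_trans[rotated])
  then obtain \<pi> where pic: "\<pi> \<in> couplings Pb (prodM M P)"
    and picost: "(\<integral>\<^sup>+ z. ennreal (costM M c (fst z) (snd z)) \<partial>\<pi>) < ennreal (real M * (\<rho> + \<epsilon>))"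
    unfolding OT_def INF_less_iff by blast
  have spi: "sets \<pi> = sets (spaceM M \<Otimes>\<^sub>M spaceM M)"
    using pic sets_pair_measure_cong[OF sPb sM] by (simp add: couplings_def)
  note [measurable_cong] = spi
  have d1: "distr \<pi> Pb fst = Pb" and d2: "distr \<pi> (prodM M P) snd = prodM M P" using pic by (auto simp: couplings_def)
  have f1: "fst \<in> measurable \<pi> Pb" and f2: "snd \<in> measurable \<pi> (prodM M P)" by measurable
  have ppi: "prob_space \<pi>"
  proof
    have "emeasure (distr \<pi> Pb fst) (space Pb) = 1" unfolding d1 by (rule Pb.emeasure_space_1)
    then show "emeasure \<pi> (space \<pi>) = 1" using measurable_space[OF f1]
      by (subst (asm) emeasure_distr[OF f1]) (auto simp: Int_absorb1 subsetI)
  qed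
  interpret pi: prob_space \<pi> by (rule ppi)
  have tm: "tup M X \<in> sets (spaceM M)" by (rule sets_tup[OF X_sets])
  have aP: "AE x in Pb. x \<in> tup M X"
    using tPb tm sPb by (intro Pb.prob_eq_1[THEN iffD1]) (auto simp: Pb.emeasure_eq_measure)
  have aQ: "AE y in prodM M P. y \<in> tup M X"
    using AE_prodM[OF P_prob P_X, of M] AE_space
    by eventually_elim (auto simp: tup_def PiE_iff space_prodM[OF P_sets])
  have a1: "AE z in \<pi>. fst z \<in> tup M X"
  proof -
    have "AE x in distr \<pi> Pb fst. x \<in> tup M X" unfolding d1 by (rule aP)
    then show ?thesis using tm sPb by (subst (asm) AE_distr_iff[OF f1]) (auto simp: Int_def[symmetric] Collect_conj_eq)
  qed
  have a2: "AE z in \<pi>. snd z \<in> tup M X"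
  proof -
    have "AE x in distr \<pi> (prodM M P) snd. x \<in> tup M X" unfolding d2 by (rule aQ)
    then show ?thesis using tm sM by (subst (asm) AE_distr_iff[OF f2]) (auto simp: Int_def[symmetric] Collect_conj_eq)
  qed
  define \<mu> where "\<mu> = symm_coupling M \<pi>"
  have smu[measurable_cong]: "sets \<mu> = sets (spaceM M \<Otimes>\<^sub>M spaceM M)" by (simp add: \<mu>_def symm_coupling_def)
  note formula = nn_integral_symm_coupling[OF ppi spi, folded \<mu>_def]
  have emu: "emeasure \<mu> A = (\<Sum>\<sigma>\<in>perms M. ennreal (1 / fact M) * (\<integral>\<^sup>+ z. indicator A (permute M \<sigma> (fst z), permute M \<sigma> (snd z)) \<partial>\<pi>))"
    if "A \<in> sets (spaceM M \<Otimes>\<^sub>M spaceM M)" for A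
    using formula[of "indicator A"] that smu by (simp add: nn_integral_indicator)
  have pmu: "prob_space \<mu>"
  proof
    have "emeasure \<mu> (space \<mu>) = (\<integral>\<^sup>+ z. 1 \<partial>\<mu>)" by simp
    also have "\<dots> = (\<Sum>\<sigma>\<in>perms M. ennreal (1 / fact M) * (\<integral>\<^sup>+ z. 1 \<partial>\<pi>))"
      by (rule formula) simp
    also have "\<dots> = 1" by (simp only: sum_perms_const) (simp add: pi.emeasure_space_1)
    finally show "emeasure \<mu> (space \<mu>) = 1" .
  qed
  interpret mu: prob_space \<mu> by (rule pmu)
  have plan: "exch_plan X P M \<mu>"
    unfolding exch_plan_def
  proof (intro conjI ballI pmu smu)
    show "distr \<mu> (spaceM M) snd = prodM M P"
    proof (rule measure_eqI)
      show "sets (distr \<mu> (spaceM M) snd) = sets (prodM M P)" using sM by simp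
      fix A assume "A \<in> sets (distr \<mu> (spaceM M) snd)"
      then have A[measurable]: "A \<in> sets (spaceM M)" by simp
      have "emeasure (distr \<mu> (spaceM M) snd) A = (\<integral>\<^sup>+ y. indicator A y \<partial>distr \<mu> (spaceM M) snd)"
        by (subst nn_integral_indicator) auto
      also have "\<dots> = (\<integral>\<^sup>+ z. indicator A (snd z) \<partial>\<mu>)" by (rule nn_integral_distr) measurable
      also have "\<dots> = (\<Sum>\<sigma>\<in>perms M. ennreal (1 / fact M) * (\<integral>\<^sup>+ z. indicator A (permute M \<sigma> (snd z)) \<partial>\<pi>))"
        by (subst formula) auto
      also have "\<dots> = (\<Sum>\<sigma>\<in>perms M. ennreal (1 / fact M) * emeasure (prodM M P) A)"
      proof (intro sum.cong refl arg_cong2[where f = "(*)"])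
        fix \<sigma> assume s: "\<sigma> \<in> perms M"
        note measurable_permute[OF s, measurable]
        have "(\<integral>\<^sup>+ z. indicator A (permute M \<sigma> (snd z)) \<partial>\<pi>) = (\<integral>\<^sup>+ y. indicator A (permute M \<sigma> y) \<partial>distr \<pi> (prodM M P) snd)"
          by (rule nn_integral_distr[OF f2, symmetric]) measurable
        also have "\<dots> = (\<integral>\<^sup>+ y. indicator A (permute M \<sigma> y) \<partial>prodM M P)" unfolding d2 ..
        also have "\<dots> = (\<integral>\<^sup>+ y. indicator A y \<partial>distr (prodM M P) (spaceM M) (permute M \<sigma>))"
          by (rule nn_integral_distr[symmetric]) measurable
        also have "\<dots> = emeasure (prodM M P) A" unfolding distr_prodM_permute[OF P_prob P_sets s] using A sM by simp
        finally show "(\<integral>\<^sup>+ z. indicator A (permute M \<sigma> (snd z)) \<partial>\<pi>) = emeasure (prodM M P) A" .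
      qed
      also have "\<dots> = emeasure (prodM M P) A" by (rule sum_perms_const)
      finally show "emeasure (distr \<mu> (spaceM M) snd) A = emeasure (prodM M P) A" .
    qed
    show "AE z in \<mu>. fst z \<in> tup M X"
    proof -
      define B where "B = {z \<in> space (spaceM M \<Otimes>\<^sub>M (spaceM M :: (nat \<Rightarrow> 'a) measure)). fst z \<notin> tup M X}"
      have Bm[measurable]: "B \<in> sets (spaceM M \<Otimes>\<^sub>M spaceM M)" unfolding B_def using tm by measurable
      have "(\<integral>\<^sup>+ z. indicator B (permute M \<sigma> (fst z), permute M \<sigma> (snd z)) \<partial>\<pi>) = 0" if s: "\<sigma> \<in> perms M" for \<sigma>
      proof -
        have "(\<integral>\<^sup>+ z. indicator B (permute M \<sigma> (fst z), permute M \<sigma> (snd z)) \<partial>\<pi>) = (\<integral>\<^sup>+ z. 0 \<partial>\<pi>)"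
        proof (rule nn_integral_cong_AE)
          show "AE z in \<pi>. indicator B (permute M \<sigma> (fst z), permute M \<sigma> (snd z)) = (0 :: ennreal)"
            using a1
          proof eventually_elim
            case (elim z)
            have "permute M \<sigma> (fst z) \<in> tup M X"
              using elim s permutes_in_image[of \<sigma> "{..<M}"] by (auto simp: tup_def permute_def perms_def PiE_iff)
            then show ?case by (simp add: B_def)
          qed
        qed
        then show ?thesis by simp
      qed
      then have "emeasure \<mu> B = 0" by (simp add: emu[OF Bm])
      then show ?thesis using Bm smu sets_eq_imp_space_eq[OF smu]
        by (intro AE_I'[of B]) (auto simp: B_def null_sets_def)
    qed
    fix \<tau> assume t: "\<tau> \<in> perms M"
    note measurable_permute[OF t, measurable]
    let ?T = "\<lambda>z :: (nat \<Rightarrow> 'a) \<times> (nat \<Rightarrow> 'a). (permute M \<tau> (fst z), permute M \<tau> (snd z))"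
    show "distr \<mu> (spaceM M \<Otimes>\<^sub>M spaceM M) ?T = \<mu>"
    proof (rule measure_eqI)
      show "sets (distr \<mu> (spaceM M \<Otimes>\<^sub>M spaceM M) ?T) = sets \<mu>" using smu by simp
      fix A assume "A \<in> sets (distr \<mu> (spaceM M \<Otimes>\<^sub>M spaceM M) ?T)"
      then have A[measurable]: "A \<in> sets (spaceM M \<Otimes>\<^sub>M spaceM M)" by simp
      have Tm[measurable]: "?T \<in> measurable (spaceM M \<Otimes>\<^sub>M spaceM M) (spaceM M \<Otimes>\<^sub>M spaceM M)" by measurable
      have "emeasure (distr \<mu> (spaceM M \<Otimes>\<^sub>M spaceM M) ?T) A = (\<integral>\<^sup>+ y. indicator A y \<partial>distr \<mu> (spaceM M \<Otimes>\<^sub>M spaceM M) ?T)"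
        by (subst nn_integral_indicator) auto
      also have "\<dots> = (\<integral>\<^sup>+ z. indicator A (?T z) \<partial>\<mu>)" by (rule nn_integral_distr) measurable
      also have "\<dots> = (\<Sum>\<sigma>\<in>perms M. ennreal (1 / fact M) * (\<integral>\<^sup>+ z. indicator A (?T (permute M \<sigma> (fst z), permute M \<sigma> (snd z))) \<partial>\<pi>))"
        by (subst formula) (auto intro!: measurable_compose[OF Tm])
      also have "\<dots> = (\<Sum>\<sigma>\<in>perms M. ennreal (1 / fact M) * (\<integral>\<^sup>+ z. indicator A (permute M (\<sigma> \<circ> \<tau>) (fst z), permute M (\<sigma> \<circ> \<tau>) (snd z)) \<partial>\<pi>))"
        by (simp add: permute_permute[OF t])
      also have "\<dots> = emeasure \<mu> A"
        unfolding emu[OF A]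
        by (rule sum_perms_compose[OF t, of "\<lambda>\<sigma>. ennreal (1 / fact M) * (\<integral>\<^sup>+ z. indicator A (permute M \<sigma> (fst z), permute M \<sigma> (snd z)) \<partial>\<pi>)"])
      finally show "emeasure (distr \<mu> (spaceM M \<Otimes>\<^sub>M spaceM M) ?T) A = emeasure \<mu> A" .
    qed
  qed
  have cm: "(\<lambda>z. ennreal (cX (fst z i) (snd z i))) \<in> borel_measurable (spaceM M \<Otimes>\<^sub>M spaceM M)" if "i < M" for i
  proof -
    note measurable_coord[OF that, measurable]
    show ?thesis by measurable
  qed
  have cost: "(\<integral>\<^sup>+ z. ennreal (cX (fst z i) (snd z i)) \<partial>\<mu>) \<le> ennreal (\<rho> + \<epsilon>)" if i: "i < M" for i
  proof -
    define a where "a = (\<integral>\<^sup>+ z. ennreal (cX (fst z i) (snd z i)) \<partial>\<mu>)"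
    have same: "(\<integral>\<^sup>+ z. ennreal (cX (fst z j) (snd z j)) \<partial>\<mu>) = a" if j: "j < M" for j
      using exch_plan_nn_integral[OF plan transpose_perms[OF i j] cm[OF i]] i by (simp add: a_def permute_def)
    have "of_nat M * a = (\<Sum>j<M. \<integral>\<^sup>+ z. ennreal (cX (fst z j) (snd z j)) \<partial>\<mu>)" by (simp add: same)
    also have "\<dots> = (\<integral>\<^sup>+ z. (\<Sum>j<M. ennreal (cX (fst z j) (snd z j))) \<partial>\<mu>)"
      by (rule nn_integral_sum[symmetric]) (use cm in \<open>simp add: measurable_cong_sets[OF smu refl]\<close>)
    also have "\<dots> = (\<Sum>\<sigma>\<in>perms M. ennreal (1 / fact M) *
        (\<integral>\<^sup>+ z. (\<Sum>j<M. ennreal (cX (permute M \<sigma> (fst z) j) (permute M \<sigma> (snd z) j))) \<partial>\<pi>))"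
    proof -
      have m: "(\<lambda>z. \<Sum>j<M. ennreal (cX (fst z j) (snd z j))) \<in> borel_measurable (spaceM M \<Otimes>\<^sub>M spaceM M)"
        by (intro borel_measurable_sum cm) simp
      show ?thesis using formula[OF m] by simp
    qed
    also have "\<dots> = (\<Sum>\<sigma>\<in>perms M. ennreal (1 / fact M) * (\<integral>\<^sup>+ z. (\<Sum>j<M. ennreal (cX (fst z j) (snd z j))) \<partial>\<pi>))"
    proof -
      have "(\<Sum>j<M. ennreal (cX (permute M \<sigma> x j) (permute M \<sigma> y j))) = (\<Sum>j<M. ennreal (cX (x j) (y j)))"
        if "\<sigma> \<in> perms M" for \<sigma> x y
      proof -
        have "bij_betw \<sigma> {..<M} {..<M}" using that by (simp add: perms_def permutes_imp_bij)
        from sum.reindex_bij_betw[OF this, of "\<lambda>j. ennreal (cX (x j) (y j))"] show ?thesis by (simp add: permute_def)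
      qed
      then show ?thesis by simp
    qed
    also have "\<dots> = (\<integral>\<^sup>+ z. (\<Sum>j<M. ennreal (cX (fst z j) (snd z j))) \<partial>\<pi>)" by (rule sum_perms_const)
    also have "\<dots> = (\<integral>\<^sup>+ z. ennreal (costM M c (fst z) (snd z)) \<partial>\<pi>)"
    proof (rule nn_integral_cong_AE)
      show "AE z in \<pi>. (\<Sum>j<M. ennreal (cX (fst z j) (snd z j))) = ennreal (costM M c (fst z) (snd z))"
        using a1 a2
      proof eventually_elim
        case (elim z)
        have "costM M c (fst z) (snd z) = (\<Sum>j<M. cX (fst z j) (snd z j))"
          unfolding costM_def using elim by (intro sum.cong) (auto simp: cX_def tup_def PiE_iff)
        then show ?case using cX_nonneg by (simp add: sum_ennreal)
      qed
    qed
    also have "\<dots> \<le> ennreal (real M * (\<rho> + \<epsilon>))" using picost by (rule less_imp_le)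
    also have "\<dots> = of_nat M * ennreal (\<rho> + \<epsilon>)"
      using eps \<rho>_pos by (simp add: ennreal_mult ennreal_of_nat_eq_real_of_nat)
    finally have "of_nat M * a \<le> of_nat M * ennreal (\<rho> + \<epsilon>)" .
    then show ?thesis unfolding a_def using M
      by (simp add: ennreal_mult_le_mult_iff of_nat_less_top less_top[symmetric])
  qed
  show thesis
  proof (rule that[OF plan cost])
    fix h :: "(nat \<Rightarrow> 'a) \<Rightarrow> ennreal" assume h[measurable]: "h \<in> borel_measurable (spaceM M)"
    have "(\<integral>\<^sup>+ z. h (fst z) \<partial>\<mu>) = (\<Sum>\<sigma>\<in>perms M. ennreal (1 / fact M) * (\<integral>\<^sup>+ z. h (permute M \<sigma> (fst z)) \<partial>\<pi>))"
      by (subst formula) auto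
    also have "\<dots> = (\<Sum>\<sigma>\<in>perms M. ennreal (1 / fact M) * (\<integral>\<^sup>+ x. h (permute M \<sigma> x) \<partial>Pb))"
    proof (intro sum.cong refl arg_cong2[where f = "(*)"])
      fix \<sigma> assume "\<sigma> \<in> perms M"
      note measurable_permute[OF this, measurable]
      have "(\<integral>\<^sup>+ x. h (permute M \<sigma> x) \<partial>distr \<pi> Pb fst) = (\<integral>\<^sup>+ z. h (permute M \<sigma> (fst z)) \<partial>\<pi>)"
        by (rule nn_integral_distr[OF f1]) measurable
      then show "(\<integral>\<^sup>+ z. h (permute M \<sigma> (fst z)) \<partial>\<pi>) = (\<integral>\<^sup>+ x. h (permute M \<sigma> x) \<partial>Pb)" unfolding d1 by simp
    qed
    finally show "(\<integral>\<^sup>+ z. h (fst z) \<partial>\<mu>) = (\<Sum>\<sigma>\<in>perms M. ennreal (1 / fact M) * (\<integral>\<^sup>+ x. h (permute M \<sigma> x) \<partial>Pb))" .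
  qed
qed

end

section \<open>Comparing the values\<close>

lemma ext_integral_cong_AE:
  assumes "AE x in M. f x = g x" shows "ext_integral M f = ext_integral M g"
proof -
  have "(\<integral>\<^sup>+ x. ennreal (f x) \<partial>M) = (\<integral>\<^sup>+ x. ennreal (g x) \<partial>M)"
    "(\<integral>\<^sup>+ x. ennreal (- f x) \<partial>M) = (\<integral>\<^sup>+ x. ennreal (- g x) \<partial>M)"
    using assms by (intro nn_integral_cong_AE; auto elim!: eventually_mono)+
  then show ?thesis by (simp add: ext_integral_def)
qed

text \<open>The loss may have infinite negative part. Such laws have value
  \<open>- \<infinity>\<close> and are harmless on the smaller side of an inequality, so only
  integrable losses remain to be treated.\<close>

lemma ext_integral_cases:
  assumes "f \<in> borel_measurable M" "(\<integral>\<^sup>+ x. ennreal (f x) \<partial>M) < \<infinity>"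
  shows "integrable M f \<and> ext_integral M f = ereal (\<integral>x. f x \<partial>M) \<or> ext_integral M f = - \<infinity>"
proof (cases "(\<integral>\<^sup>+ x. ennreal (- f x) \<partial>M) = \<infinity>")
  case True
  have "enn2ereal (\<integral>\<^sup>+ x. ennreal (f x) \<partial>M) \<noteq> \<infinity>" using assms(2)
    by (metis enn2ereal_eq_top_iff infinity_ennreal_def less_top top_ereal_def)
  then have "ext_integral M f = - \<infinity>" using True
    by (cases "enn2ereal (\<integral>\<^sup>+ x. ennreal (f x) \<partial>M)") (auto simp: ext_integral_def)
  then show ?thesis by simp
next
  case False
  then have "integrable M f" using assms by (subst real_integrable_def) auto
  then show ?thesis using ext_integral_eq by blast
qed

context dro
begin

lemma AE_X_imp_eq_cX:
  assumes "AE x in Q. x \<in> X" "z \<in> X"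
  shows "(\<integral>\<^sup>+ x. ennreal (c z x) \<partial>Q) = (\<integral>\<^sup>+ x. ennreal (cX z x) \<partial>Q)"
  using assms by (intro nn_integral_cong_AE) (auto simp: cX_def elim!: eventually_mono)

text \<open>The \<open>M\<close>-fold product of a nearly optimal coupling, its pairs regrouped into
  a pair of tuples, couples the two products at \<open>M\<close> times the cost. The moment
  condition tensorises in the same way.\<close>

lemma product_in_ball:
  assumes Q: "Q \<in> OTball borel X c \<rho> P" and M: "0 < M"
  shows "prodM M Q \<in> ballM X c \<rho> P M"
proof -
  have sQ[measurable_cong]: "sets Q = sets borel" and pQ: "prob_space Q" and QX: "emeasure Q X = 1"
    and mQ: "finite_moment c X Q" and oQ: "OT c Q P \<le> ennreal \<rho>"
    using Q by (auto simp: OTball_def probs_on_def)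
  interpret Q: prob_space Q by (rule pQ)
  interpret pM: prob_space "prodM M Q" by (rule prob_space_prodM[OF pQ])
  have aQ: "AE x in Q. x \<in> X"
    using QX sQ by (intro Q.prob_eq_1[THEN iffD1]) (auto simp: Q.emeasure_eq_measure)
  have aM: "AE x in prodM M Q. x \<in> tup M X"
    using AE_prodM[OF pQ aQ, of M] AE_space
    by eventually_elim (auto simp: tup_def PiE_iff space_prodM[OF sQ])
  have "emeasure (prodM M Q) (tup M X) = 1"
    unfolding tup_def using sQ by (subst emeasure_prodM[OF pQ]) (auto simp: QX)
  then have 1: "prodM M Q \<in> probs_on (spaceM M) (tup M X)"
    using pM.prob_space_axioms sets_prodM[OF sQ] by (simp add: probs_on_def)
  have 2: "finite_moment (costM M c) (tup M X) (prodM M Q)"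
  proof -
    obtain x0 where x0: "x0 \<in> X" "(\<integral>\<^sup>+ x. ennreal (c x0 x) \<partial>Q) < \<infinity>" using mQ by (auto simp: finite_moment_def)
    have hm: "(\<lambda>x. ennreal (cX x0 x)) \<in> borel_measurable Q" by measurable
    define w where "w = restrict (\<lambda>_. x0) {..<M}"
    have cm: "(\<lambda>y. y i) \<in> measurable (prodM M Q) Q" if "i < M" for i
      unfolding prodM_def using that by (intro measurable_component_singleton) simp
    have mi: "(\<integral>\<^sup>+ y. ennreal (cX x0 (y i)) \<partial>prodM M Q) = (\<integral>\<^sup>+ x. ennreal (cX x0 x) \<partial>Q)" if i: "i < M" for i
    proof -
      have "distr (prodM M Q) Q (\<lambda>y. y i) = Q"
        unfolding prodM_def using i pQ by (intro distr_PiM_component) auto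
      then show ?thesis using nn_integral_distr[OF cm[OF i], of "\<lambda>x. ennreal (cX x0 x)"] hm by simp
    qed
    have "(\<integral>\<^sup>+ x. ennreal (costM M c w x) \<partial>prodM M Q) = (\<integral>\<^sup>+ x. (\<Sum>i<M. ennreal (cX x0 (x i))) \<partial>prodM M Q)"
    proof (rule nn_integral_cong_AE)
      show "AE x in prodM M Q. ennreal (costM M c w x) = (\<Sum>i<M. ennreal (cX x0 (x i)))"
        using aM
      proof eventually_elim
        case (elim x)
        have "costM M c w x = (\<Sum>i<M. cX x0 (x i))"
          unfolding costM_def w_def using elim x0(1) by (intro sum.cong) (auto simp: cX_def tup_def PiE_iff)
        then show ?case using cX_nonneg by (simp add: sum_ennreal)
      qed
    qed
    also have "\<dots> = (\<Sum>i<M. \<integral>\<^sup>+ x. ennreal (cX x0 (x i)) \<partial>prodM M Q)"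
      by (rule nn_integral_sum) (use measurable_compose[OF cm hm] in simp)
    also have "\<dots> = of_nat M * (\<integral>\<^sup>+ x. ennreal (cX x0 x) \<partial>Q)" using mi by simp
    also have "\<dots> < \<infinity>" using x0 AE_X_imp_eq_cX[OF aQ x0(1)] by (simp add: ennreal_mult_less_top of_nat_less_top)
    finally have "(\<integral>\<^sup>+ x. ennreal (costM M c w x) \<partial>prodM M Q) < \<infinity>" .
    moreover have "w \<in> tup M X" using x0(1) by (simp add: w_def tup_def)
    ultimately show ?thesis unfolding finite_moment_def by blast
  qed
  have 3: "OT (costM M c) (prodM M Q) (prodM M P) \<le> ennreal (real M * \<rho>)"
  proof (rule ennreal_le_epsilon)
    fix e :: real assume e: "0 < e"
    \<comment> \<open>A slack of \<open>e / M\<close> for each coordinate adds up to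
      \<open>e\<close>.\<close>
    have "0 < e / M" using e M by simp
    then have "ennreal \<rho> < ennreal (\<rho> + e / M)" using \<rho>_pos by (intro ennreal_lessI) linarith+
    then have "OT c Q P < ennreal (\<rho> + e / M)" using oQ by (rule le_less_trans[rotated])
    then obtain \<kappa> where kc: "\<kappa> \<in> couplings Q P" and kcost: "(\<integral>\<^sup>+ z. ennreal (c (fst z) (snd z)) \<partial>\<kappa>) < ennreal (\<rho> + e / M)"
      unfolding OT_def INF_less_iff by blast
    have sk[measurable_cong]: "sets \<kappa> = sets (Q \<Otimes>\<^sub>M P)" and d1: "distr \<kappa> Q fst = Q" and d2: "distr \<kappa> P snd = P"
      using kc by (auto simp: couplings_def)
    have f1: "fst \<in> measurable \<kappa> Q" and f2: "snd \<in> measurable \<kappa> P" by measurable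
    have pk: "prob_space \<kappa>"
    proof
      have "emeasure (distr \<kappa> Q fst) (space Q) = 1" unfolding d1 by (rule Q.emeasure_space_1)
      then show "emeasure \<kappa> (space \<kappa>) = 1" using measurable_space[OF f1]
        by (subst (asm) emeasure_distr[OF f1]) (auto simp: Int_absorb1 subsetI)
    qed
    interpret kM: prob_space "PiM {..<M} (\<lambda>_. \<kappa>)" using pk by (intro prob_space_PiM)
    have sk': "sets \<kappa> = sets (borel \<Otimes>\<^sub>M borel)" using sk sets_pair_measure_cong[OF sQ P_sets] by simp
    have ak: "AE z in \<kappa>. fst z \<in> X \<and> snd z \<in> X"
    proof -
      have "AE x in distr \<kappa> Q fst. x \<in> X" "AE x in distr \<kappa> P snd. x \<in> X" unfolding d1 d2 using aQ P_X by auto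
      then have "AE z in \<kappa>. fst z \<in> X" "AE z in \<kappa>. snd z \<in> X"
        using sQ P_sets by (subst (asm) AE_distr_iff[OF f1], auto simp: X_closed; subst (asm) AE_distr_iff[OF f2], auto simp: X_closed)+
      then show ?thesis by eventually_elim simp
    qed
    let ?F = "compose {..<M} fst" and ?S = "compose {..<M} snd"
    define \<pi> where "\<pi> = distr (PiM {..<M} (\<lambda>_. \<kappa>)) (prodM M Q \<Otimes>\<^sub>M prodM M P) (\<lambda>w. (?F w, ?S w))"
    have Fm: "?F \<in> measurable (PiM {..<M} (\<lambda>_. \<kappa>)) (prodM M Q)" and Sm: "?S \<in> measurable (PiM {..<M} (\<lambda>_. \<kappa>)) (prodM M P)"
      unfolding prodM_def compose_def
      by (intro measurable_restrict measurable_compose[where N = \<kappa>, OF _ f1] measurable_compose[where N = \<kappa>, OF _ f2]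
          measurable_component_singleton; assumption)+
    have FS: "(\<lambda>w. (?F w, ?S w)) \<in> measurable (PiM {..<M} (\<lambda>_. \<kappa>)) (prodM M Q \<Otimes>\<^sub>M prodM M P)"
      using Fm Sm by (rule measurable_Pair)
    have "distr \<pi> (prodM M Q) fst = distr (PiM {..<M} (\<lambda>_. \<kappa>)) (prodM M Q) ?F"
      unfolding \<pi>_def by (subst distr_distr[OF measurable_fst FS]) (simp add: comp_def)
    also have "\<dots> = prodM M Q"
      unfolding prodM_def using pk pQ f1 by (subst distr_PiM_finite_prob_space') (auto simp: d1)
    finally have m1: "distr \<pi> (prodM M Q) fst = prodM M Q" .
    have "distr \<pi> (prodM M P) snd = distr (PiM {..<M} (\<lambda>_. \<kappa>)) (prodM M P) ?S"
      unfolding \<pi>_def by (subst distr_distr[OF measurable_snd FS]) (simp add: comp_def)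
    also have "\<dots> = prodM M P"
      unfolding prodM_def using pk P_prob f2 by (subst distr_PiM_finite_prob_space') (auto simp: d2)
    finally have m2: "distr \<pi> (prodM M P) snd = prodM M P" .
    have sp: "sets \<pi> = sets (prodM M Q \<Otimes>\<^sub>M prodM M P)" by (simp add: \<pi>_def)
    have "\<pi> \<in> couplings (prodM M Q) (prodM M P)" using m1 m2 sp by (simp add: couplings_def)
    then have "OT (costM M c) (prodM M Q) (prodM M P) \<le> (\<integral>\<^sup>+ z. ennreal (costM M c (fst z) (snd z)) \<partial>\<pi>)"
      unfolding OT_def by (rule INF_lower)
    also have "\<dots> = (\<integral>\<^sup>+ z. (\<Sum>i<M. ennreal (cX (fst z i) (snd z i))) \<partial>\<pi>)"
    proof (rule nn_integral_cong_AE)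
      have spp: "sets \<pi> = sets (spaceM M \<Otimes>\<^sub>M spaceM M)"
        using sp sets_pair_measure_cong[OF sets_prodM[OF sQ] sets_prodM[OF P_sets]] by simp
      have am: "AE z in \<pi>. \<forall>i<M. fst z i \<in> X \<and> snd z i \<in> X"
      proof -
        have "AE w in PiM {..<M} (\<lambda>_. \<kappa>). \<forall>i<M. fst (w i) \<in> X \<and> snd (w i) \<in> X"
          using AE_prodM[OF pk ak, of M] unfolding prodM_def .
        then have c: "AE w in PiM {..<M} (\<lambda>_. \<kappa>). \<forall>i<M. fst (?F w, ?S w) i \<in> X \<and> snd (?F w, ?S w) i \<in> X"
          by eventually_elim (simp add: compose_def)
        have "{z \<in> space \<pi>. \<forall>i\<in>{..<M}. fst z i \<in> X \<and> snd z i \<in> X} \<in> sets \<pi>"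
        proof (rule sets.sets_Collect_finite_All')
          fix i assume i: "i \<in> {..<M}"
          have "i < M" using i by simp
          note [measurable] = plan_measurable(1,2)[OF spp this]
          show "{z \<in> space \<pi>. fst z i \<in> X \<and> snd z i \<in> X} \<in> sets \<pi>" by measurable
        qed (use M in auto)
        then have S: "{z \<in> space (prodM M Q \<Otimes>\<^sub>M prodM M P). \<forall>i<M. fst z i \<in> X \<and> snd z i \<in> X}
            \<in> sets (prodM M Q \<Otimes>\<^sub>M prodM M P)"
          unfolding sp sets_eq_imp_space_eq[OF sp] Ball_def lessThan_iff .
        show ?thesis unfolding \<pi>_def AE_distr_iff[OF FS S] by (rule c)
      qed
      then show "AE z in \<pi>. ennreal (costM M c (fst z) (snd z)) = (\<Sum>i<M. ennreal (cX (fst z i) (snd z i)))"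
      proof eventually_elim
        case (elim z)
        then have "costM M c (fst z) (snd z) = (\<Sum>i<M. cX (fst z i) (snd z i))"
          unfolding costM_def by (intro sum.cong) (auto simp: cX_def)
        then show ?case using cX_nonneg by (simp add: sum_ennreal)
      qed
    qed
    also have "\<dots> = (\<integral>\<^sup>+ w. (\<Sum>i<M. ennreal (cX (fst (w i)) (snd (w i)))) \<partial>PiM {..<M} (\<lambda>_. \<kappa>))"
    proof -
      have "(\<lambda>z. \<Sum>i<M. ennreal (cX (fst z i) (snd z i))) \<in> borel_measurable (spaceM M \<Otimes>\<^sub>M spaceM M)"
      proof (rule borel_measurable_sum)
        fix i assume "i \<in> {..<M}"
        then have "i < M" by simp
        note measurable_coord[OF this, measurable]
        show "(\<lambda>z. ennreal (cX (fst z i) (snd z i))) \<in> borel_measurable (spaceM M \<Otimes>\<^sub>M spaceM M)" by measurable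
      qed
      then have "(\<lambda>z. \<Sum>i<M. ennreal (cX (fst z i) (snd z i))) \<in> borel_measurable (prodM M Q \<Otimes>\<^sub>M prodM M P)"
        by (simp add: measurable_cong_sets[OF sets_pair_measure_cong[OF sets_prodM[OF sQ] sets_prodM[OF P_sets]] refl])
      then show ?thesis unfolding \<pi>_def by (subst nn_integral_distr[OF FS]) (simp_all add: compose_def)
    qed
    also have "\<dots> = (\<Sum>i<M. \<integral>\<^sup>+ w. ennreal (cX (fst (w i)) (snd (w i))) \<partial>PiM {..<M} (\<lambda>_. \<kappa>))"
    proof (rule nn_integral_sum)
      fix i assume "i \<in> {..<M}"
      then have "(\<lambda>w. w i) \<in> measurable (PiM {..<M} (\<lambda>_. \<kappa>)) \<kappa>" by (rule measurable_component_singleton)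
      moreover have "(\<lambda>z. ennreal (cX (fst z) (snd z))) \<in> borel_measurable \<kappa>"
        unfolding measurable_cong_sets[OF sk' refl] using cX_measurable by measurable
      ultimately show "(\<lambda>w. ennreal (cX (fst (w i)) (snd (w i)))) \<in> borel_measurable (PiM {..<M} (\<lambda>_. \<kappa>))"
        by (rule measurable_compose)
    qed
    also have "\<dots> = (\<Sum>i<M. \<integral>\<^sup>+ z. ennreal (cX (fst z) (snd z)) \<partial>\<kappa>)"
    proof (rule sum.cong[OF refl])
      fix i assume i: "i \<in> {..<M}"
      have "distr (PiM {..<M} (\<lambda>_. \<kappa>)) \<kappa> (\<lambda>w. w i) = \<kappa>" using i pk by (intro distr_PiM_component) auto
      moreover have "(\<lambda>z. ennreal (cX (fst z) (snd z))) \<in> borel_measurable \<kappa>"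
        unfolding measurable_cong_sets[OF sk' refl] using cX_measurable by measurable
      moreover have "(\<lambda>w. w i) \<in> measurable (PiM {..<M} (\<lambda>_. \<kappa>)) \<kappa>" using i by (rule measurable_component_singleton)
      ultimately show "(\<integral>\<^sup>+ w. ennreal (cX (fst (w i)) (snd (w i))) \<partial>PiM {..<M} (\<lambda>_. \<kappa>)) = (\<integral>\<^sup>+ z. ennreal (cX (fst z) (snd z)) \<partial>\<kappa>)"
        using nn_integral_distr[of "\<lambda>w. w i" "PiM {..<M} (\<lambda>_. \<kappa>)" \<kappa> "\<lambda>z. ennreal (cX (fst z) (snd z))"] by simp
    qed
    also have "\<dots> = of_nat M * (\<integral>\<^sup>+ z. ennreal (c (fst z) (snd z)) \<partial>\<kappa>)"
    proof -
      have "(\<integral>\<^sup>+ z. ennreal (cX (fst z) (snd z)) \<partial>\<kappa>) = (\<integral>\<^sup>+ z. ennreal (c (fst z) (snd z)) \<partial>\<kappa>)"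
      proof (rule nn_integral_cong_AE)
        show "AE z in \<kappa>. ennreal (cX (fst z) (snd z)) = ennreal (c (fst z) (snd z))"
          using ak by eventually_elim (simp add: cX_def)
      qed
      then show ?thesis by simp
    qed
    also have "\<dots> \<le> of_nat M * ennreal (\<rho> + e / M)" using kcost by (intro mult_left_mono) auto
    also have "\<dots> = ennreal (real M * \<rho> + e)"
      using M e \<rho>_pos by (simp add: ennreal_of_nat_eq_real_of_nat ennreal_mult[symmetric] distrib_left)
    also have "\<dots> = ennreal (real M * \<rho>) + ennreal e" using e \<rho>_pos by (simp add: ennreal_plus)
    finally show "OT (costM M c) (prodM M Q) (prodM M P) \<le> ennreal (real M * \<rho>) + ennreal e" .
  qed
  show ?thesis using 1 2 3 by (simp add: ballM_def OTball_def)
qed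

lemma distr_prodM_prN:
  assumes "prob_space Q" "sets Q = sets borel" "N \<le> M"
  shows "distr (prodM M Q) (spaceM N) (prN N) = prodM N Q"
proof -
  have "prodM N Q = distr (prodM M Q) (prodM N Q) (prN N)"
    unfolding prodM_def prN_def[abs_def]
    using distr_PiM_reindex[of "{..<M}" "\<lambda>_. Q" "\<lambda>i. i" "{..<N}"] assms by auto
  also have "\<dots> = distr (prodM M Q) (spaceM N) (prN N)"
    by (intro distr_cong refl) (simp add: sets_prodM[OF assms(2)])
  finally show ?thesis by simp
qed

lemma product_in_U_inf:
  assumes Q: "Q \<in> OTball borel X c \<rho> P" shows "prodM N Q \<in> U_inf X c \<rho> P N"
  unfolding U_inf_def
proof (intro INT_I)
  have sQ: "sets Q = sets borel" and pQ: "prob_space Q" using Q by (auto simp: OTball_def probs_on_def)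
  fix M assume "M \<in> {N..}"
  then have M: "N \<le> M" "0 < M" using N_pos by auto
  show "prodM N Q \<in> U_set X c \<rho> P N M"
    unfolding U_set_def
  proof (rule image_eqI)
    show "prodM N Q = distr (prodM M Q) (spaceM N) (prN N)" using distr_prodM_prN[OF pQ sQ M(1)] by simp
    show "prodM M Q \<in> {Pb \<in> ballM X c \<rho> P M. symmetric_measure M Pb}"
      using product_in_ball[OF Q M(2)] distr_prodM_permute[OF pQ sQ] by (simp add: symmetric_measure_def)
  qed
qed

lemma Exp_on_lX: "Exp_on (tup N X) Q l = ext_integral Q lX"
  by (simp add: Exp_on_def lX_def[abs_def])

lemma S_le_U_inf: "S_val X c \<rho> P N l \<le> (SUP Pb \<in> U_inf X c \<rho> P N. Exp_on (tup N X) Pb l)"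
  unfolding S_val_def by (intro SUP_least SUP_upper product_in_U_inf)

section \<open>Integrability of the loss on transport balls\<close>

lemma ball_facts:
  assumes Pb: "Pb \<in> ballM X c \<rho> P M"
  shows "sets Pb = sets (spaceM M)" "prob_space Pb" "AE x in Pb. x \<in> tup M X"
    and "i < M \<Longrightarrow> (\<integral>\<^sup>+ x. ennreal (cX z0 (x i)) \<partial>Pb) < \<infinity>"
proof -
  show s[measurable_cong]: "sets Pb = sets (spaceM M)" and p: "prob_space Pb"
    using Pb by (auto simp: ballM_def OTball_def probs_on_def)
  have t: "emeasure Pb (tup M X) = 1" and mo: "finite_moment (costM M c) (tup M X) Pb"
    using Pb by (auto simp: ballM_def OTball_def probs_on_def)
  interpret prob_space Pb by (rule p)
  show a: "AE x in Pb. x \<in> tup M X"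
    using t sets_tup[OF X_sets, of M] s by (intro prob_eq_1[THEN iffD1]) (auto simp: emeasure_eq_measure)
  show "(\<integral>\<^sup>+ x. ennreal (cX z0 (x i)) \<partial>Pb) < \<infinity>" if i: "i < M"
  proof -
    obtain x0 where x0: "x0 \<in> tup M X" "(\<integral>\<^sup>+ x. ennreal (costM M c x0 x) \<partial>Pb) < \<infinity>"
      using mo by (auto simp: finite_moment_def)
    have xi: "x0 i \<in> X" using x0(1) i by (auto simp: tup_def PiE_iff)
    have [measurable]: "(\<lambda>x. x i) \<in> borel_measurable Pb"
      unfolding measurable_cong_sets[OF s refl] by (rule measurable_coord[OF i])
    have "(\<integral>\<^sup>+ x. ennreal (cX (x0 i) (x i)) \<partial>Pb) \<le> (\<integral>\<^sup>+ x. ennreal (costM M c x0 x) \<partial>Pb)"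
    proof (rule nn_integral_mono_AE)
      show "AE x in Pb. ennreal (cX (x0 i) (x i)) \<le> ennreal (costM M c x0 x)"
        using a
      proof eventually_elim
        case (elim x)
        have "costM M c x0 x = (\<Sum>i<M. cX (x0 i) (x i))"
          unfolding costM_def using elim x0(1) by (intro sum.cong) (auto simp: cX_def tup_def PiE_iff)
        also have "\<dots> \<ge> cX (x0 i) (x i)" using i cX_nonneg by (intro member_le_sum) auto
        finally show ?case by (rule ennreal_leI)
      qed
    qed
    then have fin: "(\<integral>\<^sup>+ x. ennreal (cX (x0 i) (x i)) \<partial>Pb) < \<infinity>" using x0(2) by (rule le_less_trans)
    have "(\<integral>\<^sup>+ x. ennreal (cX z0 (x i)) \<partial>Pb) \<le> (\<integral>\<^sup>+ x. ennreal K * (ennreal (cX z0 (x0 i)) + ennreal (cX (x0 i) (x i))) \<partial>Pb)"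
    proof (rule nn_integral_mono_AE)
      show "AE x in Pb. ennreal (cX z0 (x i)) \<le> ennreal K * (ennreal (cX z0 (x0 i)) + ennreal (cX (x0 i) (x i)))"
        using a
      proof eventually_elim
        case (elim x)
        have "x i \<in> X" using elim i by (auto simp: tup_def PiE_iff)
        then have "ennreal (cX z0 (x i)) \<le> ennreal (K * (cX z0 (x0 i) + cX (x0 i) (x i)))"
          using cX_triangle[OF z0 _ xi] by (intro ennreal_leI) simp
        then show ?case using K_pos cX_nonneg by (simp add: ennreal_mult ennreal_plus)
      qed
    qed
    also have "\<dots> = ennreal K * (ennreal (cX z0 (x0 i)) + (\<integral>\<^sup>+ x. ennreal (cX (x0 i) (x i)) \<partial>Pb))"
      by (subst nn_integral_cmult, measurable, subst nn_integral_add) (simp_all add: emeasure_space_1)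
    also have "\<dots> < \<infinity>" using fin by (simp add: ennreal_mult_less_top)
    finally show ?thesis .
  qed
qed

lemma permute_tup: "x \<in> tup M X \<Longrightarrow> \<sigma> \<in> perms M \<Longrightarrow> permute M \<sigma> x \<in> tup M X"
  using permutes_in_image[of \<sigma> "{..<M}"] by (auto simp: tup_def permute_def perms_def PiE_iff)

lemma prN_tup: "x \<in> tup M X \<Longrightarrow> N \<le> M \<Longrightarrow> prN N x \<in> tup N X"
  by (auto simp: tup_def prN_def PiE_iff)

lemma l_permuted_measurable:
  assumes "N \<le> M" "\<sigma> \<in> perms M"
  shows "(\<lambda>x. lX (prN N (permute M \<sigma> x))) \<in> borel_measurable (spaceM M)"
  by (rule measurable_compose[OF measurable_compose[OF measurable_permute[OF assms(2)] measurable_prN[OF assms(1)]] lX_measurable])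

lemma ball_lX_pos_finite:
  assumes Pb: "Pb \<in> ballM X c \<rho> P M" and NM: "N \<le> M" and s: "\<sigma> \<in> perms M"
  shows "(\<integral>\<^sup>+ x. ennreal (lX (prN N (permute M \<sigma> x))) \<partial>Pb) < \<infinity>"
proof -
  note bf = ball_facts[OF Pb]
  interpret prob_space Pb by (rule bf(2))
  obtain C where C: "0 \<le> C" "\<And>x. x \<in> tup N X \<Longrightarrow> l x \<le> C * (1 + (\<Sum>i<N. cX z0 (x i)))"
    using l_linear_growth by blast
  have si: "\<sigma> i < M" if "i < N" for i using that NM s permutes_in_image[of \<sigma> "{..<M}" i] by (auto simp: perms_def)
  have m: "(\<lambda>x. ennreal (cX z0 (x (\<sigma> i)))) \<in> borel_measurable Pb" if "i \<in> {..<N}" for i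
  proof -
    have "\<sigma> i < M" using si that by simp
    note measurable_coord[OF this, measurable]
    show ?thesis unfolding measurable_cong_sets[OF bf(1) refl] by measurable
  qed
  have ms: "(\<lambda>x. \<Sum>i<N. ennreal (cX z0 (x (\<sigma> i)))) \<in> borel_measurable Pb" using m by (rule borel_measurable_sum)
  have "(\<integral>\<^sup>+ x. ennreal (lX (prN N (permute M \<sigma> x))) \<partial>Pb)
      \<le> (\<integral>\<^sup>+ x. ennreal C * (1 + (\<Sum>i<N. ennreal (cX z0 (x (\<sigma> i))))) \<partial>Pb)"
  proof (rule nn_integral_mono_AE)
    show "AE x in Pb. ennreal (lX (prN N (permute M \<sigma> x))) \<le> ennreal C * (1 + (\<Sum>i<N. ennreal (cX z0 (x (\<sigma> i)))))"
      using bf(3)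
    proof eventually_elim
      case (elim x)
      define w where "w = prN N (permute M \<sigma> x)"
      have w: "w \<in> tup N X" unfolding w_def by (rule prN_tup[OF permute_tup[OF elim s] NM])
      have wi: "w i = x (\<sigma> i)" if "i < N" for i using that NM by (simp add: w_def prN_def permute_def)
      have "ennreal (lX w) \<le> ennreal (C * (1 + (\<Sum>i<N. cX z0 (x (\<sigma> i)))))"
        using C(2)[OF w] w wi by (intro ennreal_leI) (simp add: lX_def)
      also have "\<dots> = ennreal C * (1 + (\<Sum>i<N. ennreal (cX z0 (x (\<sigma> i)))))"
        using C(1) cX_nonneg by (simp add: ennreal_mult ennreal_plus sum_nonneg sum_ennreal)
      finally show ?case by (simp add: w_def)
    qed
  qed
  also have "\<dots> = ennreal C * (1 + (\<integral>\<^sup>+ x. (\<Sum>i<N. ennreal (cX z0 (x (\<sigma> i)))) \<partial>Pb))"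
    using ms by (subst nn_integral_cmult, measurable, subst nn_integral_add) (simp_all add: emeasure_space_1)
  also have "(\<integral>\<^sup>+ x. (\<Sum>i<N. ennreal (cX z0 (x (\<sigma> i)))) \<partial>Pb) = (\<Sum>i<N. \<integral>\<^sup>+ x. ennreal (cX z0 (x (\<sigma> i))) \<partial>Pb)"
    using m by (rule nn_integral_sum)
  also have "ennreal C * (1 + \<dots>) < \<infinity>"
    using bf(4)[OF si] by (auto simp: ennreal_mult_less_top)
  finally show ?thesis .
qed

text \<open>A measurable stand-in for \<open>sym_fun N M l\<close>, built from \<open>lX\<close>;
  for \<open>N \<le> M\<close> the two agree on \<open>tup M X\<close>.\<close>

definition lsym :: "nat \<Rightarrow> (nat \<Rightarrow> 'a) \<Rightarrow> real" where
  "lsym M x = (\<Sum>\<sigma>\<in>perms M. lX (prN N (permute M \<sigma> x))) / fact M"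

lemma Exp_on_lsym:
  assumes Pb: "Pb \<in> ballM X c \<rho> P M" and NM: "N \<le> M"
  shows "Exp_on (tup M X) Pb (sym_fun N M l) = ext_integral Pb (lsym M)"
  unfolding Exp_on_def
proof (rule ext_integral_cong_AE)
  show "AE x in Pb. (if x \<in> tup M X then sym_fun N M l x else 0) = lsym M x"
    using ball_facts(3)[OF Pb]
  proof eventually_elim
    case (elim x)
    have "prN N (permute M \<sigma> x) \<in> tup N X" if "\<sigma> \<in> perms M" for \<sigma>
      by (rule prN_tup[OF permute_tup[OF elim that] NM])
    then show ?case using elim by (simp add: sym_fun_def lsym_def lX_def)
  qed
qed

lemma lsym_measurable: "N \<le> M \<Longrightarrow> lsym M \<in> borel_measurable (spaceM M)"
  unfolding lsym_def[abs_def] by (intro borel_measurable_divide borel_measurable_sum l_permuted_measurable) auto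

lemma ball_lsym_pos_finite:
  assumes Pb: "Pb \<in> ballM X c \<rho> P M" and NM: "N \<le> M"
  shows "(\<integral>\<^sup>+ x. ennreal (lsym M x) \<partial>Pb) < \<infinity>"
proof -
  note s = ball_facts(1)[OF Pb]
  have m: "(\<lambda>x. ennreal (lX (prN N (permute M \<sigma> x)))) \<in> borel_measurable Pb" if "\<sigma> \<in> perms M" for \<sigma>
    using l_permuted_measurable[OF NM that] unfolding measurable_cong_sets[OF s refl] by measurable
  have "(\<integral>\<^sup>+ x. ennreal (lsym M x) \<partial>Pb) \<le> (\<integral>\<^sup>+ x. (\<Sum>\<sigma>\<in>perms M. ennreal (lX (prN N (permute M \<sigma> x)))) \<partial>Pb)"
  proof (rule nn_integral_mono)
    fix x
    define a where "a \<sigma> = lX (prN N (permute M \<sigma> x))" for \<sigma>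
    define s where "s = (\<Sum>\<sigma>\<in>perms M. max 0 (a \<sigma>))"
    have s0: "0 \<le> s" unfolding s_def by (simp add: sum_nonneg)
    have le: "(\<Sum>\<sigma>\<in>perms M. a \<sigma>) \<le> s" unfolding s_def by (rule sum_mono) simp
    have "lsym M x = (\<Sum>\<sigma>\<in>perms M. a \<sigma>) / fact M" by (simp add: lsym_def a_def)
    also have "\<dots> \<le> s / fact M" using le by (rule divide_right_mono) simp
    also have "\<dots> \<le> s / 1" using s0 by (intro divide_left_mono) (auto simp: fact_ge_1)
    finally have "lsym M x \<le> s" by simp
    then have "ennreal (lsym M x) \<le> ennreal s" by (rule ennreal_leI)
    also have "\<dots> = (\<Sum>\<sigma>\<in>perms M. ennreal (max 0 (a \<sigma>)))" unfolding s_def by (rule sum_ennreal[symmetric]) simp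
    also have "\<dots> = (\<Sum>\<sigma>\<in>perms M. ennreal (a \<sigma>))" by (intro sum.cong) (auto simp: max_def ennreal_neg)
    finally show "ennreal (lsym M x) \<le> (\<Sum>\<sigma>\<in>perms M. ennreal (lX (prN N (permute M \<sigma> x))))" by (simp add: a_def)
  qed
  also have "\<dots> = (\<Sum>\<sigma>\<in>perms M. \<integral>\<^sup>+ x. ennreal (lX (prN N (permute M \<sigma> x))) \<partial>Pb)" using m by (rule nn_integral_sum)
  also have "\<dots> < \<infinity>" using ball_lX_pos_finite[OF Pb NM] finite_perms[of M] by (simp add: less_top[symmetric])
  finally show ?thesis .
qed

text \<open>Under a product measure any \<open>N\<close> distinct coordinates have the same product
  law, so each permuted summand, and with it the symmetrised loss, has the mean of \<open>l\<close>.
  If that mean is \<open>- \<infinity>\<close>, nothing has to be shown.\<close>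

lemma S_le_U_sym:
  assumes NM: "N \<le> M" shows "S_val X c \<rho> P N l \<le> U_sym X c \<rho> P N l M"
  unfolding S_val_def
proof (rule SUP_least)
  fix Q assume Q: "Q \<in> OTball borel X c \<rho> P"
  have sQ: "sets Q = sets borel" and pQ: "prob_space Q" using Q by (auto simp: OTball_def probs_on_def)
  have M: "0 < M" using NM N_pos by simp
  have QN: "prodM N Q \<in> ballM X c \<rho> P N" using product_in_ball[OF Q] N_pos by simp
  have QM: "prodM M Q \<in> ballM X c \<rho> P M" by (rule product_in_ball[OF Q M])
  have ln: "lX \<in> borel_measurable (prodM N Q)" unfolding measurable_cong_sets[OF sets_prodM[OF sQ] refl] by measurable
  have idN: "id \<in> perms N" by (simp add: perms_def permutes_id)
  have "(\<integral>\<^sup>+ x. ennreal (lX x) \<partial>prodM N Q) = (\<integral>\<^sup>+ x. ennreal (lX (prN N (permute N id x))) \<partial>prodM N Q)"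
  proof (rule nn_integral_cong)
    fix x assume "x \<in> space (prodM N Q)"
    then have "prN N (permute N id x) = x" by (auto simp: prN_def permute_def space_prodM[OF sQ] extensional_restrict)
    then show "ennreal (lX x) = ennreal (lX (prN N (permute N id x)))" by simp
  qed
  then have fin: "(\<integral>\<^sup>+ x. ennreal (lX x) \<partial>prodM N Q) < \<infinity>" using ball_lX_pos_finite[OF QN order_refl idN] by simp
  have le: "Exp_on (tup M X) (prodM M Q) (sym_fun N M l) \<le> U_sym X c \<rho> P N l M"
    unfolding U_sym_def by (rule SUP_upper[OF QM])
  from ext_integral_cases[OF ln fin]
  show "Exp_on (tup N X) (prodM N Q) l \<le> U_sym X c \<rho> P N l M"
  proof
    assume i: "integrable (prodM N Q) lX \<and> ext_integral (prodM N Q) lX = ereal (\<integral>x. lX x \<partial>prodM N Q)"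
    have each: "integrable (prodM M Q) (\<lambda>x. lX (prN N (permute M \<sigma> x)))"
      "(\<integral>x. lX (prN N (permute M \<sigma> x)) \<partial>prodM M Q) = (\<integral>x. lX x \<partial>prodM N Q)" if s: "\<sigma> \<in> perms M" for \<sigma>
    proof -
      note sM = sets_prodM[OF sQ, of M]
      have pm: "permute M \<sigma> \<in> measurable (prodM M Q) (spaceM M)"
        unfolding measurable_cong_sets[OF sM refl] by (rule measurable_permute[OF s])
      have pp: "(\<lambda>x. prN N (permute M \<sigma> x)) \<in> measurable (prodM M Q) (spaceM N)"
        by (rule measurable_compose[OF pm measurable_prN[OF NM]])
      have "distr (prodM M Q) (spaceM N) (\<lambda>x. prN N (permute M \<sigma> x)) = distr (distr (prodM M Q) (spaceM M) (permute M \<sigma>)) (spaceM N) (prN N)"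
        by (subst distr_distr[OF measurable_prN[OF NM] pm]) (simp add: comp_def)
      also have "\<dots> = prodM N Q" unfolding distr_prodM_permute[OF pQ sQ s] by (rule distr_prodM_prN[OF pQ sQ NM])
      finally have d: "distr (prodM M Q) (spaceM N) (\<lambda>x. prN N (permute M \<sigma> x)) = prodM N Q" .
      show "integrable (prodM M Q) (\<lambda>x. lX (prN N (permute M \<sigma> x)))"
        using i integrable_distr_eq[OF pp lX_measurable] unfolding d by simp
      show "(\<integral>x. lX (prN N (permute M \<sigma> x)) \<partial>prodM M Q) = (\<integral>x. lX x \<partial>prodM N Q)"
        using integral_distr[OF pp lX_measurable] unfolding d by simp
    qed
    have "integrable (prodM M Q) (lsym M)" unfolding lsym_def[abs_def] using each(1) by auto
    moreover have "(\<integral>x. lsym M x \<partial>prodM M Q) = (\<integral>x. lX x \<partial>prodM N Q)"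
      unfolding lsym_def using each by (simp add: card_perms)
    ultimately have "ext_integral (prodM M Q) (lsym M) = ext_integral (prodM N Q) lX"
      using i ext_integral_eq by metis
    then show ?thesis using le by (simp add: Exp_on_lX Exp_on_lsym[OF QM NM])
  qed (simp add: Exp_on_lX)
qed


text \<open>Beyond some \<open>r0\<close> the quotient \<open>\<delta> r / r\<close> is below any
  prescribed \<open>\<eta>'\<close>, and below \<open>r0\<close> the bound
  \<open>\<delta> r \<le> r\<close> suffices. An arbitrarily small multiple of the cost therefore
  controls \<open>l\<close>, which is the source of uniform integrability in the second
  claim.\<close>

lemma growth_lt_absorb:
  assumes "growth_lt N X c l" "0 < (\<eta>::real)"
  shows "\<exists>A\<ge>0. \<forall>x\<in>tup N X. l x \<le> A + \<eta> * (\<Sum>i<N. cX z0 (x i))"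
proof -
  obtain C \<delta> xh where C: "C > 0" and d: "\<delta> \<in> Dfuns" and xh: "xh \<in> tup N X"
    and gr: "\<And>x. x \<in> tup N X \<Longrightarrow> l x \<le> C * (1 + \<delta> (costM N c xh x))"
    using assms(1) by (auto simp: growth_lt_def)
  \<comment> \<open>\<open>K\<close> is lost when the base point moves to \<open>z0\<close>, and
    \<open>C\<close> is the growth constant; dividing by both leaves exactly \<open>\<eta>\<close>
    in front of the sum.\<close>
  define \<eta>' where "\<eta>' = \<eta> / (C * K)"
  have e': "0 < \<eta>'" unfolding \<eta>'_def using assms(2) C K_pos by simp
  have "((\<lambda>r. \<delta> r / r) \<longlongrightarrow> 0) at_top" using d by (simp add: Dfuns_def)
  then have "eventually (\<lambda>r. \<delta> r / r < \<eta>') at_top" using e' by (rule order_tendstoD)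
  then obtain r1 where r1: "\<And>r. r1 \<le> r \<Longrightarrow> \<delta> r / r < \<eta>'" by (auto simp: eventually_at_top_linorder)
  define r0 where "r0 = max 1 r1"
  have dr: "\<delta> r \<le> r0 + \<eta>' * r" if "0 \<le> r" for r
  proof (cases "r0 \<le> r")
    case True
    then have "0 < r" "\<delta> r / r < \<eta>'" using r1[of r] by (auto simp: r0_def)
    then have "\<delta> r < \<eta>' * r" by (simp add: pos_divide_less_eq)
    moreover have "0 \<le> r0" by (simp add: r0_def)
    ultimately show ?thesis by linarith
  next
    case False
    have "\<delta> r \<le> r" using d that by (auto simp: Dfuns_def)
    moreover have "0 \<le> \<eta>' * r" using e' that by simp
    ultimately show ?thesis using False by linarith
  qed
  define b where "b = K * (\<Sum>i<N. cX (xh i) z0)"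
  have b: "0 \<le> b" unfolding b_def using K_pos cX_nonneg by (simp add: sum_nonneg)
  have "l x \<le> C * (1 + r0 + \<eta>' * b) + \<eta> * (\<Sum>i<N. cX z0 (x i))" if x: "x \<in> tup N X" for x
  proof -
    define s where "s = (\<Sum>i<N. cX z0 (x i))"
    have q0: "0 \<le> costM N c xh x"
      unfolding costM_def using xh x tc by (intro sum_nonneg) (auto simp: tup_def PiE_iff transport_cost_def)
    have "costM N c xh x \<le> b + K * s" using growth_at_z0[OF xh x] by (simp add: b_def s_def)
    then have "\<eta>' * costM N c xh x \<le> \<eta>' * (b + K * s)" using e' by (intro mult_left_mono) auto
    then have "1 + \<delta> (costM N c xh x) \<le> 1 + r0 + \<eta>' * (b + K * s)" using dr[OF q0] by linarith
    then have "C * (1 + \<delta> (costM N c xh x)) \<le> C * (1 + r0 + \<eta>' * (b + K * s))" using C by (intro mult_left_mono) auto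
    also have "\<dots> = C * (1 + r0 + \<eta>' * b) + (C * K * \<eta>') * s" by (simp add: algebra_simps)
    also have "C * K * \<eta>' = \<eta>" unfolding \<eta>'_def using C K_pos by simp
    finally show ?thesis using gr[OF x] by (simp add: s_def)
  qed
  moreover have "0 \<le> C * (1 + r0 + \<eta>' * b)" using C b e' by (simp add: r0_def)
  ultimately show ?thesis by blast
qed

text \<open>\<open>Pb\<close> has symmetric extensions in every dimension \<open>M \<ge> N\<close>.
  Symmetrising their couplings leaves \<open>Pb\<close> as the law of the first \<open>N\<close>
  coordinates of \<open>x\<close>, so the tail condition \<open>ui\<close> concerns one fixed law
  and follows from integrability of its positive part.\<close>

lemma U_inf_le_S:
  assumes Pb: "Pb \<in> U_inf X c \<rho> P N"
  shows "Exp_on (tup N X) Pb l \<le> S_val X c \<rho> P N l"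
proof -
  have "\<exists>Pk. Pk \<in> ballM X c \<rho> P M \<and> symmetric_measure M Pk \<and> Pb = distr Pk (spaceM N) (prN N)" if "N \<le> M" for M
    using Pb that unfolding U_inf_def U_set_def by blast
  then obtain Q where Q: "\<And>M. N \<le> M \<Longrightarrow> Q M \<in> ballM X c \<rho> P M" "\<And>M. N \<le> M \<Longrightarrow> symmetric_measure M (Q M)"
    "\<And>M. N \<le> M \<Longrightarrow> Pb = distr (Q M) (spaceM N) (prN N)" by metis
  have sPb: "sets Pb = sets (spaceM N)" using Q(3)[of N] by simp
  have lm: "lX \<in> borel_measurable Pb" unfolding measurable_cong_sets[OF sPb refl] by measurable
  have Qsym: "(\<integral>\<^sup>+ x. h (prN N (permute M \<sigma> x)) \<partial>Q M) = (\<integral>\<^sup>+ x. h x \<partial>Pb)"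
    if M: "N \<le> M" and s: "\<sigma> \<in> perms M" and h: "h \<in> borel_measurable (spaceM N)" for h M \<sigma>
  proof -
    have sQ: "sets (Q M) = sets (spaceM M)" by (rule ball_facts(1)[OF Q(1)[OF M]])
    have pm: "permute M \<sigma> \<in> measurable (Q M) (spaceM M)"
      unfolding measurable_cong_sets[OF sQ refl] by (rule measurable_permute[OF s])
    have pn: "prN N \<in> measurable (Q M) (spaceM N)"
      unfolding measurable_cong_sets[OF sQ refl] by (rule measurable_prN[OF M])
    have hp: "(\<lambda>x. h (prN N x)) \<in> borel_measurable (spaceM M)" by (rule measurable_compose[OF measurable_prN[OF M] h])
    have "(\<integral>\<^sup>+ x. h (prN N (permute M \<sigma> x)) \<partial>Q M) = (\<integral>\<^sup>+ x. h (prN N x) \<partial>distr (Q M) (spaceM M) (permute M \<sigma>))"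
      using hp by (intro nn_integral_distr[OF pm, symmetric]) simp
    also have "distr (Q M) (spaceM M) (permute M \<sigma>) = Q M" using Q(2)[OF M] s by (simp add: symmetric_measure_def)
    also have "(\<integral>\<^sup>+ x. h (prN N x) \<partial>Q M) = (\<integral>\<^sup>+ x. h x \<partial>distr (Q M) (spaceM N) (prN N))"
      using h by (intro nn_integral_distr[OF pn, symmetric]) simp
    finally show ?thesis unfolding Q(3)[OF M, symmetric] .
  qed
  have fin: "(\<integral>\<^sup>+ x. ennreal (lX x) \<partial>Pb) < \<infinity>"
  proof -
    have idN: "id \<in> perms N" by (simp add: perms_def permutes_id)
    have "(\<lambda>x. ennreal (lX x)) \<in> borel_measurable (spaceM N)" by measurable
    then show ?thesis
      using Qsym[OF order_refl idN, of "\<lambda>x. ennreal (lX x)"] ball_lX_pos_finite[OF Q(1)[OF order_refl] order_refl idN] by simp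
  qed
  from ext_integral_cases[OF lm fin]
  show ?thesis
  proof
    assume i: "integrable Pb lX \<and> ext_integral Pb lX = ereal (\<integral>x. lX x \<partial>Pb)"
    define M where "M k = 4096 ^ k * N" for k
    have NM: "N \<le> M k" for k by (simp add: M_def)
    have M0: "0 < M k" for k using NM[of k] N_pos by simp
    have ex: "\<exists>\<mu>. exch_plan X P (M k) \<mu> \<and> (\<integral>\<^sup>+ z. ennreal (cX (fst z 0) (snd z 0)) \<partial>\<mu>) \<le> ennreal (\<rho> + 1 / real (k + 1)) \<and>
        (\<forall>h\<in>borel_measurable (spaceM N). (\<integral>\<^sup>+ z. h (prN N (fst z)) \<partial>\<mu>) = (\<integral>\<^sup>+ x. h x \<partial>Pb))" for k
    proof -
      have e: "0 < 1 / real (k + 1)" by simp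
      obtain \<mu> where mu: "exch_plan X P (M k) \<mu>"
        "\<And>i. i < M k \<Longrightarrow> (\<integral>\<^sup>+ z. ennreal (cX (fst z i) (snd z i)) \<partial>\<mu>) \<le> ennreal (\<rho> + 1 / real (k + 1))"
        "\<And>h. h \<in> borel_measurable (spaceM (M k)) \<Longrightarrow> (\<integral>\<^sup>+ z. h (fst z) \<partial>\<mu>)
          = (\<Sum>\<sigma>\<in>perms (M k). ennreal (1 / fact (M k)) * (\<integral>\<^sup>+ x. h (permute (M k) \<sigma> x) \<partial>Q (M k)))"
        by (rule symmetrized_plan[OF Q(1)[OF NM] M0 e]) (rule that)
      have "(\<integral>\<^sup>+ z. h (prN N (fst z)) \<partial>\<mu>) = (\<integral>\<^sup>+ x. h x \<partial>Pb)" if h: "h \<in> borel_measurable (spaceM N)" for h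
      proof -
        have "(\<lambda>x. h (prN N x)) \<in> borel_measurable (spaceM (M k))" by (rule measurable_compose[OF measurable_prN[OF NM] h])
        from mu(3)[OF this] have "(\<integral>\<^sup>+ z. h (prN N (fst z)) \<partial>\<mu>)
            = (\<Sum>\<sigma>\<in>perms (M k). ennreal (1 / fact (M k)) * (\<integral>\<^sup>+ x. h (prN N (permute (M k) \<sigma> x)) \<partial>Q (M k)))" .
        also have "\<dots> = (\<Sum>\<sigma>\<in>perms (M k). ennreal (1 / fact (M k)) * (\<integral>\<^sup>+ x. h x \<partial>Pb))"
          by (intro sum.cong refl) (simp add: Qsym[OF NM _ h])
        also have "\<dots> = (\<integral>\<^sup>+ x. h x \<partial>Pb)" by (rule sum_perms_const)
        finally show ?thesis .
      qed
      then show ?thesis using mu(1) mu(2)[OF M0] by blast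
    qed
    obtain \<mu> where mu: "\<forall>k. exch_plan X P (M k) (\<mu> k) \<and>
        (\<integral>\<^sup>+ z. ennreal (cX (fst z 0) (snd z 0)) \<partial>\<mu> k) \<le> ennreal (\<rho> + 1 / real (k + 1)) \<and>
        (\<forall>h\<in>borel_measurable (spaceM N). (\<integral>\<^sup>+ z. h (prN N (fst z)) \<partial>\<mu> k) = (\<integral>\<^sup>+ x. h x \<partial>Pb))"
      by (atomize_elim, intro choice allI ex)
    have plan: "\<And>k. exch_plan X P (M k) (\<mu> k)"
      and cost: "\<And>k. (\<integral>\<^sup>+ z. ennreal (cX (fst z 0) (snd z 0)) \<partial>\<mu> k) \<le> ennreal (\<rho> + 1 / real (k + 1))"
      and law: "\<And>k h. h \<in> borel_measurable (spaceM N) \<Longrightarrow> (\<integral>\<^sup>+ z. h (prN N (fst z)) \<partial>\<mu> k) = (\<integral>\<^sup>+ x. h x \<partial>Pb)"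
      using mu by auto
    have Xm: "(\<lambda>z. prN N (fst z)) \<in> measurable (\<mu> k) (spaceM N)" for k
      unfolding measurable_cong_sets[OF plan_facts(2)[OF plan] refl]
      by (rule measurable_compose[OF measurable_fst measurable_prN[OF NM]])
    have d: "distr (\<mu> k) (spaceM N) (\<lambda>z. prN N (fst z)) = Pb" for k
    proof (rule measure_eqI)
      show "sets (distr (\<mu> k) (spaceM N) (\<lambda>z. prN N (fst z))) = sets Pb" using sPb by simp
      fix A assume "A \<in> sets (distr (\<mu> k) (spaceM N) (\<lambda>z. prN N (fst z)))"
      then have A: "A \<in> sets (spaceM N)" by simp
      have "emeasure (distr (\<mu> k) (spaceM N) (\<lambda>z. prN N (fst z))) A = (\<integral>\<^sup>+ x. indicator A x \<partial>distr (\<mu> k) (spaceM N) (\<lambda>z. prN N (fst z)))"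
        using A by simp
      also have "\<dots> = (\<integral>\<^sup>+ z. indicator A (prN N (fst z)) \<partial>\<mu> k)" using A by (intro nn_integral_distr[OF Xm]) simp
      also have "\<dots> = (\<integral>\<^sup>+ x. indicator A x \<partial>Pb)" using A by (intro law) simp
      also have "\<dots> = emeasure Pb A" using A sPb by simp
      finally show "emeasure (distr (\<mu> k) (spaceM N) (\<lambda>z. prN N (fst z))) A = emeasure Pb A" .
    qed
    have "ereal (\<integral>x. lX x \<partial>Pb) \<le> S_val X c \<rho> P N l"
    proof (rule plans_le_S_val[OF plan _ cost])
      show "4096 ^ k * N \<le> M k" for k by (simp add: M_def)
      show "integrable (\<mu> k) (\<lambda>z. lX (prN N (fst z)))" for k
        using i integrable_distr_eq[OF Xm lX_measurable, of k] unfolding d by simp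
      show "(\<integral>x. lX x \<partial>Pb) \<le> (\<integral>z. lX (prN N (fst z)) \<partial>\<mu> k)" for k
        using integral_distr[OF Xm lX_measurable, of k] unfolding d by simp
      fix \<epsilon> :: real assume "0 < \<epsilon>"
      then obtain A where A: "0 \<le> A" "(\<integral>\<^sup>+ x. ennreal (lX x - A) \<partial>Pb) \<le> ennreal \<epsilon>"
        using nn_integral_tail_small[OF lm fin] by blast
      have "(\<lambda>x. ennreal (lX x - A)) \<in> borel_measurable (spaceM N)" by measurable
      from law[OF this] A show "\<exists>A\<ge>0. \<forall>k. (\<integral>\<^sup>+ z. ennreal (lX (prN N (fst z)) - A) \<partial>\<mu> k) \<le> ennreal \<epsilon>"
        by (intro exI[of _ A]) simp
    qed
    then show ?thesis using i by (simp add: Exp_on_lX)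
  qed (simp add: Exp_on_lX)
qed

text \<open>Integrability is given for the average over permutations only. All positive parts are
  integrable by linear growth, and a summand is the total minus the others, so its negative part is
  bounded by the absolute total plus the positive parts of the others.\<close>

lemma ball_lX_integrable:
  assumes Q: "Q \<in> ballM X c \<rho> P M" and NM: "N \<le> M" and i: "integrable Q (lsym M)" and s: "\<sigma> \<in> perms M"
  shows "integrable Q (\<lambda>x. lX (prN N (permute M \<sigma> x)))"
proof -
  note sQ = ball_facts(1)[OF Q]
  define a where "a \<tau> x = lX (prN N (permute M \<tau> x))" for \<tau> x
  have m: "a \<tau> \<in> borel_measurable Q" if "\<tau> \<in> perms M" for \<tau>
    unfolding a_def[abs_def] measurable_cong_sets[OF sQ refl] by (rule l_permuted_measurable[OF NM that])
  have posi: "integrable Q (\<lambda>x. max 0 (a \<tau> x))" if t: "\<tau> \<in> perms M" for \<tau>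
  proof (subst integrable_iff_bounded, intro conjI)
    show "(\<lambda>x. max 0 (a \<tau> x)) \<in> borel_measurable Q" using m[OF t] by simp
    have "(\<integral>\<^sup>+ x. ennreal (norm (max 0 (a \<tau> x))) \<partial>Q) = (\<integral>\<^sup>+ x. ennreal (a \<tau> x) \<partial>Q)"
      by (intro nn_integral_cong) (auto simp: max_def ennreal_neg)
    then show "(\<integral>\<^sup>+ x. ennreal (norm (max 0 (a \<tau> x))) \<partial>Q) < \<infinity>"
      using ball_lX_pos_finite[OF Q NM t] by (simp add: a_def)
  qed
  define b where "b x = (\<Sum>\<tau>\<in>perms M. max 0 (a \<tau> x)) + \<bar>fact M * lsym M x\<bar>" for x
  have bi: "integrable Q b" unfolding b_def using posi i by auto
  have "\<bar>a \<sigma> x\<bar> \<le> b x" for x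
  proof -
    have sum: "(\<Sum>\<tau>\<in>perms M. a \<tau> x) = fact M * lsym M x" by (simp add: lsym_def a_def)
    have "a \<sigma> x + (\<Sum>\<tau>\<in>perms M - {\<sigma>}. a \<tau> x) = fact M * lsym M x"
      using sum sum.remove[OF finite_perms s, of "\<lambda>\<tau>. a \<tau> x"] by simp
    moreover have "(\<Sum>\<tau>\<in>perms M - {\<sigma>}. a \<tau> x) \<le> (\<Sum>\<tau>\<in>perms M - {\<sigma>}. max 0 (a \<tau> x))" by (rule sum_mono) simp
    moreover have "(\<Sum>\<tau>\<in>perms M - {\<sigma>}. max 0 (a \<tau> x)) \<le> (\<Sum>\<tau>\<in>perms M. max 0 (a \<tau> x))"
      by (rule sum_mono2) (auto simp: finite_perms)
    moreover have "max 0 (a \<sigma> x) \<le> (\<Sum>\<tau>\<in>perms M. max 0 (a \<tau> x))"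
      by (rule member_le_sum[OF s]) (auto simp: finite_perms)
    ultimately show ?thesis unfolding b_def by linarith
  qed
  then have "integrable Q (a \<sigma>)"
    by (intro Bochner_Integration.integrable_bound[OF bi m[OF s]] AE_I2) (simp add: order_trans[OF _ abs_ge_self])
  then show ?thesis by (simp add: a_def[abs_def])
qed

text \<open>Stated for values exceeded at arbitrarily large \<open>M\<close>, this bounds the upper
  limit of \<open>U_sym\<close>. The candidates need not be symmetric; averaging their plans over
  permutations does to the law what \<open>sym_fun\<close> does to the loss. The tail condition
  comes from sublinear growth.\<close>

lemma U_sym_frequently_le_S:
  assumes gl: "growth_lt N X c l" and freq: "\<And>m. \<exists>M\<ge>m. ereal v < U_sym X c \<rho> P N l M"
  shows "ereal v \<le> S_val X c \<rho> P N l"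
proof -
  have "\<exists>M Q. 4096 ^ k * N \<le> M \<and> Q \<in> ballM X c \<rho> P M \<and> ereal v < Exp_on (tup M X) Q (sym_fun N M l)" for k
  proof -
    obtain M where "4096 ^ k * N \<le> M" "ereal v < U_sym X c \<rho> P N l M" using freq by blast
    then show ?thesis unfolding U_sym_def less_SUP_iff by blast
  qed
  then obtain M Q where M: "\<And>k. 4096 ^ k * N \<le> M k" and Q: "\<And>k. Q k \<in> ballM X c \<rho> P (M k)"
    and v: "\<And>k. ereal v < Exp_on (tup (M k) X) (Q k) (sym_fun N (M k) l)" by metis
  have NM: "N \<le> M k" for k by (rule order_trans[OF _ M[of k]]) simp
  have M0: "0 < M k" for k using NM[of k] N_pos by simp
  have li: "integrable (Q k) (lsym (M k))" "v \<le> (\<integral>x. lsym (M k) x \<partial>Q k)" for k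
  proof -
    have lm: "lsym (M k) \<in> borel_measurable (Q k)"
      unfolding measurable_cong_sets[OF ball_facts(1)[OF Q] refl] by (rule lsym_measurable[OF NM])
    have "ereal v < ext_integral (Q k) (lsym (M k))" using v[of k] by (simp add: Exp_on_lsym[OF Q NM])
    then show "integrable (Q k) (lsym (M k))" "v \<le> (\<integral>x. lsym (M k) x \<partial>Q k)"
      using ext_integral_cases[OF lm ball_lsym_pos_finite[OF Q NM]] by auto
  qed
  have ex: "\<exists>\<mu>. exch_plan X P (M k) \<mu> \<and>
      (\<forall>i<M k. (\<integral>\<^sup>+ z. ennreal (cX (fst z i) (snd z i)) \<partial>\<mu>) \<le> ennreal (\<rho> + 1 / real (k + 1))) \<and>
      (\<forall>h\<in>borel_measurable (spaceM (M k)). (\<integral>\<^sup>+ z. h (fst z) \<partial>\<mu>)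
        = (\<Sum>\<sigma>\<in>perms (M k). ennreal (1 / fact (M k)) * (\<integral>\<^sup>+ x. h (permute (M k) \<sigma> x) \<partial>Q k)))" for k
  proof -
    have e: "0 < 1 / real (k + 1)" by simp
    show ?thesis by (rule symmetrized_plan[OF Q M0 e]) blast
  qed
  obtain \<mu> where mu: "\<forall>k. exch_plan X P (M k) (\<mu> k) \<and>
      (\<forall>i<M k. (\<integral>\<^sup>+ z. ennreal (cX (fst z i) (snd z i)) \<partial>\<mu> k) \<le> ennreal (\<rho> + 1 / real (k + 1))) \<and>
      (\<forall>h\<in>borel_measurable (spaceM (M k)). (\<integral>\<^sup>+ z. h (fst z) \<partial>\<mu> k)
        = (\<Sum>\<sigma>\<in>perms (M k). ennreal (1 / fact (M k)) * (\<integral>\<^sup>+ x. h (permute (M k) \<sigma> x) \<partial>Q k)))"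
    by (atomize_elim, intro choice allI ex)
  have plan: "\<And>k. exch_plan X P (M k) (\<mu> k)"
    and cost: "\<And>k i. i < M k \<Longrightarrow> (\<integral>\<^sup>+ z. ennreal (cX (fst z i) (snd z i)) \<partial>\<mu> k) \<le> ennreal (\<rho> + 1 / real (k + 1))"
    and law: "\<And>k h. h \<in> borel_measurable (spaceM (M k)) \<Longrightarrow> (\<integral>\<^sup>+ z. h (fst z) \<partial>\<mu> k)
        = (\<Sum>\<sigma>\<in>perms (M k). ennreal (1 / fact (M k)) * (\<integral>\<^sup>+ x. h (permute (M k) \<sigma> x) \<partial>Q k))"
    using mu by auto
  note pf = plan_facts[OF plan]
  have Xm: "(\<lambda>z. prN N (fst z)) \<in> measurable (\<mu> k) (spaceM N)" for k
    unfolding measurable_cong_sets[OF pf(2) refl]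
    by (rule measurable_compose[OF measurable_fst measurable_prN[OF NM]])
  show ?thesis
  proof (rule plans_le_S_val[OF plan M cost[OF M0]])
    fix k
    define a where "a \<sigma> x = lX (prN N (permute (M k) \<sigma> x))" for \<sigma> x
    let ?w = "ennreal (1 / fact (M k))"
    have ai: "integrable (Q k) (a \<sigma>)" if "\<sigma> \<in> perms (M k)" for \<sigma>
      unfolding a_def[abs_def] by (rule ball_lX_integrable[OF Q NM li(1) that])
    have lp: "(\<lambda>x. lX (prN N x)) \<in> borel_measurable (spaceM (M k))" by (rule measurable_compose[OF measurable_prN[OF NM] lX_measurable])
    \<comment> \<open>The law of the plan is available for nonnegative functions, so integrability
      and the mean are obtained from positive and negative parts separately.\<close>
    have pos: "(\<integral>\<^sup>+ z. ennreal (lX (prN N (fst z))) \<partial>\<mu> k) = (\<Sum>\<sigma>\<in>perms (M k). ?w * (\<integral>\<^sup>+ x. ennreal (a \<sigma> x) \<partial>Q k))"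
      unfolding a_def by (rule law[OF measurable_compose[OF lp measurable_ennreal]])
    have neg: "(\<integral>\<^sup>+ z. ennreal (- lX (prN N (fst z))) \<partial>\<mu> k) = (\<Sum>\<sigma>\<in>perms (M k). ?w * (\<integral>\<^sup>+ x. ennreal (- a \<sigma> x) \<partial>Q k))"
      unfolding a_def by (rule law[OF measurable_compose[OF borel_measurable_uminus[OF lp] measurable_ennreal]])
    have fin: "?w * (\<integral>\<^sup>+ x. ennreal (a \<sigma> x) \<partial>Q k) < top" "?w * (\<integral>\<^sup>+ x. ennreal (- a \<sigma> x) \<partial>Q k) < top"
      if "\<sigma> \<in> perms (M k)" for \<sigma>
      using integrableD(2,3)[OF ai[OF that]] by (auto simp: ennreal_mult_less_top less_top)
    have lm: "(\<lambda>z. lX (prN N (fst z))) \<in> borel_measurable (\<mu> k)" by (rule measurable_compose[OF Xm lX_measurable])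
    show il: "integrable (\<mu> k) (\<lambda>z. lX (prN N (fst z)))"
      unfolding real_integrable_def pos neg
      using lm fin finite_perms by (auto simp: less_top[symmetric])
    have r: "enn2real (\<Sum>\<sigma>\<in>perms (M k). ?w * f \<sigma>) = (\<Sum>\<sigma>\<in>perms (M k). enn2real (f \<sigma>)) / fact (M k)"
      if "\<And>\<sigma>. \<sigma> \<in> perms (M k) \<Longrightarrow> ?w * f \<sigma> < top" for f
    proof -
      have "enn2real (\<Sum>\<sigma>\<in>perms (M k). ?w * f \<sigma>) = (\<Sum>\<sigma>\<in>perms (M k). enn2real (?w * f \<sigma>))"
        using that by (subst enn2real_sum) (auto simp: comp_def)
      also have "\<dots> = (\<Sum>\<sigma>\<in>perms (M k). enn2real (f \<sigma>) / fact (M k))"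
        by (intro sum.cong refl) (simp add: enn2real_mult)
      finally show ?thesis by (simp add: sum_divide_distrib)
    qed
    have "(\<integral>x. lsym (M k) x \<partial>Q k) = (\<Sum>\<sigma>\<in>perms (M k). \<integral>x. a \<sigma> x \<partial>Q k) / fact (M k)"
    proof -
      have "lsym (M k) x = (\<Sum>\<sigma>\<in>perms (M k). a \<sigma> x) / fact (M k)" for x by (simp add: lsym_def a_def)
      then show ?thesis using ai by simp
    qed
    also have "\<dots> = ((\<Sum>\<sigma>\<in>perms (M k). enn2real (\<integral>\<^sup>+ x. ennreal (a \<sigma> x) \<partial>Q k))
        - (\<Sum>\<sigma>\<in>perms (M k). enn2real (\<integral>\<^sup>+ x. ennreal (- a \<sigma> x) \<partial>Q k))) / fact (M k)"
      using real_lebesgue_integral_def[OF ai] by (simp add: sum_subtractf)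
    also have "\<dots> = (\<integral>z. lX (prN N (fst z)) \<partial>\<mu> k)"
      unfolding real_lebesgue_integral_def[OF il] pos neg
      using r[OF fin(1)] r[OF fin(2)] by (simp add: diff_divide_distrib)
    finally show "v \<le> (\<integral>z. lX (prN N (fst z)) \<partial>\<mu> k)" using li(2)[of k] by simp
  next
    fix \<epsilon> :: real assume eps: "0 < \<epsilon>"
    define B where "B = K * (mom + (\<rho> + 1))"
    have B: "0 \<le> B" unfolding B_def using K_pos mom(2) \<rho>_pos by simp
    \<comment> \<open>Each coordinate has cost moment at most \<open>B\<close>, so the excess over
      \<open>A\<close> has integral at most \<open>\<eta> * N * B\<close>; the added 1 makes the
      denominator positive from \<open>0 \<le> B\<close> alone.\<close>
    define \<eta> where "\<eta> = \<epsilon> / (real N * B + 1)"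
    have den: "0 < real N * B + 1" using B by (simp add: add_nonneg_pos)
    have eta: "0 < \<eta>" unfolding \<eta>_def using eps den by simp
    obtain A where A: "0 \<le> A" "\<And>x. x \<in> tup N X \<Longrightarrow> l x \<le> A + \<eta> * (\<Sum>i<N. cX z0 (x i))"
      using growth_lt_absorb[OF gl eta] by blast
    have "(\<integral>\<^sup>+ z. ennreal (lX (prN N (fst z)) - A) \<partial>\<mu> k) \<le> ennreal \<epsilon>" for k
    proof -
      have iM: "i < M k" if "i < N" for i using that NM[of k] by simp
      have fm: "(\<integral>\<^sup>+ z. ennreal (cX z0 (fst z i)) \<partial>\<mu> k) \<le> ennreal B" if i: "i < N" for i
      proof -
        have c: "(\<integral>\<^sup>+ z. ennreal (cX (fst z i) (snd z i)) \<partial>\<mu> k) \<le> ennreal (\<rho> + 1)"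
          by (rule order_trans[OF cost[OF iM[OF i]]]) (auto intro!: ennreal_leI)
        show ?thesis unfolding B_def
          by (rule first_moments(1)[OF pf(1) plan_measurable(1)[OF pf(2) iM[OF i]] plan_measurable(3)[OF pf(2) iM[OF i]]
                pf(3)[OF iM[OF i]] pf(4)[OF iM[OF i]] pf(5)[OF iM[OF i]] c]) (use \<rho>_pos in simp)
      qed
      have m: "(\<lambda>z. ennreal (cX z0 (fst z i))) \<in> borel_measurable (\<mu> k)" if "i \<in> {..<N}" for i
      proof -
        have "i < N" using that by simp
        note plan_measurable(1)[OF pf(2) iM[OF this], measurable]
        show ?thesis by measurable
      qed
      have "(\<integral>\<^sup>+ z. ennreal (lX (prN N (fst z)) - A) \<partial>\<mu> k) \<le> (\<integral>\<^sup>+ z. ennreal \<eta> * (\<Sum>i<N. ennreal (cX z0 (fst z i))) \<partial>\<mu> k)"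
      proof (rule nn_integral_mono_AE)
        show "AE z in \<mu> k. ennreal (lX (prN N (fst z)) - A) \<le> ennreal \<eta> * (\<Sum>i<N. ennreal (cX z0 (fst z i)))"
          using pf(7)[OF NM]
        proof eventually_elim
          case (elim z)
          have "(\<Sum>i<N. cX z0 (prN N (fst z) i)) = (\<Sum>i<N. cX z0 (fst z i))" by (simp add: prN_def)
          then have "ennreal (lX (prN N (fst z)) - A) \<le> ennreal (\<eta> * (\<Sum>i<N. cX z0 (fst z i)))"
            using A(2)[OF elim] elim by (intro ennreal_leI) (simp add: lX_def)
          also have "\<dots> = ennreal \<eta> * (\<Sum>i<N. ennreal (cX z0 (fst z i)))"
            using eta cX_nonneg by (simp add: ennreal_mult sum_nonneg sum_ennreal)
          finally show ?case .
        qed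
      qed
      also have "\<dots> = ennreal \<eta> * (\<integral>\<^sup>+ z. (\<Sum>i<N. ennreal (cX z0 (fst z i))) \<partial>\<mu> k)"
        by (rule nn_integral_cmult[OF borel_measurable_sum[OF m]])
      also have "(\<integral>\<^sup>+ z. (\<Sum>i<N. ennreal (cX z0 (fst z i))) \<partial>\<mu> k) = (\<Sum>i<N. \<integral>\<^sup>+ z. ennreal (cX z0 (fst z i)) \<partial>\<mu> k)"
        using m by (rule nn_integral_sum)
      also have "ennreal \<eta> * \<dots> \<le> ennreal \<eta> * (\<Sum>i<N. ennreal B)" using fm by (intro mult_left_mono sum_mono) auto
      also have "\<dots> = ennreal (\<eta> * (real N * B))"
        using eta B by (simp add: ennreal_mult[symmetric] ennreal_of_nat_eq_real_of_nat)
      also have "\<dots> \<le> ennreal \<epsilon>"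
      proof (rule ennreal_leI)
        have "\<eta> * (real N * B) \<le> \<eta> * (real N * B + 1)" using eta by (intro mult_left_mono) auto
        also have "\<dots> = \<epsilon>" unfolding \<eta>_def using den by simp
        finally show "\<eta> * (real N * B) \<le> \<epsilon>" .
      qed
      finally show ?thesis .
    qed
    then show "\<exists>A\<ge>0. \<forall>k. (\<integral>\<^sup>+ z. ennreal (lX (prN N (fst z)) - A) \<partial>\<mu> k) \<le> ennreal \<epsilon>" using A(1) by blast
  qed
qed

end

theorem mainTheorem15:
  fixes X :: "'a::euclidean_space set" and c :: "'a \<Rightarrow> 'a \<Rightarrow> real"
    and Phat :: "'a measure" and \<rho> :: real and N :: nat
    and l :: "(nat \<Rightarrow> 'a) \<Rightarrow> real"
  assumes "X \<noteq> {}" and "closed X" and "convex X"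
    and "transport_cost X c" and "proper_cost X c"
    and "\<forall>x\<in>X. convex_on X (c x)"
    and "Phat \<in> probs_on borel X" and "finite_moment c X Phat"
    and "\<rho> > 0" and "N \<ge> 1"
    and "growth N X c l" and "usc_on (tup N X) l" and "concave_tup N X l"
  shows "S_val X c \<rho> Phat N l = (SUP Pb \<in> U_inf X c \<rho> Phat N. Exp_on (tup N X) Pb l)
         \<and> (growth_lt N X c l \<longrightarrow> (U_sym X c \<rho> Phat N l \<longlongrightarrow> S_val X c \<rho> Phat N l) sequentially)"
proof -
  interpret dro X c Phat \<rho> N l by unfold_locales (use assms in auto)
  have "S_val X c \<rho> Phat N l = (SUP Pb \<in> U_inf X c \<rho> Phat N. Exp_on (tup N X) Pb l)"
    by (intro antisym S_le_U_inf SUP_least U_inf_le_S)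
  moreover have "(U_sym X c \<rho> Phat N l \<longlongrightarrow> S_val X c \<rho> Phat N l) sequentially" if gl: "growth_lt N X c l"
  proof (rule order_tendstoI)
    fix a assume "a < S_val X c \<rho> Phat N l"
    then show "\<forall>\<^sub>F M in sequentially. a < U_sym X c \<rho> Phat N l M"
      unfolding eventually_sequentially by (intro exI[of _ N] allI impI less_le_trans[OF _ S_le_U_sym])
  next
    fix a assume a: "S_val X c \<rho> Phat N l < a"
    show "\<forall>\<^sub>F M in sequentially. U_sym X c \<rho> Phat N l M < a"
    proof (rule ccontr)
      assume neg: "\<not> (\<forall>\<^sub>F M in sequentially. U_sym X c \<rho> Phat N l M < a)"
      \<comment> \<open>A real number strictly in between: failure of the eventual bound puts
        \<open>U_sym\<close> above it for arbitrarily large \<open>M\<close>, and the frequency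
        lemma then contradicts the choice of \<open>v\<close>.\<close>
      obtain v where v: "S_val X c \<rho> Phat N l < ereal v" "ereal v < a" using ereal_dense2[OF a] by blast
      have "\<exists>M\<ge>m. ereal v < U_sym X c \<rho> Phat N l M" for m
      proof -
        obtain M where "m \<le> M" "a \<le> U_sym X c \<rho> Phat N l M"
          using neg unfolding eventually_sequentially by (meson not_less)
        then show ?thesis using less_le_trans[OF v(2)] by blast
      qed
      from U_sym_frequently_le_S[OF gl this] v(1) show False by simp
    qed
  qed
  ultimately show ?thesis by blast
qed

end
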